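(* For every core spanner $P$ over a finite alphabet $\Sigma$, the spanner relation $R^P$ can be maintained in $\mathsf{DynCQ}$.
   Context: Dynamic setting. Fix a finite alphabet $\Sigma$. A word-structure $\mathcal{W}$ has domain $D=\{1,\dots,n+1\}$ (for some $n\ge 0$), the natural linear order $<$ on $D$, a constant $\$$ interpreted as $n+1$, and for each $\zeta\in\Sigma$ a unary relation $R_\zeta\subseteq\{1,\dots,n\}$, where every position belongs to at most one $R_\zeta$. Write $w(i)=\zeta$ if $R_\zeta(i)$ holds and $w(i)=\varepsilon$ otherwise; the represented word is $w=w(1)w(2)\cdots w(n)$. Positions $i$ with $w(i)\neq\varepsilon$ are symbol-elements; for a symbol-element $x$, $\mathrm{pos}_w(x)$ is the number of symbol-elements $\le x$. The updates are $\mathsf{ins}_\zeta(i)$ (put $i$ into $R_\zeta$ and into no other $R_{\zeta'}$) and $\mathsf{reset}(i)$ (remove $i$ from all $R_\zeta$), for $i\in\{1,\dots,n\}$, and an update is only allowed if it changes the word-structure. Initially every position is $\varepsilon$. A dynamic program consists of finitely many auxiliary relations over $D$, each initialized on the initial structure by a first-order formula, and, for every auxiliary relation $R$ of arity $k$ and every abstract update $\mathsf{op}\in\{\mathsf{ins}_\zeta:\zeta\in\Sigma\}\cup\{\mathsf{reset}\}$, an update formula $\varphi^R_{\mathsf{op}}(y;x_1,\dots,x_k)$; after applying $\mathsf{op}$ at position $i$, the new $R$ is the set of $k$-tuples $\vec{j}$ such that $\varphi^R_{\mathsf{op}}(i;\vec j)$ holds in the structure formed by the updated word-structure and the old auxiliary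 relations. A dynamic program maintains a relation (defined over $D$ from the current word-structure) if a designated auxiliary relation equals it after every finite sequence of updates. $\mathsf{DynCQ}$ is the class of relations maintainable by dynamic programs whose update formulas are conjunctive queries (formulas built from atoms using only conjunction and existential quantification). Spanners. For a word $w=a_1\cdots a_n$, a span is $[i,j\rangle$ with $1\le i\le j\le n+1$, and $w_{[i,j\rangle}=a_i\cdots a_{j-1}$. For a finite set $V$ of variables, a $(V,w)$-tuple maps each variable in $V$ to a span of $w$; a spanner $P$ with variable set $\mathrm{SVars}(P)=V$ maps every $w\in\Sigma^*$ to a set $P(w)$ of $(V,w)$-tuples. A regex formula is a regular expression over $\Sigma$ that may additionally contain subexpressions $x\{\alpha\}$ for variables $x$; it generates ref-words over $\Sigma\cup\{\vdash_x,\dashv_x\}$ (with $x\{\alpha\}$ generating $\vdash_x r\dashv_x$ for $r$ generated by $\alpha$); it is functional if every generated ref-word contains $\vdash_x$ exactly once for each variable $x$ occurring in it. A functional regex formula $\alpha$ defines the spanner mapping $w$ to all tuples $\mu^r$ for ref-words $r$ generated by $\alpha$ whose deletion of all markers equals $w$, where for $r=r_1\vdash_x r_2\dashv_x r_3$ we set $\mu^r(x)=[|c(r_1)|+1,|c(r_1r_2)|+1\rangle$, $c$ deleting markers. Core spanners are the spanners obtained from spanners defined by functional regex formulas by finitely many applications of union $(P_1\cup P_2)(w)=P_1(w)\cup P_2(w)$ (same variables), projection $\pi_Y$ (restricting tuples to $Y$), natural join $\bowtie$ (tuples on $V_1\cup V_2$ whose restrictions lie in $P_1(w)$ and $P_2(w)$),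 and string-equality selection $\xi^=_{x,y}P(w)=\{\mu\in P(w): w_{\mu(x)}=w_{\mu(y)}\}$. Spanner relation. For a spanner $P$ with $\mathrm{SVars}(P)=\{x_1,\dots,x_k\}$ and a word-structure with word $w$, $R^P$ is the $2k$-ary relation over $D$ containing $(x_1^o,x_1^c,\dots,x_k^o,x_k^c)$ iff there is $\mu\in P(w)$ with $\mu(x_i)=[\mathrm{pos}_w(x_i^o),\mathrm{pos}_w(x_i^c)\rangle$ for all $i$, where a span endpoint equal to $|w|+1$ is represented by the element $\$$. A dynamic program maintains $P$ if it maintains $R^P$. *)

theory Defs
  imports Main
begin

section \<open>Word-structures and updates\<close>

text \<open>
  The alphabet is a type of class \<open>finite\<close>. A word-structure of domain \<open>{1..n + 1}\<close> is a list of
  length \<open>n\<close> whose \<open>i\<close>-th entry (counting from \<open>1\<close>) is \<open>Some \<zeta>\<close> if \<open>R\<^sub>\<zeta>(i)\<close> holds, and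
  \<open>None\<close> (the empty word) if \<open>i\<close> is in no \<open>R\<^sub>\<zeta>\<close>. Hence every list is a legal word-structure.
\<close>

type_synonym 'a wstruct = "'a option list"

definition ws_dom :: "'a wstruct \<Rightarrow> nat set" where
  "ws_dom W = {1..length W + 1}"

definition ws_dollar :: "'a wstruct \<Rightarrow> nat" where
  "ws_dollar W = length W + 1"

definition ws_rel :: "'a wstruct \<Rightarrow> 'a \<Rightarrow> nat set" where
  "ws_rel W \<zeta> = {i \<in> {1..length W}. W ! (i - 1) = Some \<zeta>}"

definition ws_word :: "'a wstruct \<Rightarrow> 'a list" where
  "ws_word W = map the (filter (\<lambda>s. s \<noteq> None) W)"

definition symbol_elements :: "'a wstruct \<Rightarrow> nat set" where
  "symbol_elements W = (\<Union>\<zeta>. ws_rel W \<zeta>)"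

definition pos :: "'a wstruct \<Rightarrow> nat \<Rightarrow> nat" where
  "pos W x = card {i \<in> symbol_elements W. i \<le> x}"

datatype 'a upd_op = Ins 'a | Reset

fun apply_op :: "'a upd_op \<Rightarrow> nat \<Rightarrow> 'a wstruct \<Rightarrow> 'a wstruct" where
  "apply_op (Ins \<zeta>) i W = W[i - 1 := Some \<zeta>]"
| "apply_op Reset i W = W[i - 1 := None]"

definition op_allowed :: "'a upd_op \<Rightarrow> nat \<Rightarrow> 'a wstruct \<Rightarrow> bool" where
  "op_allowed p i W \<longleftrightarrow> i \<in> {1..length W} \<and> apply_op p i W \<noteq> W"

section \<open>First-order formulas\<close>

datatype fo_term = Var nat | Dollar

text \<open>Auxiliary relation symbols are natural numbers.\<close>

datatype 'a fo =
    Sym 'a fo_term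
  | Less fo_term fo_term
  | Equal fo_term fo_term
  | Aux nat "fo_term list"
  | Neg "'a fo"
  | And "'a fo" "'a fo"
  | Or "'a fo" "'a fo"
  | Exists nat "'a fo"
  | Forall nat "'a fo"

fun term_val :: "'a wstruct \<Rightarrow> (nat \<Rightarrow> nat) \<Rightarrow> fo_term \<Rightarrow> nat" where
  "term_val W \<sigma> (Var v) = \<sigma> v"
| "term_val W \<sigma> Dollar = ws_dollar W"

fun sat :: "'a wstruct \<Rightarrow> (nat \<Rightarrow> nat list set) \<Rightarrow> (nat \<Rightarrow> nat) \<Rightarrow> 'a fo \<Rightarrow> bool" where
  "sat W A \<sigma> (Sym \<zeta> t) \<longleftrightarrow> term_val W \<sigma> t \<in> ws_rel W \<zeta>"
| "sat W A \<sigma> (Less s t) \<longleftrightarrow> term_val W \<sigma> s < term_val W \<sigma> t"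
| "sat W A \<sigma> (Equal s t) \<longleftrightarrow> term_val W \<sigma> s = term_val W \<sigma> t"
| "sat W A \<sigma> (Aux r ts) \<longleftrightarrow> map (term_val W \<sigma>) ts \<in> A r"
| "sat W A \<sigma> (Neg f) \<longleftrightarrow> \<not> sat W A \<sigma> f"
| "sat W A \<sigma> (And f g) \<longleftrightarrow> sat W A \<sigma> f \<and> sat W A \<sigma> g"
| "sat W A \<sigma> (Or f g) \<longleftrightarrow> sat W A \<sigma> f \<or> sat W A \<sigma> g"
| "sat W A \<sigma> (Exists v f) \<longleftrightarrow> (\<exists>d\<in>ws_dom W. sat W A (\<sigma>(v := d)) f)"
| "sat W A \<sigma> (Forall v f) \<longleftrightarrow> (\<forall>d\<in>ws_dom W. sat W A (\<sigma>(v := d)) f)"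

fun term_vars :: "fo_term \<Rightarrow> nat set" where
  "term_vars (Var v) = {v}"
| "term_vars Dollar = {}"

fun free_vars :: "'a fo \<Rightarrow> nat set" where
  "free_vars (Sym \<zeta> t) = term_vars t"
| "free_vars (Less s t) = term_vars s \<union> term_vars t"
| "free_vars (Equal s t) = term_vars s \<union> term_vars t"
| "free_vars (Aux r ts) = (\<Union>t\<in>set ts. term_vars t)"
| "free_vars (Neg f) = free_vars f"
| "free_vars (And f g) = free_vars f \<union> free_vars g"
| "free_vars (Or f g) = free_vars f \<union> free_vars g"
| "free_vars (Exists v f) = free_vars f - {v}"
| "free_vars (Forall v f) = free_vars f - {v}"

text \<open>\<open>wf_fo ar f\<close>: the auxiliary symbols of \<open>f\<close> are those below \<open>length ar\<close>, used with the
  arity given in \<open>ar\<close>. In particular \<open>wf_fo [] f\<close> says that \<open>f\<close> uses none.\<close>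

fun wf_fo :: "nat list \<Rightarrow> 'a fo \<Rightarrow> bool" where
  "wf_fo ar (Sym \<zeta> t) \<longleftrightarrow> True"
| "wf_fo ar (Less s t) \<longleftrightarrow> True"
| "wf_fo ar (Equal s t) \<longleftrightarrow> True"
| "wf_fo ar (Aux r ts) \<longleftrightarrow> r < length ar \<and> length ts = ar ! r"
| "wf_fo ar (Neg f) \<longleftrightarrow> wf_fo ar f"
| "wf_fo ar (And f g) \<longleftrightarrow> wf_fo ar f \<and> wf_fo ar g"
| "wf_fo ar (Or f g) \<longleftrightarrow> wf_fo ar f \<and> wf_fo ar g"
| "wf_fo ar (Exists v f) \<longleftrightarrow> wf_fo ar f"
| "wf_fo ar (Forall v f) \<longleftrightarrow> wf_fo ar f"

fun is_cq :: "'a fo \<Rightarrow> bool" where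
  "is_cq (Sym \<zeta> t) \<longleftrightarrow> True"
| "is_cq (Less s t) \<longleftrightarrow> True"
| "is_cq (Equal s t) \<longleftrightarrow> True"
| "is_cq (Aux r ts) \<longleftrightarrow> True"
| "is_cq (Neg f) \<longleftrightarrow> False"
| "is_cq (And f g) \<longleftrightarrow> is_cq f \<and> is_cq g"
| "is_cq (Or f g) \<longleftrightarrow> False"
| "is_cq (Exists v f) \<longleftrightarrow> is_cq f"
| "is_cq (Forall v f) \<longleftrightarrow> False"

section \<open>Dynamic programs\<close>

text \<open>
  The auxiliary relations are \<open>0, \<dots>, length (aux_arity \<Pi>) - 1\<close>. In an initialization formula
  \<open>\<psi>(x\<^sub>1, \<dots>, x\<^sub>k)\<close> the variable \<open>x\<^sub>l\<close> is \<open>Var (l - 1)\<close>; in an update formula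
  \<open>\<phi>(y; x\<^sub>1, \<dots>, x\<^sub>k)\<close> the variable \<open>y\<close> is \<open>Var 0\<close> and \<open>x\<^sub>l\<close> is \<open>Var l\<close>.
\<close>

record 'a dynprog =
  aux_arity :: "nat list"
  init_fo :: "nat \<Rightarrow> 'a fo"
  update_fo :: "nat \<Rightarrow> 'a upd_op \<Rightarrow> 'a fo"

definition wf_dynprog :: "'a dynprog \<Rightarrow> bool" where
  "wf_dynprog \<Pi> \<longleftrightarrow>
     (\<forall>r < length (aux_arity \<Pi>).
        wf_fo [] (init_fo \<Pi> r) \<and>
        free_vars (init_fo \<Pi> r) \<subseteq> {..<aux_arity \<Pi> ! r} \<and>
        (\<forall>p. wf_fo (aux_arity \<Pi>) (update_fo \<Pi> r p) \<and>
             free_vars (update_fo \<Pi> r p) \<subseteq> {..aux_arity \<Pi> ! r}))"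

definition cq_dynprog :: "'a dynprog \<Rightarrow> bool" where
  "cq_dynprog \<Pi> \<longleftrightarrow> (\<forall>r < length (aux_arity \<Pi>). \<forall>p. is_cq (update_fo \<Pi> r p))"

definition tuples :: "nat \<Rightarrow> 'a wstruct \<Rightarrow> nat list set" where
  "tuples k W = {js. length js = k \<and> set js \<subseteq> ws_dom W}"

definition init_ws :: "nat \<Rightarrow> 'a wstruct" where
  "init_ws n = replicate n None"

definition init_aux :: "'a dynprog \<Rightarrow> nat \<Rightarrow> nat \<Rightarrow> nat list set" where
  "init_aux \<Pi> n r =
     (if r < length (aux_arity \<Pi>)
      then {js \<in> tuples (aux_arity \<Pi> ! r) (init_ws n :: 'a wstruct).
              sat (init_ws n) (\<lambda>_. {}) (\<lambda>v. js ! v) (init_fo \<Pi> r)}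
      else {})"

text \<open>\<open>W'\<close> is the updated word-structure, \<open>A\<close> the old auxiliary relations.\<close>

definition update_aux ::
  "'a dynprog \<Rightarrow> 'a upd_op \<Rightarrow> nat \<Rightarrow> 'a wstruct \<Rightarrow> (nat \<Rightarrow> nat list set) \<Rightarrow> nat \<Rightarrow> nat list set" where
  "update_aux \<Pi> p i W' A r =
     (if r < length (aux_arity \<Pi>)
      then {js \<in> tuples (aux_arity \<Pi> ! r) W'. sat W' A (\<lambda>v. (i # js) ! v) (update_fo \<Pi> r p)}
      else {})"

inductive reachable :: "'a dynprog \<Rightarrow> 'a wstruct \<Rightarrow> (nat \<Rightarrow> nat list set) \<Rightarrow> bool"
  for \<Pi> :: "'a dynprog" where
  initial: "reachable \<Pi> (init_ws n) (init_aux \<Pi> n)"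
| update: "reachable \<Pi> W A \<Longrightarrow> op_allowed p i W \<Longrightarrow>
    reachable \<Pi> (apply_op p i W) (update_aux \<Pi> p i (apply_op p i W) A)"

definition maintains :: "'a dynprog \<Rightarrow> nat \<Rightarrow> ('a wstruct \<Rightarrow> nat list set) \<Rightarrow> bool" where
  "maintains \<Pi> k Q \<longleftrightarrow>
     (\<exists>r < length (aux_arity \<Pi>). aux_arity \<Pi> ! r = k \<and>
        (\<forall>W A. reachable \<Pi> W A \<longrightarrow> A r = Q W))"

definition DynCQ :: "nat \<Rightarrow> ('a wstruct \<Rightarrow> nat list set) set" where
  "DynCQ k = {Q. \<exists>\<Pi>. wf_dynprog \<Pi> \<and> cq_dynprog \<Pi> \<and> maintains \<Pi> k Q}"

section \<open>Regex formulas\<close>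

text \<open>The span \<open>[i,j\<rangle>\<close> is the pair \<open>(i, j)\<close>; a \<open>(V,w)\<close>-tuple is a map with domain \<open>V\<close>.\<close>

type_synonym span = "nat \<times> nat"

type_synonym ('a, 'v) spanner_fun = "'a list \<Rightarrow> ('v \<rightharpoonup> span) set"

fun factor :: "'a list \<Rightarrow> span \<Rightarrow> 'a list" where
  "factor w (i, j) = take (j - i) (drop (i - 1) w)"

datatype ('a, 'v) regex_formula =
    RNone
  | REps
  | RSym 'a
  | RAlt "('a, 'v) regex_formula" "('a, 'v) regex_formula"
  | RConc "('a, 'v) regex_formula" "('a, 'v) regex_formula"
  | RStar "('a, 'v) regex_formula"
  | RBind 'v "('a, 'v) regex_formula"

datatype ('a, 'v) ref_symbol = Letter 'a | Open 'v | Close 'v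

fun ref_words :: "('a, 'v) regex_formula \<Rightarrow> ('a, 'v) ref_symbol list set" where
  "ref_words RNone = {}"
| "ref_words REps = {[]}"
| "ref_words (RSym a) = {[Letter a]}"
| "ref_words (RAlt \<alpha> \<beta>) = ref_words \<alpha> \<union> ref_words \<beta>"
| "ref_words (RConc \<alpha> \<beta>) = {r @ s | r s. r \<in> ref_words \<alpha> \<and> s \<in> ref_words \<beta>}"
| "ref_words (RStar \<alpha>) = {concat rs | rs. set rs \<subseteq> ref_words \<alpha>}"
| "ref_words (RBind x \<alpha>) = {Open x # r @ [Close x] | r. r \<in> ref_words \<alpha>}"

fun regex_vars :: "('a, 'v) regex_formula \<Rightarrow> 'v set" where
  "regex_vars RNone = {}"
| "regex_vars REps = {}"
| "regex_vars (RSym a) = {}"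
| "regex_vars (RAlt \<alpha> \<beta>) = regex_vars \<alpha> \<union> regex_vars \<beta>"
| "regex_vars (RConc \<alpha> \<beta>) = regex_vars \<alpha> \<union> regex_vars \<beta>"
| "regex_vars (RStar \<alpha>) = regex_vars \<alpha>"
| "regex_vars (RBind x \<alpha>) = insert x (regex_vars \<alpha>)"

definition functional :: "('a, 'v) regex_formula \<Rightarrow> bool" where
  "functional \<alpha> \<longleftrightarrow> (\<forall>r \<in> ref_words \<alpha>. \<forall>x \<in> regex_vars \<alpha>. count_list r (Open x) = 1)"

fun clr :: "('a, 'v) ref_symbol list \<Rightarrow> 'a list" where
  "clr [] = []"
| "clr (Letter a # r) = a # clr r"
| "clr (Open x # r) = clr r"
| "clr (Close x # r) = clr r"

text \<open>For a ref-word \<open>r\<close> of a functional regex formula with variables \<open>V\<close> the decomposition of \<open>r\<close>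
  below is unique for each \<open>x \<in> V\<close>, so exactly one \<open>\<mu>\<close> satisfies \<open>is_ref_tuple V r \<mu>\<close>.\<close>

definition is_ref_tuple :: "'v set \<Rightarrow> ('a, 'v) ref_symbol list \<Rightarrow> ('v \<rightharpoonup> span) \<Rightarrow> bool" where
  "is_ref_tuple V r \<mu> \<longleftrightarrow> dom \<mu> = V \<and>
     (\<forall>x\<in>V. \<exists>r1 r2 r3. r = r1 @ [Open x] @ r2 @ [Close x] @ r3 \<and>
        \<mu> x = Some (length (clr r1) + 1, length (clr (r1 @ r2)) + 1))"

definition regex_spanner :: "('a, 'v) regex_formula \<Rightarrow> ('a, 'v) spanner_fun" where
  "regex_spanner \<alpha> w =
     {\<mu>. \<exists>r \<in> ref_words \<alpha>. clr r = w \<and> is_ref_tuple (regex_vars \<alpha>) r \<mu>}"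

section \<open>Core spanners and spanner relations\<close>

text \<open>\<open>core_spanner V P\<close>: \<open>P\<close> is a core spanner with variable set \<open>V\<close>. The variable set has to be
  carried along since \<open>P\<close> does not determine it when it yields no tuples.\<close>

inductive core_spanner :: "'v set \<Rightarrow> ('a, 'v) spanner_fun \<Rightarrow> bool" where
  regex: "functional \<alpha> \<Longrightarrow> core_spanner (regex_vars \<alpha>) (regex_spanner \<alpha>)"
| union: "core_spanner V P1 \<Longrightarrow> core_spanner V P2 \<Longrightarrow>
    core_spanner V (\<lambda>w. P1 w \<union> P2 w)"
| projection: "core_spanner V P \<Longrightarrow> Y \<subseteq> V \<Longrightarrow>
    core_spanner Y (\<lambda>w. (\<lambda>\<mu>. \<mu> |` Y) ` P w)"
| join: "core_spanner V1 P1 \<Longrightarrow> core_spanner V2 P2 \<Longrightarrow>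
    core_spanner (V1 \<union> V2)
      (\<lambda>w. {\<mu>. dom \<mu> = V1 \<union> V2 \<and> \<mu> |` V1 \<in> P1 w \<and> \<mu> |` V2 \<in> P2 w})"
| selection: "core_spanner V P \<Longrightarrow> x \<in> V \<Longrightarrow> y \<in> V \<Longrightarrow>
    core_spanner V (\<lambda>w. {\<mu> \<in> P w. factor w (the (\<mu> x)) = factor w (the (\<mu> y))})"

definition endpoint_elements :: "'a wstruct \<Rightarrow> nat set" where
  "endpoint_elements W = insert (ws_dollar W) (symbol_elements W)"

definition endpoint_pos :: "'a wstruct \<Rightarrow> nat \<Rightarrow> nat" where
  "endpoint_pos W x = (if x = ws_dollar W then length (ws_word W) + 1 else pos W x)"

text \<open>The list \<open>xs\<close> enumerates the variables of \<open>P\<close>; the tuple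
  \<open>(x\<^sub>1\<^sup>o, x\<^sub>1\<^sup>c, \<dots>, x\<^sub>k\<^sup>o, x\<^sub>k\<^sup>c)\<close> is the list \<open>js\<close>.\<close>

definition spanner_rel ::
  "'v list \<Rightarrow> ('a, 'v) spanner_fun \<Rightarrow> 'a wstruct \<Rightarrow> nat list set" where
  "spanner_rel xs P W =
     {js. length js = 2 * length xs \<and> set js \<subseteq> endpoint_elements W \<and>
        (\<exists>\<mu> \<in> P (ws_word W). \<forall>i < length xs.
           \<mu> (xs ! i) = Some (endpoint_pos W (js ! (2 * i)), endpoint_pos W (js ! (2 * i + 1))))}"

end

theory Submission imports Defs begin

text \<open>
  All relations are stated for intervals of positions instead of spans, so that an update at position
  \<open>i\<close> only cuts the intervals containing \<open>i\<close>. Two kinds of relations then suffice: equality of the words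
  of two intervals, which is maintained by matching the pieces left and right of \<open>i\<close> with pieces of the
  other interval, and, for a regular language, the states to which an automaton moves when it reads an
  interval. A functional regex formula is positively and existentially definable from these by recursion on
  its syntax: functionality rules out variables below a star, a concatenation guesses the position
  where the word is split, and a variable binding compares positions. Union, projection, join and selection
  become disjunction, existential quantification, conjunction and an atom for interval equality.
  A query that is definable in this way from maintained relations is maintained as well, and disjunctions
  are removed from the update formulas by coding truth values as elements of the domain.
\<close>

section \<open>Positive existential queries\<close>

text \<open>Inserting one symbol shifts the span endpoints of every later symbol, whereas positions
  keep their place. This is why queries on positions are maintained, and only the final query
  restricts the tuples to endpoint elements. Two features of the setting shape the rest. An update
  formula is evaluated over the new word-structure and the old auxiliary relations, so whatever is
  needed of the old structure, including its letters, has to be stored. And only update formulas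
  have to be conjunctive, whereas initialization is first-order: the successor relation, the first
  position and the truth table of the disjunction are created there and then carried along
  unchanged. Coding truth values takes two distinct elements. A domain with a single element causes
  no trouble, because it admits no update.\<close>

type_synonym 'a query = "'a wstruct \<Rightarrow> nat list \<Rightarrow> bool"

datatype 'a pf =
    PTrue
  | PFalse
  | PAtom nat "'a query" "nat list"
  | PAnd "'a pf" "'a pf"
  | POr "'a pf" "'a pf"
  | PEx nat "'a pf"

fun psat :: "'a wstruct \<Rightarrow> (nat \<Rightarrow> nat) \<Rightarrow> 'a pf \<Rightarrow> bool" where
  "psat W \<sigma> PTrue \<longleftrightarrow> True"
| "psat W \<sigma> PFalse \<longleftrightarrow> False"
| "psat W \<sigma> (PAtom k Q vs) \<longleftrightarrow> Q W (map \<sigma> vs)"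
| "psat W \<sigma> (PAnd f g) \<longleftrightarrow> psat W \<sigma> f \<and> psat W \<sigma> g"
| "psat W \<sigma> (POr f g) \<longleftrightarrow> psat W \<sigma> f \<or> psat W \<sigma> g"
| "psat W \<sigma> (PEx v f) \<longleftrightarrow> (\<exists>d\<in>ws_dom W. psat W (\<sigma>(v := d)) f)"

fun pwf :: "(nat \<times> 'a query) set \<Rightarrow> 'a pf \<Rightarrow> bool" where
  "pwf F PTrue \<longleftrightarrow> True"
| "pwf F PFalse \<longleftrightarrow> True"
| "pwf F (PAtom k Q vs) \<longleftrightarrow> (k, Q) \<in> F \<and> length vs = k"
| "pwf F (PAnd f g) \<longleftrightarrow> pwf F f \<and> pwf F g"
| "pwf F (POr f g) \<longleftrightarrow> pwf F f \<and> pwf F g"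
| "pwf F (PEx v f) \<longleftrightarrow> pwf F f"

definition in_dom :: "'a wstruct \<Rightarrow> (nat \<Rightarrow> nat) \<Rightarrow> bool" where
  "in_dom W \<sigma> \<longleftrightarrow> (\<forall>v. \<sigma> v \<in> ws_dom W)"

lemma in_dom_upd [simp]: "in_dom W \<sigma> \<Longrightarrow> d \<in> ws_dom W \<Longrightarrow> in_dom W (\<sigma>(v := d))"
  by (simp add: in_dom_def)

lemma in_dom_comp: "in_dom W \<sigma> \<Longrightarrow> in_dom W (\<sigma> \<circ> f)"
  by (simp add: in_dom_def)

lemma in_dom_bounds: "in_dom W \<sigma> \<Longrightarrow> 1 \<le> \<sigma> v \<and> \<sigma> v \<le> Suc (length W)"
  by (simp add: in_dom_def ws_dom_def)

lemma pwf_mono: "pwf F \<phi> \<Longrightarrow> F \<subseteq> G \<Longrightarrow> pwf G \<phi>"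
  by (induction \<phi>) auto

text \<open>Definability is a property of predicates on valuations, so that concrete formulas rarely
  have to be written down. Valuations are confined to the domain because stored relations contain
  only tuples over it.\<close>

definition fdef ::
  "(nat \<times> 'a query) set \<Rightarrow> ('a wstruct \<Rightarrow> (nat \<Rightarrow> nat) \<Rightarrow> bool) \<Rightarrow> bool" where
  "fdef F X \<longleftrightarrow> (\<exists>\<phi>. pwf F \<phi> \<and> (\<forall>W \<sigma>. in_dom W \<sigma> \<longrightarrow> (X W \<sigma> \<longleftrightarrow> psat W \<sigma> \<phi>)))"

lemma fdef_mono: "fdef F X \<Longrightarrow> F \<subseteq> G \<Longrightarrow> fdef G X"
  unfolding fdef_def using pwf_mono by blast

lemma fdef_cong:
  assumes "fdef F X" "\<And>W \<sigma>. in_dom W \<sigma> \<Longrightarrow> Y W \<sigma> \<longleftrightarrow> X W \<sigma>"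
  shows "fdef F Y"
  using assms unfolding fdef_def by metis

lemma fdef_atom: "(k, Q) \<in> F \<Longrightarrow> length vs = k \<Longrightarrow> fdef F (\<lambda>W \<sigma>. Q W (map \<sigma> vs))"
  unfolding fdef_def by (rule exI[of _ "PAtom k Q vs"]) simp

lemma fdef_const: "fdef F (\<lambda>W \<sigma>. c)"
  unfolding fdef_def by (rule exI[of _ "if c then PTrue else PFalse"]) simp

lemma fdef_and:
  assumes "fdef F X" "fdef F Y"
  shows "fdef F (\<lambda>W \<sigma>. X W \<sigma> \<and> Y W \<sigma>)"
proof -
  from assms obtain f g where "pwf F f" "pwf F g"
    "\<And>W \<sigma>. in_dom W \<sigma> \<Longrightarrow> X W \<sigma> = psat W \<sigma> f" "\<And>W \<sigma>. in_dom W \<sigma> \<Longrightarrow> Y W \<sigma> = psat W \<sigma> g"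
    unfolding fdef_def by blast
  then show ?thesis unfolding fdef_def by (intro exI[of _ "PAnd f g"]) simp
qed

lemma fdef_or:
  assumes "fdef F X" "fdef F Y"
  shows "fdef F (\<lambda>W \<sigma>. X W \<sigma> \<or> Y W \<sigma>)"
proof -
  from assms obtain f g where "pwf F f" "pwf F g"
    "\<And>W \<sigma>. in_dom W \<sigma> \<Longrightarrow> X W \<sigma> = psat W \<sigma> f" "\<And>W \<sigma>. in_dom W \<sigma> \<Longrightarrow> Y W \<sigma> = psat W \<sigma> g"
    unfolding fdef_def by blast
  then show ?thesis unfolding fdef_def by (intro exI[of _ "POr f g"]) simp
qed

lemma fdef_ex:
  assumes "fdef F X"
  shows "fdef F (\<lambda>W \<sigma>. \<exists>d\<in>ws_dom W. X W (\<sigma>(v := d)))"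
proof -
  from assms obtain f where "pwf F f" "\<And>W \<sigma>. in_dom W \<sigma> \<Longrightarrow> X W \<sigma> = psat W \<sigma> f"
    unfolding fdef_def by blast
  then show ?thesis unfolding fdef_def by (intro exI[of _ "PEx v f"]) simp
qed

lemma fdef_Bex:
  assumes "finite S" "\<And>s. s \<in> S \<Longrightarrow> fdef F (X s)"
  shows "fdef F (\<lambda>W \<sigma>. \<exists>s\<in>S. X s W \<sigma>)"
  using assms
proof (induction S rule: finite_induct)
  case empty
  show ?case by (simp add: fdef_const)
next
  case (insert s S)
  then show ?case by (simp add: fdef_or)
qed

text \<open>A projection discards a whole set of spanner variables at once. The quantifier block is
  therefore a second valuation that may differ on \<open>Z\<close>.\<close>

lemma fdef_exs:
  fixes X :: "'a wstruct \<Rightarrow> (nat \<Rightarrow> nat) \<Rightarrow> bool"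
  assumes "finite Z" "fdef F X"
  shows "fdef F (\<lambda>W \<sigma>. \<exists>\<tau>. in_dom W \<tau> \<and> (\<forall>v. v \<notin> Z \<longrightarrow> \<tau> v = \<sigma> v) \<and> X W \<tau>)"
  using assms(1)
proof (induction Z rule: finite_induct)
  case empty
  show ?case
  proof (rule fdef_cong[OF assms(2)])
    fix W :: "'a wstruct" and \<sigma> :: "nat \<Rightarrow> nat"
    assume "in_dom W \<sigma>"
    moreover have "(\<forall>v. v \<notin> {} \<longrightarrow> \<tau> v = \<sigma> v) \<longleftrightarrow> \<tau> = \<sigma>" for \<tau>
      by auto
    ultimately show "(\<exists>\<tau>. in_dom W \<tau> \<and> (\<forall>v. v \<notin> {} \<longrightarrow> \<tau> v = \<sigma> v) \<and> X W \<tau>) \<longleftrightarrow> X W \<sigma>"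
      by metis
  qed
next
  case (insert z Z)
  have "fdef F (\<lambda>W \<sigma>. \<exists>d\<in>ws_dom W. \<exists>\<tau>. in_dom W \<tau> \<and> (\<forall>v. v \<notin> Z \<longrightarrow> \<tau> v = (\<sigma>(z := d)) v) \<and> X W \<tau>)"
    using fdef_ex[OF insert.IH, of z] .
  then show ?case
  proof (rule fdef_cong)
    fix W :: "'a wstruct" and \<sigma> :: "nat \<Rightarrow> nat"
    assume "in_dom W \<sigma>"
    show "(\<exists>\<tau>. in_dom W \<tau> \<and> (\<forall>v. v \<notin> insert z Z \<longrightarrow> \<tau> v = \<sigma> v) \<and> X W \<tau>) \<longleftrightarrow>
      (\<exists>d\<in>ws_dom W. \<exists>\<tau>. in_dom W \<tau> \<and> (\<forall>v. v \<notin> Z \<longrightarrow> \<tau> v = (\<sigma>(z := d)) v) \<and> X W \<tau>)"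
      (is "?L \<longleftrightarrow> ?R")
    proof
      assume ?L
      then obtain \<tau> where "in_dom W \<tau>" "\<forall>v. v \<notin> insert z Z \<longrightarrow> \<tau> v = \<sigma> v" "X W \<tau>"
        by blast
      moreover from this have "\<forall>v. v \<notin> Z \<longrightarrow> \<tau> v = (\<sigma>(z := \<tau> z)) v" "\<tau> z \<in> ws_dom W"
        by (auto simp: in_dom_def)
      ultimately show ?R by blast
    next
      assume ?R
      then show ?L using insert.hyps(2) by (metis fun_upd_apply insert_iff)
    qed
  qed
qed

section \<open>Renaming and substitution in positive existential formulas\<close>

lemma pf_rename:
  assumes "\<And>v. g v < N"
  shows "\<exists>\<psi>. (\<forall>F. pwf F \<psi> \<longleftrightarrow> pwf F \<phi>) \<and> (\<forall>W \<sigma>. psat W \<sigma> \<psi> \<longleftrightarrow> psat W (\<sigma> \<circ> g) \<phi>)"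
    (is "\<exists>\<psi>. ?ok g \<phi> \<psi>")
  using assms
proof (induction \<phi> arbitrary: g N)
  case PTrue
  show ?case by (rule exI[of _ PTrue]) simp
next
  case PFalse
  show ?case by (rule exI[of _ PFalse]) simp
next
  case (PAtom k Q vs)
  show ?case by (rule exI[of _ "PAtom k Q (map g vs)"]) (simp add: comp_def)
next
  case (PAnd f1 f2)
  obtain p1 where "?ok g f1 p1" using PAnd.IH(1)[where g = g, OF PAnd.prems] by (elim exE)
  moreover obtain p2 where "?ok g f2 p2" using PAnd.IH(2)[where g = g, OF PAnd.prems] by (elim exE)
  ultimately show ?case by (intro exI[of _ "PAnd p1 p2"]) simp
next
  case (POr f1 f2)
  obtain p1 where "?ok g f1 p1" using POr.IH(1)[where g = g, OF POr.prems] by (elim exE)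
  moreover obtain p2 where "?ok g f2 p2" using POr.IH(2)[where g = g, OF POr.prems] by (elim exE)
  ultimately show ?case by (intro exI[of _ "POr p1 p2"]) simp
next
  case (PEx v f)
  \<comment> \<open>\<open>N\<close> bounds the range of \<open>g\<close>, so it is a fresh name for
    the bound variable and nothing is captured.\<close>
  have "(g(v := N)) u < Suc N" for u
    using PEx.prems[of u] by simp
  from PEx.IH[where g = "g(v := N)", OF this] obtain p where p: "?ok (g(v := N)) f p" by (elim exE)
  have eq: "\<sigma>(N := d) \<circ> g(v := N) = (\<sigma> \<circ> g)(v := d)" for \<sigma> :: "nat \<Rightarrow> nat" and d
    using PEx.prems by (fastforce simp: fun_eq_iff)
  have "psat W (\<sigma>(N := d)) p \<longleftrightarrow> psat W ((\<sigma> \<circ> g)(v := d)) f" for W \<sigma> d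
    using p eq[of \<sigma> d] by metis
  with conjunct1[OF p] show ?case by (intro exI[of _ "PEx N p"]) (simp add: comp_def)
qed

text \<open>The relation \<open>Ctx W1 W2 \<sigma>\<close> says which new structure \<open>W1\<close> is described over which old
  structure \<open>W2\<close>; the variables below \<open>s\<close> are parameters of that description.\<close>

lemma pf_compose:
  assumes "pwf F \<phi>"
    and def: "\<And>k Q. (k, Q) \<in> F \<Longrightarrow> \<exists>\<psi>. pwf G \<psi> \<and>
      (\<forall>W1 W2 \<sigma>. Ctx W1 W2 \<sigma> \<longrightarrow> in_dom W2 \<sigma> \<longrightarrow> (Q W1 (map \<sigma> [s..<s + k]) \<longleftrightarrow> psat W2 \<sigma> \<psi>))"
    and dom: "\<And>W1 W2 \<sigma>. Ctx W1 W2 \<sigma> \<Longrightarrow> ws_dom W1 = ws_dom W2"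
    and local: "\<And>W1 W2 \<sigma> \<tau>. Ctx W1 W2 \<sigma> \<Longrightarrow> (\<And>u. u < s \<Longrightarrow> \<tau> u = \<sigma> u) \<Longrightarrow> Ctx W1 W2 \<tau>"
    and "\<And>v. f v < N" "s \<le> N"
  shows "\<exists>\<psi>. pwf G \<psi> \<and>
    (\<forall>W1 W2 \<sigma>. Ctx W1 W2 \<sigma> \<longrightarrow> in_dom W2 \<sigma> \<longrightarrow> (psat W1 (\<sigma> \<circ> f) \<phi> \<longleftrightarrow> psat W2 \<sigma> \<psi>))"
    (is "\<exists>\<psi>. ?ok f \<phi> \<psi>")
  using assms(1) assms(5,6)
proof (induction \<phi> arbitrary: f N)
  case PTrue
  show ?case by (rule exI[of _ PTrue]) simp
next
  case PFalse
  show ?case by (rule exI[of _ PFalse]) simp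
next
  case (PAtom k Q vs)
  then have F: "(k, Q) \<in> F" and len: "length vs = k" by auto
  from def[OF F] obtain \<psi> where \<psi>: "pwf G \<psi>"
    "\<And>W1 W2 \<sigma>. Ctx W1 W2 \<sigma> \<Longrightarrow> in_dom W2 \<sigma> \<Longrightarrow> Q W1 (map \<sigma> [s..<s + k]) = psat W2 \<sigma> \<psi>"
    by blast
  \<comment> \<open>The definition of the atom has the formal arguments \<open>s\<close>, ...,
    \<open>s + k - 1\<close>. \<open>g\<close> sends them to the actual ones and fixes the
    parameters; the default 0 keeps \<open>g\<close> bounded.\<close>
  define g where "g u = (if u < s then u else if u < s + k then f (vs ! (u - s)) else 0)" for u
  have "g u < Suc N" for u
    using PAtom.prems(2)[of "vs ! (u - s)"] PAtom.prems(3) by (auto simp: g_def)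
  from pf_rename[where g = g, OF this, of \<psi>] obtain \<psi>' where \<psi>': "pwf G \<psi>' = pwf G \<psi>"
    "\<And>W \<sigma>. psat W \<sigma> \<psi>' = psat W (\<sigma> \<circ> g) \<psi>" by blast
  show ?case
  proof (intro exI[of _ \<psi>'] conjI allI impI)
    show "pwf G \<psi>'" using \<psi> \<psi>' by simp
    fix W1 W2 \<sigma> assume c: "Ctx W1 W2 \<sigma>" "in_dom W2 \<sigma>"
    have "map (\<sigma> \<circ> g) [s..<s + k] = map (\<sigma> \<circ> f) vs"
      using len by (auto simp: g_def intro: nth_equalityI)
    moreover have "Ctx W1 W2 (\<sigma> \<circ> g)"
      using local[OF c(1)] by (simp add: g_def)
    ultimately show "psat W1 (\<sigma> \<circ> f) (PAtom k Q vs) \<longleftrightarrow> psat W2 \<sigma> \<psi>'"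
      using \<psi>(2)[of W1 W2 "\<sigma> \<circ> g"] in_dom_comp[OF c(2)] by (simp add: \<psi>')
  qed
next
  case (PAnd f1 f2)
  then have wf: "pwf F f1" "pwf F f2" by simp_all
  obtain p1 where "?ok f f1 p1" using PAnd.IH(1)[where f = f, OF wf(1) PAnd.prems(2,3)] by (elim exE)
  moreover obtain p2 where "?ok f f2 p2" using PAnd.IH(2)[where f = f, OF wf(2) PAnd.prems(2,3)] by (elim exE)
  ultimately show ?case by (intro exI[of _ "PAnd p1 p2"]) simp
next
  case (POr f1 f2)
  then have wf: "pwf F f1" "pwf F f2" by simp_all
  obtain p1 where "?ok f f1 p1" using POr.IH(1)[where f = f, OF wf(1) POr.prems(2,3)] by (elim exE)
  moreover obtain p2 where "?ok f f2 p2" using POr.IH(2)[where f = f, OF wf(2) POr.prems(2,3)] by (elim exE)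
  ultimately show ?case by (intro exI[of _ "POr p1 p2"]) simp
next
  case (PEx v \<phi>)
  have wf: "pwf F \<phi>" using PEx.prems by simp
  have bd: "(f(v := N)) u < Suc N" for u
    using PEx.prems(2)[of u] by simp
  obtain p where p: "pwf G p" "\<And>W1 W2 \<sigma>. Ctx W1 W2 \<sigma> \<Longrightarrow> in_dom W2 \<sigma> \<Longrightarrow>
      psat W1 (\<sigma> \<circ> f(v := N)) \<phi> \<longleftrightarrow> psat W2 \<sigma> p"
    using PEx.IH[where f = "f(v := N)", OF wf bd le_SucI[OF PEx.prems(3)]] by blast
  have eq: "\<sigma>(N := d) \<circ> f(v := N) = (\<sigma> \<circ> f)(v := d)" for \<sigma> :: "nat \<Rightarrow> nat" and d
    using PEx.prems(2) by (fastforce simp: fun_eq_iff)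
  show ?case
  proof (intro exI[of _ "PEx N p"] conjI allI impI)
    show "pwf G (PEx N p)" using p by simp
    fix W1 W2 \<sigma> assume c: "Ctx W1 W2 \<sigma>" "in_dom W2 \<sigma>"
    \<comment> \<open>Since \<open>s \<le> N\<close>, the quantified variable is not one of the
      parameters.\<close>
    have "Ctx W1 W2 (\<sigma>(N := d))" for d
      using local[OF c(1)] PEx.prems(3) by simp
    then have "psat W1 ((\<sigma> \<circ> f)(v := d)) \<phi> \<longleftrightarrow> psat W2 (\<sigma>(N := d)) p" if "d \<in> ws_dom W2" for d
      using p(2)[of W1 W2 "\<sigma>(N := d)"] c(2) that by (simp only: eq in_dom_upd)
    then show "psat W1 (\<sigma> \<circ> f) (PEx v \<phi>) \<longleftrightarrow> psat W2 \<sigma> (PEx N p)"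
      using dom[OF c(1)] by auto
  qed
qed

section \<open>Maintainable queries\<close>

definition q_lt :: "'a query" where "q_lt W js \<longleftrightarrow> js ! 0 < js ! 1"
definition q_eq :: "'a query" where "q_eq W js \<longleftrightarrow> js ! 0 = js ! 1"
definition q_succ :: "'a query" where "q_succ W js \<longleftrightarrow> js ! 1 = Suc (js ! 0)"
definition q_first :: "'a query" where "q_first W js \<longleftrightarrow> js ! 0 = 1"
definition q_dollar :: "'a query" where "q_dollar W js \<longleftrightarrow> js ! 0 = ws_dollar W"

text \<open>Defining the successor relation or the first position from the order takes a negation,
  so both are stored. All five queries depend at most on the size of the domain and thus survive
  every update.\<close>

definition statics :: "(nat \<times> 'a query) set" where
  "statics = {(2, q_lt), (2, q_eq), (2, q_succ), (1, q_first), (1, q_dollar)}"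

definition initializable :: "nat \<Rightarrow> 'a query \<Rightarrow> bool" where
  "initializable k Q \<longleftrightarrow> (\<exists>X. fdef (statics :: (nat \<times> 'a query) set) X \<and> (\<forall>n \<sigma>. in_dom (init_ws n :: 'a wstruct) \<sigma> \<longrightarrow>
     (Q (init_ws n) (map \<sigma> [0..<k]) \<longleftrightarrow> X (init_ws n :: 'a wstruct) \<sigma>)))"

text \<open>Variable \<open>0\<close> denotes the updated position, as in update formulas.\<close>

definition updatable :: "(nat \<times> 'a query) set \<Rightarrow> nat \<Rightarrow> 'a query \<Rightarrow> 'a upd_op \<Rightarrow> bool" where
  "updatable F k Q p \<longleftrightarrow> (\<exists>X. fdef F X \<and> (\<forall>W \<sigma>. in_dom W \<sigma> \<longrightarrow> op_allowed p (\<sigma> 0) W \<longrightarrow>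
     (Q (apply_op p (\<sigma> 0) W) (map \<sigma> [1..<1 + k]) \<longleftrightarrow> X W \<sigma>)))"

text \<open>A dynamic program before the removal of disjunctions: one auxiliary relation for each
  member, with positive existential update formulas over the members.\<close>

definition closed_family :: "(nat \<times> 'a query) set \<Rightarrow> bool" where
  "closed_family F \<longleftrightarrow> finite F \<and> statics \<subseteq> F \<and>
     (\<forall>k Q. (k, Q) \<in> F \<longrightarrow> initializable k Q \<and> (\<forall>p. updatable F k Q p))"

definition mdef :: "('a wstruct \<Rightarrow> (nat \<Rightarrow> nat) \<Rightarrow> bool) \<Rightarrow> bool" where
  "mdef X \<longleftrightarrow> (\<exists>F. closed_family F \<and> fdef F X)"

lemma length_apply_op [simp]: "length (apply_op p i W) = length W"
  by (cases p) auto

lemma ws_dom_apply_op [simp]: "ws_dom (apply_op p i W) = ws_dom W"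
  by (simp add: ws_dom_def)

lemma updatable_mono: "updatable F k Q p \<Longrightarrow> F \<subseteq> G \<Longrightarrow> updatable G k Q p"
  unfolding updatable_def using fdef_mono by blast

lemma closed_family_union:
  assumes "closed_family F" "closed_family G"
  shows "closed_family (F \<union> G)"
proof -
  have "finite (F \<union> G)" "statics \<subseteq> F \<union> G"
    using assms unfolding closed_family_def by (simp_all add: le_supI1)
  moreover have "initializable k Q \<and> (\<forall>p. updatable (F \<union> G) k Q p)" if "(k, Q) \<in> F \<union> G" for k Q
    using that assms updatable_mono[OF _ Un_upper1[of F G]] updatable_mono[OF _ Un_upper2[of G F]]
    unfolding closed_family_def by blast
  ultimately show ?thesis unfolding closed_family_def by blast
qed

text \<open>The definition of \<open>Q\<close> speaks about the new structure. Replacing each of its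
  atoms by the update formula of that atom turns it into a formula over the old structure. The
  initialization formula arises in the same way.\<close>

lemma closed_family_insert:
  assumes F: "closed_family F" and "fdef F X"
    and QX: "\<And>W \<sigma>. in_dom W \<sigma> \<Longrightarrow> Q W (map \<sigma> [0..<k]) \<longleftrightarrow> X W \<sigma>"
  shows "closed_family (insert (k, Q) F)"
proof -
  from assms(2) obtain \<phi> where \<phi>: "pwf F \<phi>" "\<And>W \<sigma>. in_dom W \<sigma> \<Longrightarrow> X W \<sigma> \<longleftrightarrow> psat W \<sigma> \<phi>"
    unfolding fdef_def by blast
  have Q\<phi>: "Q W (map \<sigma> [0..<k]) \<longleftrightarrow> psat W \<sigma> \<phi>" if "in_dom W \<sigma>" for W \<sigma>
    using QX \<phi> that by simp
  have "initializable k Q"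
  proof -
    define Ctx where "Ctx W1 W2 (\<sigma> :: nat \<Rightarrow> nat) \<longleftrightarrow> W1 = W2 \<and> (\<exists>n. W1 = (init_ws n :: 'a wstruct))"
      for W1 W2 \<sigma>
    define f where "f v = (if v < k then v else 0)" for v :: nat
    have "\<exists>\<psi>. pwf statics \<psi> \<and>
        (\<forall>W1 W2 \<sigma>. Ctx W1 W2 \<sigma> \<longrightarrow> in_dom W2 \<sigma> \<longrightarrow> (psat W1 (\<sigma> \<circ> f) \<phi> \<longleftrightarrow> psat W2 \<sigma> \<psi>))"
    proof (rule pf_compose[where s = 0 and N = "Suc k"])
      fix k' Q' assume "(k', Q') \<in> F"
      then have "initializable k' Q'"
        using F by (simp add: closed_family_def)
      then obtain X' and \<psi> :: "'a pf"
        where "pwf statics \<psi>" "\<And>W \<sigma>. in_dom W \<sigma> \<Longrightarrow> X' W \<sigma> \<longleftrightarrow> psat W \<sigma> \<psi>"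
          "\<And>n \<sigma>. in_dom (init_ws n :: 'a wstruct) \<sigma> \<Longrightarrow>
            Q' (init_ws n) (map \<sigma> [0..<k']) \<longleftrightarrow> X' (init_ws n) \<sigma>"
        unfolding initializable_def fdef_def by blast
      then show "\<exists>\<psi>. pwf statics \<psi> \<and> (\<forall>W1 W2 \<sigma>. Ctx W1 W2 \<sigma> \<longrightarrow> in_dom W2 \<sigma> \<longrightarrow>
          (Q' W1 (map \<sigma> [0..<0 + k']) \<longleftrightarrow> psat W2 \<sigma> \<psi>))"
        by (intro exI[of _ \<psi>]) (auto simp: Ctx_def)
    qed (use \<phi> in \<open>auto simp: Ctx_def f_def\<close>)
    then obtain \<psi> :: "'a pf" where \<psi>: "pwf statics \<psi>" "\<And>n \<sigma>. in_dom (init_ws n :: 'a wstruct) \<sigma> \<Longrightarrow>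
        psat (init_ws n) (\<sigma> \<circ> f) \<phi> \<longleftrightarrow> psat (init_ws n) \<sigma> \<psi>"
      unfolding Ctx_def by blast
    have "Q (init_ws n) (map \<sigma> [0..<k]) \<longleftrightarrow> psat (init_ws n) \<sigma> \<psi>"
      if "in_dom (init_ws n :: 'a wstruct) \<sigma>" for n \<sigma>
    proof -
      have "map (\<sigma> \<circ> f) [0..<k] = map \<sigma> [0..<k]" by (simp add: f_def)
      then show ?thesis
        using Q\<phi>[OF in_dom_comp[OF that, of f]] \<psi>(2)[OF that] by (simp only:)
    qed
    then show ?thesis
      unfolding initializable_def fdef_def using \<psi>(1) by (intro exI[of _ "\<lambda>W \<sigma>. psat W \<sigma> \<psi>"]) blast
  qed
  moreover have "updatable F k Q p" for p
  proof -
    define Ctx where "Ctx W1 W2 \<sigma> \<longleftrightarrow> op_allowed p (\<sigma> 0) W2 \<and> W1 = apply_op p (\<sigma> 0) W2"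
      for W1 W2 :: "'a wstruct" and \<sigma> :: "nat \<Rightarrow> nat"
    \<comment> \<open>The arguments of \<open>Q\<close> move up by one because variable 0 is the
      updated position, the only parameter (\<open>s = 1\<close>).\<close>
    define f where "f v = (if v < k then Suc v else 0)" for v :: nat
    have "\<exists>\<psi>. pwf F \<psi> \<and>
        (\<forall>W1 W2 \<sigma>. Ctx W1 W2 \<sigma> \<longrightarrow> in_dom W2 \<sigma> \<longrightarrow> (psat W1 (\<sigma> \<circ> f) \<phi> \<longleftrightarrow> psat W2 \<sigma> \<psi>))"
    proof (rule pf_compose[where s = 1 and N = "Suc (Suc k)"])
      fix k' Q' assume "(k', Q') \<in> F"
      then have "updatable F k' Q' p"
        using F by (simp add: closed_family_def)
      then obtain X' \<psi> where "pwf F \<psi>" "\<And>W \<sigma>. in_dom W \<sigma> \<Longrightarrow> X' W \<sigma> \<longleftrightarrow> psat W \<sigma> \<psi>"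
        "\<And>W \<sigma>. in_dom W \<sigma> \<Longrightarrow> op_allowed p (\<sigma> 0) W \<Longrightarrow>
          (Q' (apply_op p (\<sigma> 0) W) (map \<sigma> [1..<1 + k']) \<longleftrightarrow> X' W \<sigma>)"
        unfolding updatable_def fdef_def by blast
      then show "\<exists>\<psi>. pwf F \<psi> \<and> (\<forall>W1 W2 \<sigma>. Ctx W1 W2 \<sigma> \<longrightarrow> in_dom W2 \<sigma> \<longrightarrow>
          (Q' W1 (map \<sigma> [1..<1 + k']) \<longleftrightarrow> psat W2 \<sigma> \<psi>))"
        unfolding Ctx_def by (intro exI[of _ \<psi>]) blast
    qed (use \<phi> in \<open>auto simp: Ctx_def f_def\<close>)
    then obtain \<psi> where \<psi>: "pwf F \<psi>" "\<And>W1 W2 \<sigma>. Ctx W1 W2 \<sigma> \<Longrightarrow> in_dom W2 \<sigma> \<Longrightarrow>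
        psat W1 (\<sigma> \<circ> f) \<phi> \<longleftrightarrow> psat W2 \<sigma> \<psi>"
      by blast
    have "Q (apply_op p (\<sigma> 0) W) (map \<sigma> [1..<1 + k]) \<longleftrightarrow> psat W \<sigma> \<psi>"
      if "in_dom W \<sigma>" "op_allowed p (\<sigma> 0) W" for W \<sigma>
    proof -
      have "in_dom (apply_op p (\<sigma> 0) W) (\<sigma> \<circ> f)"
        using that(1) by (simp add: in_dom_def)
      from Q\<phi>[OF this]
      have "Q (apply_op p (\<sigma> 0) W) (map (\<sigma> \<circ> f) [0..<k]) = psat W \<sigma> \<psi>"
        using \<psi>(2)[of "apply_op p (\<sigma> 0) W" W \<sigma>] that by (simp add: Ctx_def)
      moreover have "map (\<sigma> \<circ> f) [0..<k] = map \<sigma> [1..<1 + k]"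
        by (rule nth_equalityI) (auto simp: f_def simp del: upt_Suc)
      ultimately show ?thesis by simp
    qed
    then show ?thesis
      unfolding updatable_def fdef_def using \<psi>(1) by (intro exI[of _ "\<lambda>W \<sigma>. psat W \<sigma> \<psi>"]) blast
  qed
  ultimately have "initializable k' Q' \<and> (\<forall>p. updatable F k' Q' p)" if "(k', Q') \<in> insert (k, Q) F" for k' Q'
    using F that unfolding closed_family_def by blast
  moreover have "finite (insert (k, Q) F)" "statics \<subseteq> insert (k, Q) F"
    using F unfolding closed_family_def by (simp_all add: subset_insertI2)
  ultimately show ?thesis
    unfolding closed_family_def using updatable_mono[OF _ subset_insertI[of F "(k, Q)"]] by metis
qed

section \<open>Elimination of disjunctions\<close>

text \<open>A truth value is stored as an element of the domain, with \<open>$\<close> for true and every other element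
  for false. A query \<open>Q\<close> is replaced by \<open>b = $ \<longrightarrow> Q\<close>: this guarded form commutes with conjunction and
  existential quantification, and a disjunction becomes a conjunction of guarded queries with
  existentially quantified guards constrained by a static relation.\<close>

definition guard_or :: "nat \<Rightarrow> nat list set \<Rightarrow> bool" where
  "guard_or m S \<longleftrightarrow> (\<forall>b c d. b \<in> {1..Suc m} \<longrightarrow> c \<in> {1..Suc m} \<longrightarrow> d \<in> {1..Suc m} \<longrightarrow>
     ([b, c, d] \<in> S \<longleftrightarrow> (b = Suc m \<longrightarrow> c = Suc m \<or> d = Suc m)))"

text \<open>The guard is the last component of a stored tuple, and relation \<open>length Rs\<close>
  is the truth table of the disjunction. Nothing is demanded of lists outside the domain, since
  formulas never see them.\<close>

definition guarded :: "(nat \<times> 'a query) list \<Rightarrow> 'a wstruct \<Rightarrow> (nat \<Rightarrow> nat list set) \<Rightarrow> bool" where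
  "guarded Rs W A \<longleftrightarrow> guard_or (length W) (A (length Rs)) \<and>
     (\<forall>r < length Rs. \<forall>us b. length us = fst (Rs ! r) \<longrightarrow> set us \<subseteq> ws_dom W \<longrightarrow> b \<in> ws_dom W \<longrightarrow>
        (us @ [b] \<in> A r \<longleftrightarrow> (b = ws_dollar W \<longrightarrow> snd (Rs ! r) W us)))"

lemma term_val_cong: "(\<And>v. v \<in> term_vars t \<Longrightarrow> \<sigma> v = \<tau> v) \<Longrightarrow> term_val W \<sigma> t = term_val W \<tau> t"
  by (cases t) auto

lemma term_val_dom:
  assumes "term_vars t \<subseteq> {..<N}" "\<And>v. v < N \<Longrightarrow> \<sigma> v \<in> ws_dom W" "length W' = length W"
  shows "term_val W' \<sigma> t \<in> ws_dom W"
  using assms by (cases t) (auto simp: ws_dollar_def ws_dom_def)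

lemma term_val_upd_fresh:
  "term_vars t \<subseteq> {..<N} \<Longrightarrow> N \<le> M \<Longrightarrow> term_val W (\<sigma>(M := d)) t = term_val W \<sigma> t"
  by (rule term_val_cong) auto

lemma env_upd_fresh:
  assumes "\<And>u. term_vars (e u) \<subseteq> {..<N}"
  shows "(\<lambda>u. term_val W (\<sigma>(N := d)) ((e(v := Var N)) u)) = (\<lambda>u. term_val W \<sigma> (e u))(v := d)"
  using term_val_upd_fresh[OF assms order_refl] by (auto simp: fun_eq_iff)

text \<open>\<open>W\<close> is the old structure, which \<open>\<phi>\<close> speaks about, and
  \<open>W'\<close> the new one, over which \<open>\<chi>\<close> is evaluated. Equal length
  suffices as a link because the translation reads letters from auxiliary relations only.
  \<open>b\<close> is the guard, \<open>e\<close> translates variables, and \<open>N\<close> is the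
  first fresh name.\<close>

definition cq_of :: "(nat \<times> 'a query) list \<Rightarrow> nat list \<Rightarrow> nat \<Rightarrow> fo_term \<Rightarrow> (nat \<Rightarrow> fo_term) \<Rightarrow> 'a pf \<Rightarrow>
    'a fo \<Rightarrow> bool" where
  "cq_of Rs ar N b e \<phi> \<chi> \<longleftrightarrow> is_cq \<chi> \<and> wf_fo ar \<chi> \<and> free_vars \<chi> \<subseteq> {..<N} \<and>
    (\<forall>W W' A \<sigma>. length W' = length W \<longrightarrow> W \<noteq> [] \<longrightarrow> guarded Rs W A \<longrightarrow> (\<forall>v<N. \<sigma> v \<in> ws_dom W) \<longrightarrow>
      (sat W' A \<sigma> \<chi> \<longleftrightarrow>
        (term_val W' \<sigma> b = ws_dollar W \<longrightarrow> psat W (\<lambda>v. term_val W' \<sigma> (e v)) \<phi>)))"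

lemma cq_ofD:
  assumes "cq_of Rs ar N b e \<phi> \<chi>"
  shows "is_cq \<chi>" "wf_fo ar \<chi>" "free_vars \<chi> \<subseteq> {..<N}"
    "length W' = length W \<Longrightarrow> W \<noteq> [] \<Longrightarrow> guarded Rs W A \<Longrightarrow> (\<forall>v<N. \<sigma> v \<in> ws_dom W) \<Longrightarrow>
      sat W' A \<sigma> \<chi> \<longleftrightarrow>
        (term_val W' \<sigma> b = ws_dollar W \<longrightarrow> psat W (\<lambda>v. term_val W' \<sigma> (e v)) \<phi>)"
  using assms unfolding cq_of_def by simp_all

definition fo_of :: "nat \<Rightarrow> (nat \<Rightarrow> fo_term) \<Rightarrow> 'a pf \<Rightarrow> 'a fo \<Rightarrow> bool" where
  "fo_of N e \<phi> \<chi> \<longleftrightarrow> wf_fo [] \<chi> \<and> free_vars \<chi> \<subseteq> {..<N} \<and>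
    (\<forall>W A \<sigma>. (\<forall>v<N. \<sigma> v \<in> ws_dom W) \<longrightarrow>
      (sat W A \<sigma> \<chi> \<longleftrightarrow> psat W (\<lambda>v. term_val W \<sigma> (e v)) \<phi>))"

lemma fo_ofD:
  assumes "fo_of N e \<phi> \<chi>"
  shows "wf_fo [] \<chi>" "free_vars \<chi> \<subseteq> {..<N}"
    "(\<forall>v<N. \<sigma> v \<in> ws_dom W) \<Longrightarrow> sat W A \<sigma> \<chi> \<longleftrightarrow> psat W (\<lambda>v. term_val W \<sigma> (e v)) \<phi>"
  using assms unfolding fo_of_def by simp_all

lemma pf_to_cq:
  fixes \<phi> :: "'a pf" and Rs :: "(nat \<times> 'a query) list"
  assumes "pwf (set Rs) \<phi>" and ar: "length Rs < length ar"
    and ar1: "\<And>r. r < length Rs \<Longrightarrow> ar ! r = Suc (fst (Rs ! r))" and ar2: "ar ! length Rs = 3"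
    and "\<And>v. term_vars (e v) \<subseteq> {..<N}" "term_vars b \<subseteq> {..<N}"
  shows "\<exists>\<chi>. cq_of Rs ar N b e \<phi> \<chi>"
  using assms(1) assms(5,6)
proof (induction \<phi> arbitrary: e N b)
  case PTrue
  show ?case by (rule exI[of _ "Equal Dollar Dollar"]) (simp add: cq_of_def)
next
  case PFalse
  \<comment> \<open>A guard that implies falsity must differ from \<open>$\<close>. As
    \<open>$\<close> is the largest element, \<open>b < $\<close> says so without negation.\<close>
  have "term_val W' \<sigma> b < ws_dollar W' \<longleftrightarrow> term_val W' \<sigma> b \<noteq> ws_dollar W"
    if "length W' = length W" "\<forall>v<N. \<sigma> v \<in> ws_dom W" for W W' :: "'a wstruct" and \<sigma>
    using term_val_dom[of b N \<sigma> W W'] PFalse that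
    by (auto simp: ws_dom_def ws_dollar_def)
  then show ?case
    unfolding cq_of_def using PFalse by (intro exI[of _ "Less b Dollar"]) auto
next
  case (PAtom k Q vs)
  then obtain r where r: "r < length Rs" "Rs ! r = (k, Q)" and len: "length vs = k"
    by (auto simp: in_set_conv_nth)
  show ?case
    unfolding cq_of_def
  proof (intro exI[of _ "Aux r (map e vs @ [b])"] conjI allI impI)
    show "is_cq (Aux r (map e vs @ [b]))" by simp
    show "wf_fo ar (Aux r (map e vs @ [b]))"
      using ar ar1[OF r(1)] r len by simp
    show "free_vars (Aux r (map e vs @ [b])) \<subseteq> {..<N}"
      using PAtom.prems by auto
    fix W W' :: "'a wstruct" and A \<sigma>
    assume a: "length W' = length W" "W \<noteq> []" "guarded Rs W A" "\<forall>v<N. \<sigma> v \<in> ws_dom W"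
    have d: "term_val W' \<sigma> t \<in> ws_dom W" if "term_vars t \<subseteq> {..<N}" for t
      using term_val_dom[OF that] a(1,4) by blast
    note d = d[OF PAtom.prems(3)] d[OF PAtom.prems(2)]
    show "sat W' A \<sigma> (Aux r (map e vs @ [b])) \<longleftrightarrow>
        (term_val W' \<sigma> b = ws_dollar W \<longrightarrow> psat W (\<lambda>v. term_val W' \<sigma> (e v)) (PAtom k Q vs))"
      using a(3) r len d unfolding guarded_def by (auto simp: comp_def image_subset_iff)
  qed
next
  case (PAnd f1 f2)
  then obtain \<chi>1 \<chi>2 where "cq_of Rs ar N b e f1 \<chi>1" "cq_of Rs ar N b e f2 \<chi>2"
    by (metis pwf.simps(4))
  note \<chi> = cq_ofD[OF this(1)] cq_ofD[OF this(2)]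
  show ?case unfolding cq_of_def using \<chi> by (intro exI[of _ "And \<chi>1 \<chi>2"]) auto
next
  case (POr f1 f2)
  have wf: "pwf (set Rs) f1" "pwf (set Rs) f2" using POr.prems by auto
  have fr: "term_vars (e v) \<subseteq> {..<N + 2}" "term_vars (Var N) \<subseteq> {..<N + 2}"
    "term_vars (Var (Suc N)) \<subseteq> {..<N + 2}" for v
    using POr.prems(2)[of v] by auto
  obtain \<chi>1 \<chi>2 where "cq_of Rs ar (N + 2) (Var N) e f1 \<chi>1" "cq_of Rs ar (N + 2) (Var (Suc N)) e f2 \<chi>2"
    using POr.IH(1)[where N = "N + 2" and e = e, OF wf(1) fr(1,2)] POr.IH(2)[where N = "N + 2" and e = e, OF wf(2) fr(1,3)] by blast
  note \<chi>1 = cq_ofD[OF this(1)] and \<chi>2 = cq_ofD[OF this(2)]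
  \<comment> \<open>Each disjunct gets a fresh guard. The table makes one of the two guards true
    whenever \<open>b\<close> is true.\<close>
  let ?\<chi> = "Exists N (Exists (Suc N) (And (Aux (length Rs) [b, Var N, Var (Suc N)]) (And \<chi>1 \<chi>2)))"
  show ?case
    unfolding cq_of_def
  proof (intro exI[of _ ?\<chi>] conjI allI impI)
    show "is_cq ?\<chi>" using \<chi>1 \<chi>2 by simp
    show "wf_fo ar ?\<chi>" using \<chi>1 \<chi>2 ar ar2 by simp
    show "free_vars ?\<chi> \<subseteq> {..<N}"
      using \<chi>1(3) \<chi>2(3) POr.prems(3) by (fastforce simp: less_Suc_eq)
    fix W W' :: "'a wstruct" and A \<sigma>
    assume a: "length W' = length W" "W \<noteq> []" "guarded Rs W A" "\<forall>v<N. \<sigma> v \<in> ws_dom W"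
    let ?t = "ws_dollar W" and ?\<beta> = "term_val W' \<sigma> b"
    let ?p1 = "psat W (\<lambda>v. term_val W' \<sigma> (e v)) f1" and ?p2 = "psat W (\<lambda>v. term_val W' \<sigma> (e v)) f2"
    have d: "ws_dom W' = ws_dom W" using a(1) by (simp add: ws_dom_def)
    have \<beta>: "?\<beta> \<in> ws_dom W" using term_val_dom[OF POr.prems(3)] a by auto
    have tv: "term_val W' (\<sigma>(N := c, Suc N := c')) (e v) = term_val W' \<sigma> (e v)"
      "term_val W' (\<sigma>(N := c, Suc N := c')) b = ?\<beta>" for c c' v
      using POr.prems(2)[of v] POr.prems(3) by (auto intro!: term_val_cong)
    have or: "[?\<beta>, c, c'] \<in> A (length Rs) \<longleftrightarrow> (?\<beta> = ?t \<longrightarrow> c = ?t \<or> c' = ?t)"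
      if "c \<in> ws_dom W" "c' \<in> ws_dom W" for c c'
      using a(3) \<beta> that unfolding guarded_def guard_or_def ws_dom_def ws_dollar_def by simp
    have "sat W' A (\<sigma>(N := c, Suc N := c')) \<chi>1 \<longleftrightarrow> (c = ?t \<longrightarrow> ?p1)"
      "sat W' A (\<sigma>(N := c, Suc N := c')) \<chi>2 \<longleftrightarrow> (c' = ?t \<longrightarrow> ?p2)"
      if "c \<in> ws_dom W" "c' \<in> ws_dom W" for c c'
      using \<chi>1(4)[OF a(1-3), of "\<sigma>(N := c, Suc N := c')"] \<chi>2(4)[OF a(1-3), of "\<sigma>(N := c, Suc N := c')"]
        a(4) that by (auto simp: tv less_Suc_eq)
    then have "sat W' A \<sigma> ?\<chi> \<longleftrightarrow> (\<exists>c\<in>ws_dom W. \<exists>c'\<in>ws_dom W.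
        (?\<beta> = ?t \<longrightarrow> c = ?t \<or> c' = ?t) \<and> (c = ?t \<longrightarrow> ?p1) \<and> (c' = ?t \<longrightarrow> ?p2))"
      using or by (auto simp: d tv)
    also have "\<dots> \<longleftrightarrow> (?\<beta> = ?t \<longrightarrow> ?p1 \<or> ?p2)"
    proof -
      \<comment> \<open>Position 1 serves as the value false; it differs from \<open>$\<close> since
        \<open>W\<close> is nonempty.\<close>
      have "1 \<in> ws_dom W" "1 \<noteq> ?t" "?t \<in> ws_dom W"
        using a(2) by (auto simp: ws_dom_def ws_dollar_def)
      then show ?thesis by metis
    qed
    finally show "sat W' A \<sigma> ?\<chi> \<longleftrightarrow>
        (?\<beta> = ?t \<longrightarrow> psat W (\<lambda>v. term_val W' \<sigma> (e v)) (POr f1 f2))" by simp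
  qed
next
  case (PEx v f)
  have wf: "pwf (set Rs) f" using PEx.prems by simp
  have fr: "term_vars ((e(v := Var N)) u) \<subseteq> {..<Suc N}" "term_vars b \<subseteq> {..<Suc N}" for u
    using PEx.prems(2)[of u] PEx.prems(3) by auto
  obtain \<chi> where "cq_of Rs ar (Suc N) b (e(v := Var N)) f \<chi>"
    using PEx.IH[where e = "e(v := Var N)", OF wf fr] by blast
  note \<chi> = cq_ofD[OF this]
  show ?case
    unfolding cq_of_def
  proof (intro exI[of _ "Exists N \<chi>"] conjI allI impI)
    show "is_cq (Exists N \<chi>)" "wf_fo ar (Exists N \<chi>)" using \<chi> by auto
    show "free_vars (Exists N \<chi>) \<subseteq> {..<N}" using \<chi>(3) by (auto simp: less_Suc_eq)
    fix W W' :: "'a wstruct" and A \<sigma>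
    assume a: "length W' = length W" "W \<noteq> []" "guarded Rs W A" "\<forall>v<N. \<sigma> v \<in> ws_dom W"
    have d: "ws_dom W' = ws_dom W" using a(1) by (simp add: ws_dom_def)
    have "sat W' A (\<sigma>(N := c)) \<chi> \<longleftrightarrow> (term_val W' \<sigma> b = ws_dollar W \<longrightarrow>
        psat W ((\<lambda>u. term_val W' \<sigma> (e u))(v := c)) f)" if "c \<in> ws_dom W" for c
      using \<chi>(4)[OF a(1-3), of "\<sigma>(N := c)"] a(4) that
      unfolding env_upd_fresh[of e, OF PEx.prems(2)] term_val_upd_fresh[OF PEx.prems(3) order_refl]
      by (auto simp: less_Suc_eq)
    \<comment> \<open>Under a false guard every element is a witness, so it remains to provide
      one.\<close>
    moreover have "1 \<in> ws_dom W" by (simp add: ws_dom_def)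
    ultimately show "sat W' A \<sigma> (Exists N \<chi>) \<longleftrightarrow> (term_val W' \<sigma> b = ws_dollar W \<longrightarrow>
        psat W (\<lambda>v. term_val W' \<sigma> (e v)) (PEx v f))"
      by (auto simp: d)
  qed
qed

text \<open>Initialization formulas may use full first-order logic, so no guards occur here.
  Negation yields the successor relation by excluding elements in between, and the first position by
  excluding smaller ones.\<close>

lemma static_to_fo:
  fixes \<phi> :: "'a pf"
  assumes "pwf statics \<phi>" "\<And>v. term_vars (e v) \<subseteq> {..<N}"
  shows "\<exists>\<chi>. fo_of N e \<phi> \<chi>"
  using assms
proof (induction \<phi> arbitrary: e N)
  case PTrue
  show ?case by (rule exI[of _ "Equal Dollar Dollar"]) (simp add: fo_of_def)
next
  case PFalse
  show ?case by (rule exI[of _ "Less Dollar Dollar"]) (simp add: fo_of_def)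
next
  case (PAtom k Q vs)
  note fr = PAtom.prems(2)
  have tv: "term_val W (\<sigma>(N := d)) (e v) = term_val W \<sigma> (e v)" for W :: "'a wstruct" and \<sigma> d v
    using term_val_upd_fresh[OF fr order_refl] .
  have dm: "term_val W \<sigma> (e v) \<in> ws_dom W"
    if "\<forall>v<N. \<sigma> v \<in> ws_dom W" for W :: "'a wstruct" and \<sigma> v
    using term_val_dom[OF fr] that by auto
  consider u v where "Q = q_lt" "vs = [u, v]" | u v where "Q = q_eq" "vs = [u, v]"
    | u v where "Q = q_succ" "vs = [u, v]" | u where "Q = q_first" "vs = [u]"
    | u where "Q = q_dollar" "vs = [u]"
    using PAtom.prems(1) by (auto simp: statics_def length_Suc_conv numeral_2_eq_2)
  then show ?case
  proof cases
    case 1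
    then show ?thesis using fr by (intro exI[of _ "Less (e u) (e v)"]) (simp add: q_lt_def fo_of_def)
  next
    case 2
    then show ?thesis using fr by (intro exI[of _ "Equal (e u) (e v)"]) (simp add: q_eq_def fo_of_def)
  next
    case 3
    let ?\<chi> = "And (Less (e u) (e v)) (Neg (Exists N (And (Less (e u) (Var N)) (Less (Var N) (e v)))))"
    have "sat W A \<sigma> ?\<chi> \<longleftrightarrow> term_val W \<sigma> (e v) = Suc (term_val W \<sigma> (e u))"
      if "\<forall>v<N. \<sigma> v \<in> ws_dom W" for W :: "'a wstruct" and A \<sigma>
    proof -
      have "Suc (term_val W \<sigma> (e u)) \<in> ws_dom W" if "term_val W \<sigma> (e u) < term_val W \<sigma> (e v)"
        using that dm[OF \<open>\<forall>v<N. \<sigma> v \<in> ws_dom W\<close>, of v] by (simp add: ws_dom_def)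
      then show ?thesis by (force simp: tv)
    qed
    with 3 show ?thesis using fr[of u] fr[of v] by (intro exI[of _ ?\<chi>]) (auto simp: q_succ_def fo_of_def)
  next
    case 4
    let ?\<chi> = "Neg (Exists N (Less (Var N) (e u)))"
    have "sat W A \<sigma> ?\<chi> \<longleftrightarrow> term_val W \<sigma> (e u) = 1"
      if "\<forall>v<N. \<sigma> v \<in> ws_dom W" for W :: "'a wstruct" and A \<sigma>
    proof -
      have "term_val W \<sigma> (e u) \<in> ws_dom W" by (rule dm[OF that])
      moreover have "1 \<in> ws_dom W" by (simp add: ws_dom_def)
      ultimately show ?thesis
        by (simp add: tv) (metis One_nat_def atLeastAtMost_iff le_neq_implies_less less_one not_less_zero
          not_le ws_dom_def)
    qed
    with 4 show ?thesis using fr[of u] by (intro exI[of _ ?\<chi>]) (auto simp: q_first_def fo_of_def)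
  next
    case 5
    then show ?thesis using fr by (intro exI[of _ "Equal (e u) Dollar"]) (simp add: q_dollar_def fo_of_def)
  qed
next
  case (PAnd f1 f2)
  then obtain \<chi>1 \<chi>2 where "fo_of N e f1 \<chi>1" "fo_of N e f2 \<chi>2"
    by (metis pwf.simps(4))
  note \<chi> = fo_ofD[OF this(1)] fo_ofD[OF this(2)]
  show ?case unfolding fo_of_def using \<chi> by (intro exI[of _ "And \<chi>1 \<chi>2"]) auto
next
  case (POr f1 f2)
  then obtain \<chi>1 \<chi>2 where "fo_of N e f1 \<chi>1" "fo_of N e f2 \<chi>2"
    by (metis pwf.simps(5))
  note \<chi> = fo_ofD[OF this(1)] fo_ofD[OF this(2)]
  show ?case unfolding fo_of_def using \<chi> by (intro exI[of _ "Or \<chi>1 \<chi>2"]) auto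
next
  case (PEx v f)
  have wf: "pwf statics f" using PEx.prems by simp
  have fr: "term_vars ((e(v := Var N)) u) \<subseteq> {..<Suc N}" for u
    using PEx.prems(2)[of u] by auto
  obtain \<chi> where "fo_of (Suc N) (e(v := Var N)) f \<chi>"
    using PEx.IH[where e = "e(v := Var N)", OF wf fr] by blast
  note \<chi> = fo_ofD[OF this]
  have "sat W A (\<sigma>(N := c)) \<chi> \<longleftrightarrow> psat W ((\<lambda>u. term_val W \<sigma> (e u))(v := c)) f"
    if "c \<in> ws_dom W" "\<forall>v<N. \<sigma> v \<in> ws_dom W" for c W A \<sigma>
    using \<chi>(3)[of "\<sigma>(N := c)" W A] that
    unfolding env_upd_fresh[of e, OF PEx.prems(2)] by (auto simp: less_Suc_eq)
  with \<chi>(1,2) show ?case unfolding fo_of_def by (intro exI[of _ "Exists N \<chi>"]) (auto simp: less_Suc_eq)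
qed

lemma ex_update_cq:
  fixes Q :: "'a query"
  assumes F: "closed_family (set Rs)" and kQ: "(k, Q) \<in> set Rs" and ar: "length Rs < length ar"
    and ar1: "\<And>r. r < length Rs \<Longrightarrow> ar ! r = Suc (fst (Rs ! r))" and ar2: "ar ! length Rs = 3"
    and b: "term_vars b \<subseteq> {..<N}" and N: "Suc k \<le> N"
  shows "\<exists>\<chi>. is_cq \<chi> \<and> wf_fo ar \<chi> \<and> free_vars \<chi> \<subseteq> {..<N} \<and>
    (\<forall>W A \<tau>. op_allowed p (\<tau> 0) W \<longrightarrow> guarded Rs W A \<longrightarrow> (\<forall>v<N. \<tau> v \<in> ws_dom W) \<longrightarrow>
      (sat (apply_op p (\<tau> 0) W) A \<tau> \<chi> \<longleftrightarrow>
        (term_val W \<tau> b = ws_dollar W \<longrightarrow> Q (apply_op p (\<tau> 0) W) (map \<tau> [1..<1 + k]))))"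
proof -
  have "updatable (set Rs) k Q p"
    using F kQ by (simp add: closed_family_def)
  then obtain X \<phi> where \<phi>: "pwf (set Rs) \<phi>" "\<And>W \<sigma>. in_dom W \<sigma> \<Longrightarrow> X W \<sigma> \<longleftrightarrow> psat W \<sigma> \<phi>"
    "\<And>W \<sigma>. in_dom W \<sigma> \<Longrightarrow> op_allowed p (\<sigma> 0) W \<Longrightarrow>
      (Q (apply_op p (\<sigma> 0) W) (map \<sigma> [1..<1 + k]) \<longleftrightarrow> X W \<sigma>)"
    unfolding updatable_def fdef_def by blast
  \<comment> \<open>\<open>\<phi>\<close> may mention variables above \<open>k\<close>, on which its
    value does not depend here. Substituting \<open>$\<close> for them keeps the free variables in
    bounds and the valuation inside the domain.\<close>
  define e where "e v = (if v \<le> k then Var v else Dollar)" for v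
  have e: "term_vars (e v) \<subseteq> {..<N}" for v
    using N by (auto simp: e_def)
  obtain \<chi> where "cq_of Rs ar N b e \<phi> \<chi>"
    using pf_to_cq[where e = e, OF \<phi>(1) ar ar1 ar2 e b] by blast
  note \<chi> = cq_ofD[OF this]
  show ?thesis
  proof (intro exI[of _ \<chi>] conjI allI impI)
    show "is_cq \<chi>" "wf_fo ar \<chi>" "free_vars \<chi> \<subseteq> {..<N}" using \<chi> by auto
    fix W A \<tau>
    assume a: "op_allowed p (\<tau> 0) W" "guarded Rs W A" "\<forall>v<N. \<tau> v \<in> ws_dom W"
    let ?W = "apply_op p (\<tau> 0) W"
    let ?\<sigma> = "\<lambda>v. term_val ?W \<tau> (e v)"
    have "W \<noteq> []" using a(1) by (auto simp: op_allowed_def)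
    then have "sat ?W A \<tau> \<chi> \<longleftrightarrow> (term_val ?W \<tau> b = ws_dollar W \<longrightarrow> psat W ?\<sigma> \<phi>)"
      using \<chi>(4)[of ?W W A \<tau>] a by simp
    also have "term_val ?W \<tau> b = term_val W \<tau> b"
      by (cases b) (auto simp: ws_dollar_def)
    also have "psat W ?\<sigma> \<phi> \<longleftrightarrow> Q ?W (map ?\<sigma> [1..<1 + k])"
    proof -
      have "in_dom W ?\<sigma>"
        using a(3) N by (auto simp: in_dom_def e_def ws_dom_def ws_dollar_def)
      moreover have "?\<sigma> 0 = \<tau> 0" by (simp add: e_def)
      ultimately show ?thesis using \<phi>(2)[of W ?\<sigma>] \<phi>(3)[of W ?\<sigma>] a(1) by simp
    qed
    also have "map ?\<sigma> [1..<1 + k] = map \<tau> [1..<1 + k]"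
      by (auto simp: e_def)
    finally show "sat ?W A \<tau> \<chi> \<longleftrightarrow> (term_val W \<tau> b = ws_dollar W \<longrightarrow> Q ?W (map \<tau> [1..<1 + k]))" .
  qed
qed

lemma ex_init_fo:
  fixes Q :: "'a query"
  assumes "initializable k Q"
  shows "\<exists>\<chi> :: 'a fo. wf_fo [] \<chi> \<and> free_vars \<chi> \<subseteq> {..<k} \<and>
    (\<forall>n A \<tau>. (\<forall>v<k. \<tau> v \<in> ws_dom (init_ws n :: 'a wstruct)) \<longrightarrow>
      (sat (init_ws n) A \<tau> \<chi> \<longleftrightarrow> Q (init_ws n) (map \<tau> [0..<k])))"
proof -
  obtain X and \<phi> :: "'a pf" where \<phi>: "pwf statics \<phi>" "\<And>W \<sigma>. in_dom W \<sigma> \<Longrightarrow> X W \<sigma> \<longleftrightarrow> psat W \<sigma> \<phi>"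
    "\<And>n \<sigma>. in_dom (init_ws n :: 'a wstruct) \<sigma> \<Longrightarrow>
      (Q (init_ws n) (map \<sigma> [0..<k]) \<longleftrightarrow> X (init_ws n) \<sigma>)"
    using assms unfolding initializable_def fdef_def by blast
  define e where "e v = (if v < k then Var v else Dollar)" for v
  have e: "term_vars (e v) \<subseteq> {..<k}" for v
    by (auto simp: e_def)
  obtain \<chi> where "fo_of k e \<phi> \<chi>"
    using static_to_fo[where e = e, OF \<phi>(1) e] by blast
  note \<chi> = fo_ofD[OF this]
  have "sat (init_ws n) A \<tau> \<chi> \<longleftrightarrow> Q (init_ws n) (map \<tau> [0..<k])"
    if a: "\<forall>v<k. \<tau> v \<in> ws_dom (init_ws n :: 'a wstruct)" for n A \<tau>
  proof -
    let ?\<sigma> = "\<lambda>v. term_val (init_ws n :: 'a wstruct) \<tau> (e v)"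
    have d: "in_dom (init_ws n :: 'a wstruct) ?\<sigma>"
      using a by (auto simp: in_dom_def e_def ws_dom_def ws_dollar_def)
    have "map ?\<sigma> [0..<k] = map \<tau> [0..<k]" by (auto simp: e_def)
    then show ?thesis using \<chi>(3)[of \<tau> "init_ws n" A] \<phi>(2,3)[OF d] a by metis
  qed
  with \<chi>(1,2) show ?thesis by (intro exI[of _ \<chi>]) simp
qed

lemma map_nth_prefix: "length us = k \<Longrightarrow> map ((!) (us @ vs)) [0..<k] = us"
  by (rule nth_equalityI) (auto simp: nth_append)

lemma map_nth_Cons_prefix: "length us = k \<Longrightarrow> map ((!) (i # us @ vs)) [1..<1 + k] = us"
  by (rule nth_equalityI) (auto simp: nth_append simp del: upt_Suc)

text \<open>The program has a guarded relation for each member of the family, the truth table of the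
  disjunction, and the target. The target has to be stored without a guard, so its update formula is
  the translation with the constant \<open>Dollar\<close>, that is, true, as guard.\<close>

lemma closed_family_DynCQ:
  fixes F :: "(nat \<times> 'a query) set"
  assumes F: "closed_family F" and kQ: "(k, Q) \<in> F"
    and tup: "\<And>W js. Q W js \<Longrightarrow> js \<in> tuples k W"
  shows "(\<lambda>W. {js. Q W js}) \<in> DynCQ k"
proof -
  have "finite F" using F by (simp add: closed_family_def)
  then obtain Rs where Rs: "set Rs = F" using finite_list by blast
  define m where "m = length Rs"
  define K where "K r = fst (Rs ! r)" for r
  define S where "S r = snd (Rs ! r)" for r
  define ar where "ar = map (\<lambda>R. Suc (fst R)) Rs @ [3, k]"
  have len_ar: "length ar = m + 2" by (simp add: ar_def m_def)
  have ar_lt: "ar ! r = Suc (K r)" if "r < m" for r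
    using that by (simp add: ar_def m_def K_def nth_append)
  have ar_m: "ar ! m = 3" "ar ! Suc m = k" by (simp_all add: ar_def m_def nth_append)
  have RsF: "closed_family (set Rs)" using F Rs by simp
  have KS: "(K r, S r) \<in> set Rs" if "r < m" for r
    using that by (simp add: K_def S_def m_def)
  have arR: "length Rs < length ar" "\<And>r. r < length Rs \<Longrightarrow> ar ! r = Suc (fst (Rs ! r))"
    "ar ! length Rs = 3"
    using len_ar ar_lt ar_m by (auto simp: m_def K_def)

  define upd_ok where "upd_ok N b k' Q' p \<chi> \<longleftrightarrow> is_cq \<chi> \<and> wf_fo ar \<chi> \<and> free_vars \<chi> \<subseteq> {..<N} \<and>
    (\<forall>W A \<tau>. op_allowed p (\<tau> 0) W \<longrightarrow> guarded Rs W A \<longrightarrow> (\<forall>v<N. \<tau> v \<in> ws_dom W) \<longrightarrow>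
      (sat (apply_op p (\<tau> 0) W) A \<tau> \<chi> \<longleftrightarrow>
        (term_val W \<tau> b = ws_dollar W \<longrightarrow> Q' (apply_op p (\<tau> 0) W) (map \<tau> [1..<1 + k']))))"
    for N b k' and Q' :: "'a query" and p \<chi>
  have ex_upd: "\<exists>\<chi>. upd_ok N b k' Q' p \<chi>"
    if "(k', Q') \<in> set Rs" "term_vars b \<subseteq> {..<N}" "Suc k' \<le> N" for N b k' Q' p
    unfolding upd_ok_def using ex_update_cq[OF RsF that(1) arR that(2,3)] .
  have upd_okD: "sat (apply_op p (\<tau> 0) W) A \<tau> \<chi> \<longleftrightarrow>
        (term_val W \<tau> b = ws_dollar W \<longrightarrow> Q' (apply_op p (\<tau> 0) W) (map \<tau> [1..<1 + k']))"
    if "upd_ok N b k' Q' p \<chi>" "op_allowed p (\<tau> 0) W" "guarded Rs W A" "\<forall>v<N. \<tau> v \<in> ws_dom W"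
    for N b k' Q' p \<chi> W A \<tau>
    using that unfolding upd_ok_def by simp
  define init_ok where "init_ok k' Q' \<chi> \<longleftrightarrow> wf_fo [] \<chi> \<and> free_vars \<chi> \<subseteq> {..<k'} \<and>
    (\<forall>n A \<tau>. (\<forall>v<k'. \<tau> v \<in> ws_dom (init_ws n :: 'a wstruct)) \<longrightarrow>
      (sat (init_ws n) A \<tau> \<chi> \<longleftrightarrow> Q' (init_ws n) (map \<tau> [0..<k'])))" for k' and Q' :: "'a query" and \<chi> :: "'a fo"
  have ex_init: "\<exists>\<chi>. init_ok k' Q' \<chi>" if "(k', Q') \<in> set Rs" for k' Q'
    unfolding init_ok_def using RsF that by (intro ex_init_fo) (simp add: closed_family_def)

  have init_okD: "sat (init_ws n) A \<tau> \<chi> \<longleftrightarrow> Q' (init_ws n) (map \<tau> [0..<k'])"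
    if "init_ok k' Q' \<chi>" "\<forall>v<k'. \<tau> v \<in> ws_dom (init_ws n :: 'a wstruct)" for k' Q' \<chi> n A \<tau>
    using that unfolding init_ok_def by simp

  \<comment> \<open>Variable 0 is the updated position, 1 to \<open>K r\<close> are the arguments of
    the query and \<open>Suc (K r)\<close> is the guard, so \<open>K r + 2\<close> is the first
    fresh name.\<close>
  define u where "u r p = (SOME \<chi>. upd_ok (K r + 2) (Var (Suc (K r))) (K r) (S r) p \<chi>)" for r p
  define u' where "u' p = (SOME \<chi>. upd_ok (Suc k) Dollar k Q p \<chi>)" for p
  define h where "h r = (SOME \<chi>. init_ok (K r) (S r) \<chi>)" for r
  define h' where "h' = (SOME \<chi>. init_ok k Q \<chi>)"
  have u: "upd_ok (K r + 2) (Var (Suc (K r))) (K r) (S r) p (u r p)" if "r < m" for r p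
    unfolding u_def by (rule someI_ex, rule ex_upd[OF KS[OF that]]) auto
  have u': "upd_ok (Suc k) Dollar k Q p (u' p)" for p
    unfolding u'_def by (rule someI_ex, rule ex_upd) (use kQ Rs in auto)
  have h: "init_ok (K r) (S r) (h r)" if "r < m" for r
    unfolding h_def by (rule someI_ex, rule ex_init[OF KS[OF that]])
  have h': "init_ok k Q h'"
    unfolding h'_def by (rule someI_ex, rule ex_init) (use kQ Rs in auto)

  define \<Pi> where "\<Pi> = \<lparr> aux_arity = ar,
    init_fo = (\<lambda>r. if r < m then Or (Neg (Equal (Var (K r)) Dollar)) (h r)
      else if r = m then Or (Neg (Equal (Var 0) Dollar)) (Or (Equal (Var 1) Dollar) (Equal (Var 2) Dollar))
      else h'),
    update_fo = (\<lambda>r p. if r < m then u r p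
      else if r = m then Aux m [Var 1, Var 2, Var 3] else u' p) \<rparr>"
  have sel: "aux_arity \<Pi> = ar" "\<And>r. r < m \<Longrightarrow> init_fo \<Pi> r = Or (Neg (Equal (Var (K r)) Dollar)) (h r)"
    "init_fo \<Pi> m = Or (Neg (Equal (Var 0) Dollar)) (Or (Equal (Var 1) Dollar) (Equal (Var 2) Dollar))"
    "init_fo \<Pi> (Suc m) = h'" "\<And>r p. r < m \<Longrightarrow> update_fo \<Pi> r p = u r p"
    "\<And>p. update_fo \<Pi> m p = Aux m [Var 1, Var 2, Var 3]" "\<And>p. update_fo \<Pi> (Suc m) p = u' p"
    by (simp_all add: \<Pi>_def)
  have cases_r: "r < m \<or> r = m \<or> r = Suc m" if "r < length ar" for r
    using that len_ar by auto
  have "wf_dynprog \<Pi>"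
    unfolding wf_dynprog_def
  proof (intro allI impI)
    fix r assume "r < length (aux_arity \<Pi>)"
    then consider "r < m" | "r = m" | "r = Suc m" using cases_r sel by auto
    then show "wf_fo [] (init_fo \<Pi> r) \<and> free_vars (init_fo \<Pi> r) \<subseteq> {..<aux_arity \<Pi> ! r} \<and>
        (\<forall>p. wf_fo (aux_arity \<Pi>) (update_fo \<Pi> r p) \<and>
             free_vars (update_fo \<Pi> r p) \<subseteq> {..aux_arity \<Pi> ! r})"
    proof cases
      case 1
      have "{..<K r + 2} = {..Suc (K r)}" "{..<K r} \<subseteq> {..<Suc (K r)}" by auto
      with 1 u[OF 1] h[OF 1] show ?thesis
        unfolding upd_ok_def init_ok_def by (auto simp: sel ar_lt)
    next
      case 2
      then show ?thesis using len_ar by (simp add: sel ar_m)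
    next
      case 3
      have "{..<Suc k} = {..k}" by auto
      with 3 u' h' show ?thesis unfolding upd_ok_def init_ok_def by (simp add: sel ar_m)
    qed
  qed
  moreover have "cq_dynprog \<Pi>"
    unfolding cq_dynprog_def
  proof (intro allI impI)
    fix r p assume "r < length (aux_arity \<Pi>)"
    then consider "r < m" | "r = m" | "r = Suc m" using cases_r sel by auto
    then show "is_cq (update_fo \<Pi> r p)"
      using u u' by cases (auto simp: sel upd_ok_def)
  qed
  moreover have inv: "guarded Rs W A \<and> A (Suc m) = {js. Q W js}" if "reachable \<Pi> W A" for W A
    using that
  proof (induction rule: reachable.induct)
    case (initial n)
    let ?W = "init_ws n :: 'a wstruct"
    have lW: "length ?W = n" by (simp add: init_ws_def)
    have "guard_or (length ?W) (init_aux \<Pi> n m)"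
      using len_ar unfolding guard_or_def init_aux_def
      by (simp add: sel ar_m tuples_def ws_dom_def ws_dollar_def lW)
    moreover have "us @ [b] \<in> init_aux \<Pi> n r \<longleftrightarrow> (b = ws_dollar ?W \<longrightarrow> S r ?W us)"
      if "r < m" "length us = K r" "set us \<subseteq> ws_dom ?W" "b \<in> ws_dom ?W" for r us b
    proof -
      have "us @ [b] \<in> init_aux \<Pi> n r \<longleftrightarrow>
          (b = ws_dollar ?W \<longrightarrow> sat ?W (\<lambda>_. {}) ((!) (us @ [b])) (h r))"
        using that len_ar by (auto simp: init_aux_def sel ar_lt tuples_def nth_append)
      also have "sat ?W (\<lambda>_. {}) ((!) (us @ [b])) (h r) \<longleftrightarrow> S r ?W (map ((!) (us @ [b])) [0..<K r])"
      proof -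
        have "\<forall>v<K r. (us @ [b]) ! v \<in> ws_dom ?W"
          using that by (auto simp: nth_append)
        then show ?thesis by (rule init_okD[OF h[OF that(1)]])
      qed
      finally show ?thesis using map_nth_prefix[OF that(2)] by simp
    qed
    moreover have "init_aux \<Pi> n (Suc m) = {js. Q ?W js}"
    proof -
      have "js \<in> init_aux \<Pi> n (Suc m) \<longleftrightarrow> Q ?W js" if js: "js \<in> tuples k ?W" for js
      proof -
        have "js \<in> init_aux \<Pi> n (Suc m) \<longleftrightarrow> sat ?W (\<lambda>_. {}) ((!) js) h'"
          using js len_ar by (simp add: init_aux_def sel ar_m)
        also have "\<dots> \<longleftrightarrow> Q ?W (map ((!) js) [0..<k])"
        proof -
          have "\<forall>v<k. js ! v \<in> ws_dom ?W"
            using js by (auto simp: tuples_def)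
          then show ?thesis by (rule init_okD[OF h'])
        qed
        finally show ?thesis using map_nth_prefix[of js k "[]"] js by (simp add: tuples_def)
      qed
      \<comment> \<open>Lists that are not tuples over the domain are excluded on both sides: here
        by construction, and for \<open>Q\<close> by \<open>tup\<close>.\<close>
      moreover have "js \<in> init_aux \<Pi> n (Suc m) \<Longrightarrow> js \<in> tuples k ?W" for js
        by (auto simp: init_aux_def sel ar_m split: if_splits)
      ultimately show ?thesis using tup by blast
    qed
    ultimately show ?case
      unfolding guarded_def by (simp add: m_def K_def S_def)
  next
    case (update W A p i)
    let ?W = "apply_op p i W"
    let ?A = "update_aux \<Pi> p i ?W A"
    have g: "guarded Rs W A" and op: "op_allowed p i W" using update by auto
    have i: "i \<in> ws_dom W" using op by (auto simp: op_allowed_def ws_dom_def)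
    have dl: "ws_dollar ?W = ws_dollar W" by (simp add: ws_dollar_def)
    have "guard_or (length ?W) (?A m)"
    proof -
      have "guard_or (length W) (A m)" using g by (simp add: guarded_def m_def)
      moreover have "[b, c, d] \<in> ?A m \<longleftrightarrow> [b, c, d] \<in> A m"
        if "b \<in> ws_dom W" "c \<in> ws_dom W" "d \<in> ws_dom W" for b c d
        using that len_ar by (simp add: update_aux_def sel ar_m tuples_def numeral_3_eq_3)
      ultimately show ?thesis unfolding guard_or_def by (simp add: ws_dom_def)
    qed
    moreover have "us @ [b] \<in> ?A r \<longleftrightarrow> (b = ws_dollar ?W \<longrightarrow> S r ?W us)"
      if "r < m" "length us = K r" "set us \<subseteq> ws_dom ?W" "b \<in> ws_dom ?W" for r us b
    proof -
      let ?\<tau> = "(!) (i # us @ [b])"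
      have "us @ [b] \<in> ?A r \<longleftrightarrow> sat ?W A ?\<tau> (u r p)"
        using that len_ar by (auto simp: update_aux_def sel ar_lt tuples_def)
      also have "\<dots> \<longleftrightarrow> (?\<tau> (Suc (K r)) = ws_dollar W \<longrightarrow> S r ?W (map ?\<tau> [1..<1 + K r]))"
      proof -
        have "\<forall>v<K r + 2. ?\<tau> v \<in> ws_dom W"
        proof (intro allI impI)
          fix v assume "v < K r + 2"
          then have "?\<tau> v \<in> set (i # us @ [b])"
            using that(2) by (intro nth_mem) simp
          then show "?\<tau> v \<in> ws_dom W" using i that by auto
        qed
        then show ?thesis
          using upd_okD[OF u[OF that(1), of p], where \<tau> = ?\<tau> and W = W and A = A] op g by simp
      qed
      also have "?\<tau> (Suc (K r)) = b" using that by (simp add: nth_append)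
      finally show ?thesis using map_nth_Cons_prefix[OF that(2)] dl by simp
    qed
    moreover have "?A (Suc m) = {js. Q ?W js}"
    proof -
      have "js \<in> ?A (Suc m) \<longleftrightarrow> Q ?W js" if js: "js \<in> tuples k ?W" for js
      proof -
        let ?\<tau> = "(!) (i # js)"
        have "js \<in> ?A (Suc m) \<longleftrightarrow> sat ?W A ?\<tau> (u' p)"
          using js len_ar by (simp add: update_aux_def sel ar_m)
        also have "\<dots> \<longleftrightarrow> Q ?W (map ?\<tau> [1..<1 + k])"
        proof -
          have "\<forall>v<Suc k. ?\<tau> v \<in> ws_dom W"
          proof (intro allI impI)
            fix v assume "v < Suc k"
            then have "?\<tau> v \<in> set (i # js)"
              using js by (intro nth_mem) (simp add: tuples_def)
            then show "?\<tau> v \<in> ws_dom W" using i js by (auto simp: tuples_def)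
          qed
          then show ?thesis
            using upd_okD[OF u'[of p], where \<tau> = ?\<tau> and W = W and A = A] op g by simp
        qed
        finally show ?thesis using map_nth_Cons_prefix[of js k i "[]"] js by (simp add: tuples_def)
      qed
      moreover have "js \<in> ?A (Suc m) \<Longrightarrow> js \<in> tuples k ?W" for js
        by (auto simp: update_aux_def sel ar_m split: if_splits)
      ultimately show ?thesis using tup by blast
    qed
    ultimately show ?case
      unfolding guarded_def by (simp add: m_def K_def S_def)
  qed
  moreover have "maintains \<Pi> k (\<lambda>W. {js. Q W js})"
    unfolding maintains_def
    using inv len_ar ar_m sel by (intro exI[of _ "Suc m"]) simp
  ultimately show ?thesis unfolding DynCQ_def by blast
qed

lemma mdef_DynCQ:
  assumes "mdef X" and QX: "\<And>W \<sigma>. in_dom W \<sigma> \<Longrightarrow> Q W (map \<sigma> [0..<k]) \<longleftrightarrow> X W \<sigma>"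
    and "\<And>W js. Q W js \<Longrightarrow> js \<in> tuples k W"
  shows "(\<lambda>W. {js. Q W js}) \<in> DynCQ k"
proof -
  from assms(1) obtain F where "closed_family F" "fdef F X"
    unfolding mdef_def by blast
  from closed_family_DynCQ[OF closed_family_insert[OF this QX] _ assms(3)] show ?thesis
    by blast
qed

text \<open>The new queries may refer to each other and to themselves in their update formulas, as
  interval equality and the state queries of an automaton do.\<close>

lemma closed_family_extend:
  assumes F: "closed_family F" and "finite G"
    and G: "\<And>k Q. (k, Q) \<in> G \<Longrightarrow> initializable k Q" "\<And>k Q p. (k, Q) \<in> G \<Longrightarrow> updatable (F \<union> G) k Q p"
  shows "closed_family (F \<union> G)"
proof -
  have "finite (F \<union> G)" "statics \<subseteq> F \<union> G"
    using F assms(2) unfolding closed_family_def by (simp_all add: le_supI1)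
  moreover have "initializable k Q \<and> (\<forall>p. updatable (F \<union> G) k Q p)" if "(k, Q) \<in> F" for k Q
    using that F updatable_mono[OF _ Un_upper1[of F G]] unfolding closed_family_def by blast
  ultimately show ?thesis
    using G unfolding closed_family_def by (metis UnE)
qed

lemma closed_family_statics: "closed_family (statics :: (nat \<times> 'a query) set)"
proof -
  have init: "initializable k Q" if "(k, Q) \<in> statics" for k and Q :: "'a query"
    unfolding initializable_def using fdef_atom[OF that, of "[0..<k]"]
    by (intro exI[of _ "\<lambda>W \<sigma>. Q W (map \<sigma> [0..<k])"]) simp
  have "updatable statics k Q p" if "(k, Q) \<in> statics" for k and Q :: "'a query" and p
  proof -
    have "Q (apply_op p i W) js = Q W js" for i W js
      using that by (auto simp: statics_def q_lt_def q_eq_def q_succ_def q_first_def q_dollar_def ws_dollar_def)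
    then show ?thesis
      unfolding updatable_def using fdef_atom[OF that, of "[1..<1 + k]"]
      by (intro exI[of _ "\<lambda>W \<sigma>. Q W (map \<sigma> [1..<1 + k])"]) (simp del: upt_Suc)
  qed
  moreover have "finite (statics :: (nat \<times> 'a query) set)" by (simp add: statics_def)
  ultimately show ?thesis using init unfolding closed_family_def by blast
qed

section \<open>Closure of maintainable queries under logical operations\<close>

lemma mdefI: "closed_family F \<Longrightarrow> fdef F X \<Longrightarrow> mdef X"
  unfolding mdef_def by blast

lemma mdef_cong:
  assumes "mdef X" "\<And>W \<sigma>. in_dom W \<sigma> \<Longrightarrow> Y W \<sigma> \<longleftrightarrow> X W \<sigma>"
  shows "mdef Y"
  using assms fdef_cong unfolding mdef_def by metis

lemma mdef_const: "mdef (\<lambda>W \<sigma>. c)"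
  by (rule mdefI[OF closed_family_statics fdef_const])

lemma mdef_and:
  assumes "mdef X" "mdef Y"
  shows "mdef (\<lambda>W \<sigma>. X W \<sigma> \<and> Y W \<sigma>)"
proof -
  from assms obtain F G where "closed_family F" "fdef F X" "closed_family G" "fdef G Y"
    unfolding mdef_def by blast
  then show ?thesis
    by (intro mdefI[OF closed_family_union[of F G]] fdef_and) (auto elim: fdef_mono)
qed

lemma mdef_or:
  assumes "mdef X" "mdef Y"
  shows "mdef (\<lambda>W \<sigma>. X W \<sigma> \<or> Y W \<sigma>)"
proof -
  from assms obtain F G where "closed_family F" "fdef F X" "closed_family G" "fdef G Y"
    unfolding mdef_def by blast
  then show ?thesis
    by (intro mdefI[OF closed_family_union[of F G]] fdef_or) (auto elim: fdef_mono)
qed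

lemma mdef_ex: "mdef X \<Longrightarrow> mdef (\<lambda>W \<sigma>. \<exists>d\<in>ws_dom W. X W (\<sigma>(v := d)))"
  unfolding mdef_def using fdef_ex by blast

lemma mdef_exs:
  assumes "finite Z" "mdef X"
  shows "mdef (\<lambda>W \<sigma>. \<exists>\<tau>. in_dom W \<tau> \<and> (\<forall>v. v \<notin> Z \<longrightarrow> \<tau> v = \<sigma> v) \<and> X W \<tau>)"
proof -
  from assms(2) obtain F where "closed_family F" "fdef F X" unfolding mdef_def by blast
  then show ?thesis by (intro mdefI[of F] fdef_exs[OF assms(1)])
qed

lemma mdef_Ball:
  assumes "finite S" "\<And>s. s \<in> S \<Longrightarrow> mdef (X s)"
  shows "mdef (\<lambda>W \<sigma>. \<forall>s\<in>S. X s W \<sigma>)"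
  using assms by (induction S rule: finite_induct) (simp_all add: mdef_const mdef_and)

lemma fdef_lt: "statics \<subseteq> F \<Longrightarrow> fdef F (\<lambda>W \<sigma>. \<sigma> u < \<sigma> v)"
  using fdef_atom[of 2 q_lt F "[u, v]"] by (auto simp: statics_def q_lt_def)

lemma fdef_eq: "statics \<subseteq> F \<Longrightarrow> fdef F (\<lambda>W \<sigma>. \<sigma> u = \<sigma> v)"
  using fdef_atom[of 2 q_eq F "[u, v]"] by (auto simp: statics_def q_eq_def)

lemma fdef_succ: "statics \<subseteq> F \<Longrightarrow> fdef F (\<lambda>W \<sigma>. \<sigma> v = Suc (\<sigma> u))"
  using fdef_atom[of 2 q_succ F "[u, v]"] by (auto simp: statics_def q_succ_def)

lemma fdef_first: "statics \<subseteq> F \<Longrightarrow> fdef F (\<lambda>W \<sigma>. \<sigma> u = 1)"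
  using fdef_atom[of 1 q_first F "[u]"] by (auto simp: statics_def q_first_def)

lemma fdef_dollar: "statics \<subseteq> F \<Longrightarrow> fdef F (\<lambda>W \<sigma>. \<sigma> u = ws_dollar W)"
  using fdef_atom[of 1 q_dollar F "[u]"] by (auto simp: statics_def q_dollar_def)

lemma fdef_le: "statics \<subseteq> F \<Longrightarrow> fdef F (\<lambda>W \<sigma>. \<sigma> u \<le> \<sigma> v)"
  using fdef_or[OF fdef_lt fdef_eq, of F u v u v] by (simp add: le_less)

lemmas mdef_le = mdefI[OF closed_family_statics fdef_le[OF order_refl]]
lemmas mdef_first = mdefI[OF closed_family_statics fdef_first[OF order_refl]]
lemmas mdef_dollar = mdefI[OF closed_family_statics fdef_dollar[OF order_refl]]

section \<open>Words of position intervals\<close>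

text \<open>Intervals are half-open like spans, and empty if \<open>y \<le> x\<close>. As
  \<open>y\<close> may be \<open>$\<close>, every factor of the word is the word of an
  interval.\<close>

definition seg :: "'a wstruct \<Rightarrow> nat \<Rightarrow> nat \<Rightarrow> 'a list" where
  "seg W x y = ws_word (take (y - x) (drop (x - 1) W))"

lemma ws_word_Nil [simp]: "ws_word [] = []"
  by (simp add: ws_word_def)

lemma ws_word_append [simp]: "ws_word (U @ V) = ws_word U @ ws_word V"
  by (simp add: ws_word_def)

lemma ws_word_Cons: "ws_word (s # U) = (case s of None \<Rightarrow> [] | Some a \<Rightarrow> [a]) @ ws_word U"
  by (simp add: ws_word_def split: option.split)

lemma ws_word_replicate_None [simp]: "ws_word (replicate n None) = []"
  by (simp add: ws_word_def)

lemma ws_word_eq_append: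
  "ws_word U = u @ v \<Longrightarrow> \<exists>U1 U2. U = U1 @ U2 \<and> ws_word U1 = u \<and> ws_word U2 = v"
proof (induction U arbitrary: u)
  case Nil
  then show ?case by simp
next
  case (Cons s U)
  show ?case
  proof (cases "u = []")
    case True
    then show ?thesis using Cons.prems by (intro exI[of _ "[]"] exI[of _ "s # U"]) simp
  next
    case False
    then obtain u' where u': "u = (case s of None \<Rightarrow> [] | Some a \<Rightarrow> [a]) @ u'" "ws_word U = u' @ v"
      using Cons.prems by (cases s; cases u) (auto simp: ws_word_Cons)
    from Cons.IH[OF u'(2)] obtain U1 U2 where "U = U1 @ U2" "ws_word U1 = u'" "ws_word U2 = v"
      by blast
    then show ?thesis using u'(1)
      by (intro exI[of _ "s # U1"] exI[of _ U2]) (simp add: ws_word_Cons)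
  qed
qed

lemma ws_word_eq_append_Cons:
  "ws_word U = u @ a # v \<Longrightarrow> \<exists>U1 U2. U = U1 @ Some a # U2 \<and> ws_word U1 = u \<and> ws_word U2 = v"
proof (induction U arbitrary: u)
  case Nil
  then show ?case by simp
next
  case (Cons s U)
  show ?case
  proof (cases "s = Some a \<and> u = []")
    case True
    then show ?thesis using Cons.prems
      by (intro exI[of _ "[]"] exI[of _ U]) (simp add: ws_word_Cons)
  next
    case False
    then obtain u' where u': "u = (case s of None \<Rightarrow> [] | Some a \<Rightarrow> [a]) @ u'" "ws_word U = u' @ a # v"
      using Cons.prems by (cases s; cases u) (auto simp: ws_word_Cons)
    from Cons.IH[OF u'(2)] obtain U1 U2 where "U = U1 @ Some a # U2" "ws_word U1 = u'" "ws_word U2 = v"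
      by blast
    then show ?thesis using u'(1)
      by (intro exI[of _ "s # U1"] exI[of _ U2]) (simp add: ws_word_Cons)
  qed
qed

lemma seg_refl [simp]: "seg W x x = []"
  by (simp add: seg_def)

lemma seg_append:
  assumes "1 \<le> x" "x \<le> y" "y \<le> z"
  shows "seg W x z = seg W x y @ seg W y z"
proof -
  have "take (z - x) (drop (x - 1) W) = take (y - x) (drop (x - 1) W) @ take (z - y) (drop (y - x) (drop (x - 1) W))"
    using assms take_add[of "y - x" "z - y" "drop (x - 1) W"] by simp
  also have "drop (y - x) (drop (x - 1) W) = drop (y - 1) W"
    using assms by simp
  finally show ?thesis by (simp add: seg_def)
qed

lemma seg_Suc:
  assumes "1 \<le> x" "x \<le> length W"
  shows "seg W x (Suc x) = (case W ! (x - 1) of None \<Rightarrow> [] | Some a \<Rightarrow> [a])"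
proof -
  have "take 1 (drop (x - 1) W) = [W ! (x - 1)]"
    using assms take_Suc_conv_app_nth[of 0 "drop (x - 1) W"] by simp
  then show ?thesis by (simp add: seg_def ws_word_Cons)
qed

lemma interval_eq_append:
  assumes "1 \<le> x" "x \<le> y" "y \<le> Suc (length W)" "take (y - x) (drop (x - 1) W) = U1 @ U2"
  defines "z \<equiv> x + length U1"
  shows "z \<le> y" "take (z - x) (drop (x - 1) W) = U1" "take (y - z) (drop (z - 1) W) = U2"
proof -
  have "length (U1 @ U2) = y - x"
    unfolding assms(4)[symmetric] using assms(1-3) by simp
  then show *: "z \<le> y" using assms(2) by (simp add: z_def)
  have "U1 = take (length U1) (take (y - x) (drop (x - 1) W))"
    by (subst assms(4)) simp
  then show "take (z - x) (drop (x - 1) W) = U1"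
    using * by (simp add: z_def min_def split: if_splits)
  have "U2 = drop (length U1) (take (y - x) (drop (x - 1) W))"
    by (subst assms(4)) simp
  also have "\<dots> = take (y - z) (drop (z - 1) W)"
    using assms(1) by (simp add: drop_take z_def add.commute)
  finally show "take (y - z) (drop (z - 1) W) = U2" by simp
qed

lemma seg_eq_append:
  assumes "1 \<le> x" "x \<le> y" "y \<le> Suc (length W)" "seg W x y = u @ v"
  shows "\<exists>z. x \<le> z \<and> z \<le> y \<and> seg W x z = u \<and> seg W z y = v"
proof -
  from ws_word_eq_append assms(4) obtain U1 U2
    where U: "take (y - x) (drop (x - 1) W) = U1 @ U2" "ws_word U1 = u" "ws_word U2 = v"
    unfolding seg_def by metis
  show ?thesis
    using interval_eq_append[OF assms(1-3) U(1)] U(2,3)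
    by (intro exI[of _ "x + length U1"]) (simp add: seg_def)
qed

lemma seg_eq_append_Cons:
  assumes "1 \<le> x" "x \<le> y" "y \<le> Suc (length W)" "seg W x y = u @ a # v"
  shows "\<exists>z. x \<le> z \<and> z < y \<and> z \<in> ws_rel W a \<and> seg W x z = u \<and> seg W (Suc z) y = v"
proof -
  from ws_word_eq_append_Cons assms(4) obtain U1 U2
    where U: "take (y - x) (drop (x - 1) W) = U1 @ Some a # U2" "ws_word U1 = u" "ws_word U2 = v"
    unfolding seg_def by metis
  define z where "z = x + length U1"
  note z = interval_eq_append[OF assms(1-3) U(1), folded z_def]
  have "z \<noteq> y" using z(3) by auto
  then have "z < y" using z(1) by simp
  \<comment> \<open>A second cut, now behind the letter, gives the part that starts at
    \<open>Suc z\<close>.\<close>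
  have "U1 @ Some a # U2 = (U1 @ [Some a]) @ U2" by simp
  from interval_eq_append[OF assms(1-3) U(1)[unfolded this]]
  have "seg W (Suc z) y = v" by (simp add: seg_def z_def U)
  moreover have "W ! (z - 1) = Some a"
  proof -
    have "take (y - z) (drop (z - 1) W) ! 0 = Some a" using z(3) by simp
    then show ?thesis using \<open>z < y\<close> assms(3) by simp
  qed
  ultimately show ?thesis using z(2) U(2) \<open>z < y\<close> assms
    by (intro exI[of _ z]) (auto simp: seg_def ws_rel_def z_def)
qed

lemma seg_replicate_None [simp]: "seg (replicate n None) x y = []"
  by (simp add: seg_def)

section \<open>The word of an interval after an update\<close>

definition op_word :: "'a upd_op \<Rightarrow> 'a list" where
  "op_word p = (case p of Ins a \<Rightarrow> [a] | Reset \<Rightarrow> [])"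

lemma seg_apply_op_outside:
  assumes "1 \<le> i" "1 \<le> x" "i < x \<or> y \<le> i"
  shows "seg (apply_op p i W) x y = seg W x y"
proof -
  have "take (y - x) (drop (x - 1) (W[i - 1 := s])) = take (y - x) (drop (x - 1) W)" for s
    using assms by (intro nth_equalityI) auto
  then show ?thesis by (cases p) (simp_all add: seg_def)
qed

lemma seg_apply_op_inside:
  assumes "1 \<le> x" "x \<le> i" "i < y" "i \<le> length W"
  shows "seg (apply_op p i W) x y = seg W x i @ op_word p @ seg W (Suc i) y"
proof -
  let ?W = "apply_op p i W"
  have "seg ?W x y = seg ?W x i @ seg ?W i (Suc i) @ seg ?W (Suc i) y"
    using assms seg_append[of x i y ?W] seg_append[of i "Suc i" y ?W] by simp
  moreover have "seg ?W i (Suc i) = op_word p"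
    using assms by (subst seg_Suc) (cases p; simp add: op_word_def)+
  ultimately show ?thesis using assms by (simp add: seg_apply_op_outside)
qed

section \<open>Equality of intervals\<close>

definition segeq :: "'a wstruct \<Rightarrow> nat \<Rightarrow> nat \<Rightarrow> nat \<Rightarrow> nat \<Rightarrow> bool" where
  "segeq W x y x' y' \<longleftrightarrow> x \<le> y \<and> x' \<le> y' \<and> seg W x y = seg W x' y'"

text \<open>Between \<open>z\<close> and \<open>z'\<close> an old interval shows what the update
  writes: one symbol-element for an insertion, a mere cut for a reset.\<close>

definition op_match :: "'a upd_op \<Rightarrow> 'a wstruct \<Rightarrow> nat \<Rightarrow> nat \<Rightarrow> bool" where
  "op_match p W z z' \<longleftrightarrow> (case p of Ins a \<Rightarrow> z \<in> ws_rel W a \<and> z' = Suc z | Reset \<Rightarrow> z' = z)"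

lemma op_match_seg: "op_match p W z z' \<Longrightarrow> z \<le> z' \<and> seg W z z' = op_word p"
  by (cases p) (auto simp: op_match_def op_word_def ws_rel_def seg_Suc)

lemma seg_eq_op_word:
  assumes "1 \<le> x" "x \<le> y" "y \<le> Suc (length W)" "seg W x y = u @ op_word p @ v"
  shows "\<exists>z z'. x \<le> z \<and> z' \<le> y \<and> op_match p W z z' \<and> seg W x z = u \<and> seg W z' y = v"
proof (cases p)
  case (Ins a)
  then show ?thesis
    using seg_eq_append_Cons[OF assms(1-3), of u a v] assms(4) by (auto simp: op_word_def op_match_def)
next
  case Reset
  then show ?thesis
    using seg_eq_append[OF assms(1-3), of u v] assms(4) by (auto simp: op_word_def op_match_def)
qed

lemma seg_op_match_append:
  assumes "1 \<le> x" "x \<le> z" "op_match p W z z'" "z' \<le> y"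
  shows "seg W x y = seg W x z @ op_word p @ seg W z' y"
  using assms op_match_seg[OF assms(3)] seg_append[of x z y W] seg_append[of z z' y W] by simp

text \<open>\<open>op_word p\<close> has at most one letter, so its two occurrences in the same word
  either coincide or do not overlap.\<close>

lemma append_op_word_eq:
  assumes "u @ op_word p @ v = u' @ op_word p @ v'" "length u \<le> length u'"
  shows "u = u' \<and> v = v' \<or> (\<exists>s. u' = u @ op_word p @ s \<and> v = s @ op_word p @ v')"
proof -
  have "u = take (length u) (u @ op_word p @ v)" by simp
  also have "\<dots> = take (length u) u'" using assms by simp
  finally have u': "u' = u @ drop (length u) u'" by (metis append_take_drop_id)
  then obtain t where t: "u' = u @ t" by blast
  then have "op_word p @ v = t @ op_word p @ v'" using assms(1) by simp
  note t = t this
  show ?thesis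
    using t by (cases p; cases t) (auto simp: op_word_def)
qed

text \<open>The updated position \<open>i\<close> (with successor \<open>j\<close>) lies in the interval from \<open>x\<close> to \<open>y\<close>. If it lies in
  the second interval too, then cutting both words at \<open>i\<close> gives at most three pairs of old intervals.\<close>

definition segeq_cut ::
  "'a upd_op \<Rightarrow> 'a wstruct \<Rightarrow> nat \<Rightarrow> nat \<Rightarrow> nat \<Rightarrow> nat \<Rightarrow> nat \<Rightarrow> nat \<Rightarrow> bool" where
  "segeq_cut p W i j x y x' y' \<longleftrightarrow> x \<le> i \<and> i < y \<and>
     ((i < x' \<or> y' \<le> i) \<and> (\<exists>z\<in>ws_dom W. \<exists>z'\<in>ws_dom W.
        op_match p W z z' \<and> segeq W x i x' z \<and> segeq W j y z' y') \<or>
      x' \<le> i \<and> i < y' \<and> segeq W x i x' i \<and> segeq W j y j y' \<or>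
      x' \<le> i \<and> i < y' \<and> (\<exists>z\<in>ws_dom W. \<exists>z'\<in>ws_dom W. \<exists>t\<in>ws_dom W. \<exists>t'\<in>ws_dom W.
        op_match p W z z' \<and> op_match p W t t' \<and>
        segeq W x i x' z \<and> segeq W z' i j t \<and> segeq W t' y j y'))"

lemma segeq_cut_sound:
  assumes "segeq_cut p W i (Suc i) x y x' y'" "1 \<le> x" "1 \<le> x'" "i \<le> length W"
  shows "segeq (apply_op p i W) x y x' y'"
proof -
  have xy: "x \<le> i" "i < y" using assms(1) by (auto simp: segeq_cut_def)
  have in1: "seg (apply_op p i W) x y = seg W x i @ op_word p @ seg W (Suc i) y"
    using seg_apply_op_inside xy assms by blast
  from assms(1) consider
    (a) z z' where "i < x' \<or> y' \<le> i" "op_match p W z z'" "segeq W x i x' z" "segeq W (Suc i) y z' y'"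
    | (b) "x' \<le> i" "i < y'" "segeq W x i x' i" "segeq W (Suc i) y (Suc i) y'"
    | (c) z z' t t' where "x' \<le> i" "i < y'" "op_match p W z z'" "op_match p W t t'"
        "segeq W x i x' z" "segeq W z' i (Suc i) t" "segeq W t' y (Suc i) y'"
    unfolding segeq_cut_def by blast
  then show ?thesis
  proof cases
    case a
    have "seg W x' y' = seg W x' z @ op_word p @ seg W z' y'"
      using a assms by (intro seg_op_match_append) (auto simp: segeq_def)
    moreover have "seg (apply_op p i W) x' y' = seg W x' y'"
      using a assms xy by (intro seg_apply_op_outside) auto
    moreover have "x' \<le> y'"
      using a op_match_seg[OF a(2)] by (auto simp: segeq_def)
    ultimately show ?thesis using a in1 xy by (simp add: segeq_def)
  next
    case b
    have "seg (apply_op p i W) x' y' = seg W x' i @ op_word p @ seg W (Suc i) y'"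
      using seg_apply_op_inside b assms by blast
    then show ?thesis using b in1 xy by (simp add: segeq_def)
  next
    case c
    have "seg (apply_op p i W) x' y' = seg W x' i @ op_word p @ seg W (Suc i) y'"
      using seg_apply_op_inside c assms by blast
    moreover have "seg W x' i = seg W x' z @ op_word p @ seg W z' i"
      using c assms by (intro seg_op_match_append) (auto simp: segeq_def)
    moreover have "seg W (Suc i) y = seg W (Suc i) t @ op_word p @ seg W t' y"
      using c assms by (intro seg_op_match_append) (auto simp: segeq_def)
    ultimately show ?thesis using c in1 xy by (simp add: segeq_def)
  qed
qed

text \<open>If both intervals contain \<open>i\<close>, the part before \<open>i\<close> can be
  longer in either of them. The length hypothesis selects one of the two orders; exchanging the
  intervals gives the other.\<close>

lemma segeq_cut_complete:
  assumes eq: "segeq (apply_op p i W) x y x' y'" and "1 \<le> x" "1 \<le> x'" "y \<le> Suc (length W)" "y' \<le> Suc (length W)"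
    and i: "x \<le> i" "i < y" and le: "x' \<le> i \<Longrightarrow> i < y' \<Longrightarrow> length (seg W x i) \<le> length (seg W x' i)"
  shows "segeq_cut p W i (Suc i) x y x' y'"
proof -
  have iW: "i \<le> length W" "1 \<le> i" using assms by auto
  have in1: "seg (apply_op p i W) x y = seg W x i @ op_word p @ seg W (Suc i) y"
    using seg_apply_op_inside i iW assms by blast
  have le': "x' \<le> y'" using eq by (simp add: segeq_def)
  show ?thesis
  proof (cases "x' \<le> i \<and> i < y'")
    case False
    then have "seg (apply_op p i W) x' y' = seg W x' y'"
      using assms iW by (intro seg_apply_op_outside) auto
    with eq in1 have "seg W x' y' = seg W x i @ op_word p @ seg W (Suc i) y"
      by (simp add: segeq_def)
    from seg_eq_op_word[OF assms(3) le' assms(5) this] obtain z z'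
      where z: "x' \<le> z" "z' \<le> y'" "op_match p W z z'" "seg W x' z = seg W x i" "seg W z' y' = seg W (Suc i) y"
      by blast
    moreover have "z \<le> z'" using op_match_seg[OF z(3)] by simp
    ultimately have "z \<in> ws_dom W" "z' \<in> ws_dom W" using assms by (auto simp: ws_dom_def)
    with z i False show ?thesis
      unfolding segeq_cut_def by (fastforce simp: segeq_def)
  next
    case True
    then have in2: "seg (apply_op p i W) x' y' = seg W x' i @ op_word p @ seg W (Suc i) y'"
      using seg_apply_op_inside iW assms by blast
    have "seg W x i @ op_word p @ seg W (Suc i) y = seg W x' i @ op_word p @ seg W (Suc i) y'"
      using eq in1 in2 by (simp add: segeq_def)
    from append_op_word_eq[OF this] le True consider
      (b) "seg W x i = seg W x' i" "seg W (Suc i) y = seg W (Suc i) y'"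
      | (c) s where "seg W x' i = seg W x i @ op_word p @ s" "seg W (Suc i) y = s @ op_word p @ seg W (Suc i) y'"
      by blast
    then show ?thesis
    proof cases
      case b
      then show ?thesis using True i unfolding segeq_cut_def by (auto simp: segeq_def)
    next
      case c
      \<comment> \<open>Position \<open>i\<close> of the first interval is matched at
        \<open>z\<close> in the part of the second one before \<open>i\<close>; position
        \<open>i\<close> of the second is matched at \<open>t\<close> in the part of the first one
        behind \<open>i\<close>. The word \<open>s\<close> between the two matches gives the middle
        pair.\<close>
      from seg_eq_op_word[OF assms(3) _ _ c(1)] True iW obtain z z'
        where z: "x' \<le> z" "z' \<le> i" "op_match p W z z'" "seg W x' z = seg W x i" "seg W z' i = s"
        by auto
      from seg_eq_op_word[OF _ _ assms(4) c(2)] i iW obtain t t'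
        where t: "Suc i \<le> t" "t' \<le> y" "op_match p W t t'" "seg W (Suc i) t = s" "seg W t' y = seg W (Suc i) y'"
        by auto
      have "z \<le> z'" "t \<le> t'" using op_match_seg z(3) t(3) by auto
      then have "z \<in> ws_dom W" "z' \<in> ws_dom W" "t \<in> ws_dom W" "t' \<in> ws_dom W"
        using z t assms iW by (auto simp: ws_dom_def)
      moreover have "segeq W x i x' z" "segeq W z' i (Suc i) t" "segeq W t' y (Suc i) y'"
        using z t i True by (auto simp: segeq_def)
      ultimately show ?thesis using z(3) t(3) i True unfolding segeq_cut_def by blast
    qed
  qed
qed

lemma segeq_sym: "segeq W x y x' y' \<longleftrightarrow> segeq W x' y' x y"
  by (auto simp: segeq_def)

lemma segeq_apply_op:
  assumes "1 \<le> x" "1 \<le> x'" "y \<le> Suc (length W)" "y' \<le> Suc (length W)" "1 \<le> i" "i \<le> length W"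
  shows "segeq (apply_op p i W) x y x' y' \<longleftrightarrow>
    (i < x \<or> y \<le> i) \<and> (i < x' \<or> y' \<le> i) \<and> segeq W x y x' y' \<or>
    segeq_cut p W i (Suc i) x y x' y' \<or> segeq_cut p W i (Suc i) x' y' x y" (is "?L \<longleftrightarrow> ?R")
proof
  assume ?R
  then show ?L
    using segeq_cut_sound[of p W i x y x' y'] segeq_cut_sound[of p W i x' y' x y] assms
    by (auto simp: segeq_sym segeq_def seg_apply_op_outside)
next
  assume L: ?L
  show ?R
  proof (cases "x \<le> i \<and> i < y \<or> x' \<le> i \<and> i < y'")
    case False
    then show ?thesis using L assms by (auto simp: segeq_def seg_apply_op_outside)
  next
    case True
    have c1: "segeq_cut p W i (Suc i) x y x' y'"
      if "x \<le> i" "i < y" "x' \<le> i \<Longrightarrow> i < y' \<Longrightarrow> length (seg W x i) \<le> length (seg W x' i)"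
      using segeq_cut_complete[OF L] that assms by blast
    have c2: "segeq_cut p W i (Suc i) x' y' x y"
      if "x' \<le> i" "i < y'" "x \<le> i \<Longrightarrow> i < y \<Longrightarrow> length (seg W x' i) \<le> length (seg W x i)"
      using segeq_cut_complete[of p i W x' y' x y] L that assms by (simp add: segeq_sym)
    show ?thesis using True c1 c2 by (meson nat_le_linear)
  qed
qed

section \<open>Stored relations for letters, endpoint elements and interval equality\<close>

definition q_sym :: "'a \<Rightarrow> 'a query" where "q_sym a W js \<longleftrightarrow> js ! 0 \<in> ws_rel W a"
definition q_end :: "'a query" where "q_end W js \<longleftrightarrow> js ! 0 \<in> endpoint_elements W"
definition q_segeq :: "'a query" where "q_segeq W js \<longleftrightarrow> segeq W (js ! 0) (js ! 1) (js ! 2) (js ! 3)"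

text \<open>The letters are stored although update formulas can read the word, because they read the
  new word while the matching of intervals concerns the old one.\<close>

definition base_family :: "(nat \<times> 'a query) set" where
  "base_family = statics \<union> ({(1, q_end), (4, q_segeq)} \<union> range (\<lambda>a. (1, q_sym a)))"

lemma base_family_mem:
  "statics \<subseteq> base_family" "(1, q_end) \<in> base_family" "(4, q_segeq) \<in> base_family"
  "(1, q_sym a) \<in> base_family"
  by (auto simp: base_family_def)

lemma fdef_sym: "base_family \<subseteq> F \<Longrightarrow> fdef F (\<lambda>W \<sigma>. \<sigma> u \<in> ws_rel W a)"
  using fdef_atom[OF subsetD[OF _ base_family_mem(4)], of F "[u]" a] by (simp add: q_sym_def)

lemma fdef_end: "base_family \<subseteq> F \<Longrightarrow> fdef F (\<lambda>W \<sigma>. \<sigma> u \<in> endpoint_elements W)"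
  using fdef_atom[OF subsetD[OF _ base_family_mem(2)], of F "[u]"] by (simp add: q_end_def)

lemma fdef_segeq: "base_family \<subseteq> F \<Longrightarrow> fdef F (\<lambda>W \<sigma>. segeq W (\<sigma> a) (\<sigma> b) (\<sigma> c) (\<sigma> d))"
  using fdef_atom[OF subsetD[OF _ base_family_mem(3)], of F "[a, b, c, d]"]
  by (simp add: q_segeq_def numeral_eq_Suc)

lemma fdef_op_match:
  assumes "base_family \<subseteq> F"
  shows "fdef F (\<lambda>W \<sigma>. op_match p W (\<sigma> u) (\<sigma> v))"
proof (cases p)
  case (Ins a)
  have "statics \<subseteq> F" using assms base_family_mem(1) by blast
  then show ?thesis
    using fdef_and[OF fdef_sym[OF assms] fdef_succ, of u a v u] Ins by (simp add: op_match_def)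
next
  case Reset
  have "statics \<subseteq> F" using assms base_family_mem(1) by blast
  then show ?thesis using fdef_eq[of F v u] Reset by (simp add: op_match_def)
qed

text \<open>In the update formula for interval equality, variable 0 is the updated position, 1 to 4
  are the arguments and 5 is the successor of the position. The bounds reserve 6 to 9 for the
  quantified \<open>z\<close>, \<open>z'\<close>, \<open>t\<close>, \<open>t'\<close>.\<close>

lemma fdef_segeq_cut:
  assumes F: "base_family \<subseteq> F" and "a \<le> 5" "b \<le> 5" "c \<le> 5" "d \<le> 5" "e \<le> 5" "f \<le> 5"
  shows "fdef F (\<lambda>W \<sigma>. segeq_cut p W (\<sigma> a) (\<sigma> b) (\<sigma> c) (\<sigma> d) (\<sigma> e) (\<sigma> f))"
proof -
  have S: "statics \<subseteq> F" using F base_family_mem(1) by blast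
  have ne: "v \<noteq> 6" "v \<noteq> 7" "v \<noteq> 8" "v \<noteq> 9" if "v \<le> 5" for v :: nat
    using that by auto
  note ne = ne[OF assms(2)] ne[OF assms(3)] ne[OF assms(4)] ne[OF assms(5)] ne[OF assms(6)] ne[OF assms(7)]
  have "fdef F (\<lambda>W \<sigma>. op_match p W (\<sigma> 6) (\<sigma> 7) \<and> segeq W (\<sigma> c) (\<sigma> a) (\<sigma> e) (\<sigma> 6) \<and>
      segeq W (\<sigma> b) (\<sigma> d) (\<sigma> 7) (\<sigma> f))"
    by (intro fdef_and fdef_op_match fdef_segeq F)
  from fdef_ex[OF fdef_ex[OF this, of 7], of 6]
  have 1: "fdef F (\<lambda>W \<sigma>. \<exists>z\<in>ws_dom W. \<exists>z'\<in>ws_dom W. op_match p W z z' \<and>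
      segeq W (\<sigma> c) (\<sigma> a) (\<sigma> e) z \<and> segeq W (\<sigma> b) (\<sigma> d) z' (\<sigma> f))"
    by (simp add: ne)
  have "fdef F (\<lambda>W \<sigma>. op_match p W (\<sigma> 6) (\<sigma> 7) \<and> op_match p W (\<sigma> 8) (\<sigma> 9) \<and>
      segeq W (\<sigma> c) (\<sigma> a) (\<sigma> e) (\<sigma> 6) \<and> segeq W (\<sigma> 7) (\<sigma> a) (\<sigma> b) (\<sigma> 8) \<and>
      segeq W (\<sigma> 9) (\<sigma> d) (\<sigma> b) (\<sigma> f))"
    by (intro fdef_and fdef_op_match fdef_segeq F)
  from fdef_ex[OF fdef_ex[OF fdef_ex[OF fdef_ex[OF this, of 9], of 8], of 7], of 6]
  have 2: "fdef F (\<lambda>W \<sigma>. \<exists>z\<in>ws_dom W. \<exists>z'\<in>ws_dom W. \<exists>t\<in>ws_dom W. \<exists>t'\<in>ws_dom W.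
      op_match p W z z' \<and> op_match p W t t' \<and>
      segeq W (\<sigma> c) (\<sigma> a) (\<sigma> e) z \<and> segeq W z' (\<sigma> a) (\<sigma> b) t \<and> segeq W t' (\<sigma> d) (\<sigma> b) (\<sigma> f))"
    by (simp add: ne)
  show ?thesis
    unfolding segeq_cut_def by (intro fdef_and fdef_or 1 2 fdef_lt fdef_le fdef_segeq S F)
qed

lemma initializableI:
  fixes X :: "'a wstruct \<Rightarrow> (nat \<Rightarrow> nat) \<Rightarrow> bool" and Q :: "'a query"
  assumes "fdef statics X"
    and "\<And>n \<sigma>. in_dom (init_ws n :: 'a wstruct) \<sigma> \<Longrightarrow>
      Q (init_ws n) (map \<sigma> [0..<k]) \<longleftrightarrow> X (init_ws n) \<sigma>"
  shows "initializable k Q"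
  using assms unfolding initializable_def by blast

lemma updatableI:
  assumes "fdef F X"
    and "\<And>W \<sigma>. in_dom W \<sigma> \<Longrightarrow> op_allowed p (\<sigma> 0) W \<Longrightarrow>
      Q (apply_op p (\<sigma> 0) W) (map \<sigma> [1..<1 + k]) \<longleftrightarrow> X W \<sigma>"
  shows "updatable F k Q p"
  using assms unfolding updatable_def by blast

lemma symbol_elements_alt: "symbol_elements W = {i \<in> {1..length W}. W ! (i - 1) \<noteq> None}"
  by (auto simp: symbol_elements_def ws_rel_def)

lemma ws_rel_apply_op:
  "i \<in> {1..length W} \<Longrightarrow>
    ws_rel (apply_op p i W) a = (if p = Ins a then insert i (ws_rel W a) else ws_rel W a - {i})"
  by (cases p) (auto simp: ws_rel_def nth_list_update split: if_splits)

lemma endpoint_elements_apply_op: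
  "i \<in> {1..length W} \<Longrightarrow> endpoint_elements (apply_op p i W) =
    (if p = Reset then endpoint_elements W - {i} else insert i (endpoint_elements W))"
  by (cases p) (auto simp: endpoint_elements_def ws_dollar_def symbol_elements_alt nth_list_update
    split: if_splits)

lemma closed_base_family: "closed_family (base_family :: (nat \<times> 'a::finite query) set)"
  unfolding base_family_def
proof (rule closed_family_extend[OF closed_family_statics])
  show "finite ({(1, q_end), (4, q_segeq)} \<union> range (\<lambda>a. (1, q_sym a)) :: (nat \<times> 'a query) set)"
    by simp
next
  fix k :: nat and Q :: "'a query"
  assume "(k, Q) \<in> {(1, q_end), (4, q_segeq)} \<union> range (\<lambda>a. (1, q_sym a))"
  then consider "k = 1" "Q = q_end" | "k = 4" "Q = q_segeq" | a where "k = 1" "Q = q_sym a"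
    by auto
  then show "initializable k Q"
  proof cases
    case 1
    show ?thesis
      by (rule initializableI[OF fdef_dollar[OF order_refl, of 0]])
        (auto simp: 1 q_end_def endpoint_elements_def symbol_elements_alt init_ws_def)
  next
    case 2
    \<comment> \<open>Initially all intervals spell the empty word, so only the order of their ends
      matters.\<close>
    show ?thesis
      by (rule initializableI[OF fdef_and[OF fdef_le fdef_le, OF order_refl order_refl, of 0 1 2 3]])
        (simp add: 2 q_segeq_def segeq_def init_ws_def numeral_2_eq_2)
  next
    case 3
    show ?thesis
      by (rule initializableI[OF fdef_const[of statics False]]) (auto simp: 3 q_sym_def ws_rel_def init_ws_def)
  qed
next
  fix k :: nat and Q :: "'a query" and p
  assume "(k, Q) \<in> {(1, q_end), (4, q_segeq)} \<union> range (\<lambda>a. (1, q_sym a))"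
  then consider "k = 1" "Q = q_end" | "k = 4" "Q = q_segeq" | a where "k = 1" "Q = q_sym a"
    by auto
  then have "updatable base_family k Q p"
  proof cases
    case 1
    show ?thesis
    proof (cases "p = Reset")
      case True
      have "fdef base_family (\<lambda>W \<sigma>. \<sigma> 1 \<in> endpoint_elements W \<and> (\<sigma> 1 < \<sigma> 0 \<or> \<sigma> 0 < \<sigma> 1) :: bool)"
        by (intro fdef_and fdef_or fdef_end fdef_lt base_family_mem order_refl)
      then show ?thesis
        by (rule updatableI) (use True in \<open>auto simp: 1 q_end_def endpoint_elements_apply_op op_allowed_def
          simp del: apply_op.simps\<close>)
    next
      case False
      have "fdef base_family (\<lambda>W \<sigma>. \<sigma> 1 = \<sigma> 0 \<or> \<sigma> 1 \<in> endpoint_elements W)"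
        by (intro fdef_or fdef_end fdef_eq base_family_mem order_refl)
      then show ?thesis
        by (rule updatableI) (auto simp: 1 False q_end_def endpoint_elements_apply_op op_allowed_def)
    qed
  next
    case 2
    let ?X = "\<lambda>W \<sigma>. (\<sigma> 0 < \<sigma> 1 \<or> \<sigma> 2 \<le> \<sigma> 0) \<and> (\<sigma> 0 < \<sigma> 3 \<or> \<sigma> 4 \<le> \<sigma> 0) \<and>
        segeq W (\<sigma> 1) (\<sigma> 2) (\<sigma> 3) (\<sigma> 4) \<or>
      (\<exists>j\<in>ws_dom W. j = Suc (\<sigma> 0) \<and> (segeq_cut p W (\<sigma> 0) j (\<sigma> 1) (\<sigma> 2) (\<sigma> 3) (\<sigma> 4) \<or>
        segeq_cut p W (\<sigma> 0) j (\<sigma> 3) (\<sigma> 4) (\<sigma> 1) (\<sigma> 2)))"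
    \<comment> \<open>Terms contain no successor function, so the position behind the updated one is
      a quantified variable. It exists in the domain because \<open>$\<close> is never
      updated.\<close>
    have "fdef base_family (\<lambda>W \<sigma>. \<sigma> 5 = Suc (\<sigma> 0) \<and> (segeq_cut p W (\<sigma> 0) (\<sigma> 5) (\<sigma> 1) (\<sigma> 2) (\<sigma> 3) (\<sigma> 4) \<or>
        segeq_cut p W (\<sigma> 0) (\<sigma> 5) (\<sigma> 3) (\<sigma> 4) (\<sigma> 1) (\<sigma> 2)))"
      by (intro fdef_and fdef_or fdef_segeq_cut fdef_succ base_family_mem order_refl) simp_all
    from fdef_ex[OF this, of 5]
    have "fdef base_family (\<lambda>W \<sigma>. \<exists>j\<in>ws_dom W. j = Suc (\<sigma> 0) \<and>
        (segeq_cut p W (\<sigma> 0) j (\<sigma> 1) (\<sigma> 2) (\<sigma> 3) (\<sigma> 4) \<or>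
         segeq_cut p W (\<sigma> 0) j (\<sigma> 3) (\<sigma> 4) (\<sigma> 1) (\<sigma> 2)))"
      by simp
    then have "fdef base_family ?X"
      by (intro fdef_or fdef_and fdef_segeq fdef_le fdef_lt base_family_mem order_refl)
    then show ?thesis
    proof (rule updatableI)
      fix W and \<sigma> :: "nat \<Rightarrow> nat"
      assume \<sigma>: "in_dom W \<sigma>" and op: "op_allowed p (\<sigma> 0) W"
      have i: "1 \<le> \<sigma> 0" "\<sigma> 0 \<le> length W" using op by (auto simp: op_allowed_def)
      then have "Suc (\<sigma> 0) \<in> ws_dom W" by (simp add: ws_dom_def)
      moreover have "q_segeq (apply_op p (\<sigma> 0) W) (map \<sigma> [1..<1 + 4]) \<longleftrightarrow>
          segeq (apply_op p (\<sigma> 0) W) (\<sigma> 1) (\<sigma> 2) (\<sigma> 3) (\<sigma> 4)"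
        by (simp add: q_segeq_def numeral_eq_Suc)
      ultimately show "Q (apply_op p (\<sigma> 0) W) (map \<sigma> [1..<1 + k]) \<longleftrightarrow> ?X W \<sigma>"
        unfolding 2 using segeq_apply_op[of "\<sigma> 1" "\<sigma> 3" "\<sigma> 2" W "\<sigma> 4" "\<sigma> 0" p]
          in_dom_bounds[OF \<sigma>] i by auto
    qed
  next
    case 3
    show ?thesis
    proof (cases "p = Ins a")
      case False
      have "fdef base_family (\<lambda>W \<sigma>. \<sigma> 1 \<in> ws_rel W a \<and> (\<sigma> 1 < \<sigma> 0 \<or> \<sigma> 0 < \<sigma> 1))"
        by (intro fdef_and fdef_or fdef_sym fdef_lt base_family_mem order_refl)
      then show ?thesis
        by (rule updatableI) (auto simp: 3 False q_sym_def ws_rel_apply_op op_allowed_def)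
    next
      case True
      have "fdef base_family (\<lambda>W \<sigma>. \<sigma> 1 = \<sigma> 0 \<or> \<sigma> 1 \<in> ws_rel W a)"
        by (intro fdef_or fdef_sym fdef_eq base_family_mem order_refl)
      then show ?thesis
        by (rule updatableI) (use True in \<open>auto simp: 3 q_sym_def ws_rel_apply_op op_allowed_def
          simp del: apply_op.simps\<close>)
    qed
  qed
  then show "updatable (statics \<union> ({(1, q_end), (4, q_segeq)} \<union> range (\<lambda>a. (1, q_sym a)))) k Q p"
    by (simp add: base_family_def)
qed

lemmas mdef_end = mdefI[OF closed_base_family fdef_end[OF order_refl]]
lemmas mdef_segeq = mdefI[OF closed_base_family fdef_segeq[OF order_refl]]

section \<open>Regular languages\<close>

definition lderiv :: "'a list \<Rightarrow> 'a list set \<Rightarrow> 'a list set" where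
  "lderiv u A = {v. u @ v \<in> A}"

lemma lderiv_Nil [simp]: "lderiv [] A = A"
  by (simp add: lderiv_def)

lemma lderiv_append: "lderiv (u @ v) A = lderiv v (lderiv u A)"
  by (simp add: lderiv_def)

lemma Nil_in_lderiv: "[] \<in> lderiv u A \<longleftrightarrow> u \<in> A"
  by (simp add: lderiv_def)

text \<open>A language is regular iff it has finitely many left quotients; these are the states of its
  minimal automaton.\<close>

definition lderiv_closed :: "'a list set set \<Rightarrow> bool" where
  "lderiv_closed \<D> \<longleftrightarrow> finite \<D> \<and> (\<forall>A\<in>\<D>. \<forall>a. lderiv [a] A \<in> \<D>)"

lemma lderiv_closed_mem: "lderiv_closed \<D> \<Longrightarrow> A \<in> \<D> \<Longrightarrow> lderiv u A \<in> \<D>"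
proof (induction u arbitrary: A)
  case (Cons a u)
  then show ?case using lderiv_append[of "[a]" u A] by (simp add: lderiv_closed_def)
qed simp

definition q_lang :: "'a list set \<Rightarrow> 'a list set \<Rightarrow> 'a query" where
  "q_lang A B W js \<longleftrightarrow> js ! 0 \<le> js ! 1 \<and> lderiv (seg W (js ! 0) (js ! 1)) A = B"

definition lang_family :: "'a list set set \<Rightarrow> (nat \<times> 'a query) set" where
  "lang_family \<D> = {(2, q_lang A B) | A B. A \<in> \<D> \<and> B \<in> \<D>}"

lemma fdef_lderiv:
  assumes "A \<in> \<D>" "B \<in> \<D>"
  shows "fdef (base_family \<union> lang_family \<D>) (\<lambda>W \<sigma>. \<sigma> u \<le> \<sigma> v \<and> lderiv (seg W (\<sigma> u) (\<sigma> v)) A = B)"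
proof -
  have "(2, q_lang A B) \<in> base_family \<union> lang_family \<D>"
    using assms by (auto simp: lang_family_def)
  from fdef_atom[OF this, of "[u, v]"] show ?thesis by (simp add: q_lang_def)
qed

lemma closed_lang_family:
  fixes \<D> :: "'a::finite list set set"
  assumes \<D>: "lderiv_closed \<D>"
  shows "closed_family (base_family \<union> lang_family \<D>)" (is "closed_family ?F")
proof (rule closed_family_extend[OF closed_base_family])
  have "lang_family \<D> = (\<lambda>(A, B). (2, q_lang A B)) ` (\<D> \<times> \<D>)"
    by (auto simp: lang_family_def)
  then show "finite (lang_family \<D>)"
    using \<D> by (simp add: lderiv_closed_def)
next
  fix k :: nat and Q :: "'a query" assume "(k, Q) \<in> lang_family \<D>"
  then obtain A B where AB: "A \<in> \<D>" "B \<in> \<D>" "k = 2" "Q = q_lang A B" by (auto simp: lang_family_def)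
  have "fdef statics (\<lambda>W \<sigma>. \<sigma> 0 \<le> \<sigma> 1 \<and> A = B)"
    by (intro fdef_and fdef_le fdef_const order_refl)
  then show "initializable k Q"
    by (rule initializableI) (simp add: AB q_lang_def init_ws_def numeral_2_eq_2)
next
  fix k :: nat and Q :: "'a query" and p assume "(k, Q) \<in> lang_family \<D>"
  then obtain A B where AB: "A \<in> \<D>" "B \<in> \<D>" "k = 2" "Q = q_lang A B" by (auto simp: lang_family_def)
  have S: "statics \<subseteq> ?F" using base_family_mem(1) by blast
  have fin: "finite \<D>" using \<D> by (simp add: lderiv_closed_def)
  \<comment> \<open>\<open>C\<close> is the state in which the automaton arrives at the updated
    position; it then reads what the update writes and the rest of the interval. Since
    \<open>\<D>\<close> is finite, guessing \<open>C\<close> is a finite disjunction. Variable 3 is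
    the position behind the updated one.\<close>
  have "fdef ?F (\<lambda>W \<sigma>. \<sigma> 3 = Suc (\<sigma> 0) \<and> (\<exists>C\<in>\<D>. (\<sigma> 1 \<le> \<sigma> 0 \<and> lderiv (seg W (\<sigma> 1) (\<sigma> 0)) A = C) \<and>
      (\<sigma> 3 \<le> \<sigma> 2 \<and> lderiv (seg W (\<sigma> 3) (\<sigma> 2)) (lderiv (op_word p) C) = B)))"
    using AB fin lderiv_closed_mem[OF \<D>] by (intro fdef_and fdef_Bex fdef_lderiv fdef_succ S)
  from fdef_ex[OF this, of 3]
  have ex: "fdef ?F (\<lambda>W \<sigma>. \<exists>j\<in>ws_dom W. j = Suc (\<sigma> 0) \<and> (\<exists>C\<in>\<D>. (\<sigma> 1 \<le> \<sigma> 0 \<and> lderiv (seg W (\<sigma> 1) (\<sigma> 0)) A = C) \<and>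
      (j \<le> \<sigma> 2 \<and> lderiv (seg W j (\<sigma> 2)) (lderiv (op_word p) C) = B)))"
    by simp
  have "fdef ?F (\<lambda>W \<sigma>. (\<sigma> 0 < \<sigma> 1 \<or> \<sigma> 2 \<le> \<sigma> 0) \<and> (\<sigma> 1 \<le> \<sigma> 2 \<and> lderiv (seg W (\<sigma> 1) (\<sigma> 2)) A = B) \<or>
      (\<exists>j\<in>ws_dom W. j = Suc (\<sigma> 0) \<and> (\<exists>C\<in>\<D>. (\<sigma> 1 \<le> \<sigma> 0 \<and> lderiv (seg W (\<sigma> 1) (\<sigma> 0)) A = C) \<and>
      (j \<le> \<sigma> 2 \<and> lderiv (seg W j (\<sigma> 2)) (lderiv (op_word p) C) = B))))" (is "fdef _ ?X")
    by (intro fdef_or fdef_and fdef_lt fdef_le fdef_lderiv ex S AB)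
  then show "updatable ?F k Q p"
  proof (rule updatableI)
    fix W and \<sigma> :: "nat \<Rightarrow> nat"
    assume \<sigma>: "in_dom W \<sigma>" and op: "op_allowed p (\<sigma> 0) W"
    let ?W = "apply_op p (\<sigma> 0) W"
    have i: "1 \<le> \<sigma> 0" "\<sigma> 0 \<le> length W" using op by (auto simp: op_allowed_def)
    have d: "Suc (\<sigma> 0) \<in> ws_dom W" "1 \<le> \<sigma> 1" using i in_dom_bounds[OF \<sigma>] by (simp_all add: ws_dom_def)
    have "q_lang A B ?W (map \<sigma> [1..<1 + 2]) \<longleftrightarrow> \<sigma> 1 \<le> \<sigma> 2 \<and> lderiv (seg ?W (\<sigma> 1) (\<sigma> 2)) A = B"
      by (simp add: q_lang_def numeral_2_eq_2)
    also have "\<dots> \<longleftrightarrow> ?X W \<sigma>"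
    proof (cases "\<sigma> 1 \<le> \<sigma> 0 \<and> \<sigma> 0 < \<sigma> 2")
      case True
      have "seg ?W (\<sigma> 1) (\<sigma> 2) = seg W (\<sigma> 1) (\<sigma> 0) @ op_word p @ seg W (Suc (\<sigma> 0)) (\<sigma> 2)"
        using True d i by (intro seg_apply_op_inside) auto
      then show ?thesis
        using True d lderiv_closed_mem[OF \<D> AB(1)] by (auto simp: lderiv_append)
    next
      case False
      then have "seg ?W (\<sigma> 1) (\<sigma> 2) = seg W (\<sigma> 1) (\<sigma> 2)"
        using d i by (intro seg_apply_op_outside) auto
      then show ?thesis using False by auto
    qed
    finally show "Q ?W (map \<sigma> [1..<1 + k]) \<longleftrightarrow> ?X W \<sigma>" using AB by simp
  qed
qed

lemma mdef_lderiv_closed: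
  fixes \<D> :: "'a::finite list set set"
  assumes \<D>: "lderiv_closed \<D>" and L: "L \<in> \<D>"
  shows "mdef (\<lambda>W \<sigma>. \<sigma> u \<le> \<sigma> v \<and> seg W (\<sigma> u) (\<sigma> v) \<in> L)"
proof -
  let ?F = "base_family \<union> lang_family \<D>"
  \<comment> \<open>The accepting states are those that contain the empty word.\<close>
  have "fdef ?F (\<lambda>W \<sigma>. \<exists>B\<in>{B\<in>\<D>. [] \<in> B}. \<sigma> u \<le> \<sigma> v \<and> lderiv (seg W (\<sigma> u) (\<sigma> v)) L = B)"
  proof (rule fdef_Bex)
    show "finite {B \<in> \<D>. [] \<in> B}" using \<D> by (simp add: lderiv_closed_def)
    fix B assume "B \<in> {B \<in> \<D>. [] \<in> B}"
    then show "fdef ?F (\<lambda>W \<sigma>. \<sigma> u \<le> \<sigma> v \<and> lderiv (seg W (\<sigma> u) (\<sigma> v)) L = B)"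
      using L by (intro fdef_lderiv) auto
  qed
  from mdefI[OF closed_lang_family[OF \<D>] this] show ?thesis
    by (rule mdef_cong) (use lderiv_closed_mem[OF \<D> L] Nil_in_lderiv in auto)
qed

section \<open>Closure properties of regular languages\<close>

definition regular :: "'a list set \<Rightarrow> bool" where
  "regular L \<longleftrightarrow> (\<exists>\<D>. lderiv_closed \<D> \<and> L \<in> \<D>)"

definition conc :: "'a list set \<Rightarrow> 'a list set \<Rightarrow> 'a list set" where
  "conc A B = {u @ v | u v. u \<in> A \<and> v \<in> B}"

definition star :: "'a list set \<Rightarrow> 'a list set" where
  "star A = {concat us | us. set us \<subseteq> A}"

lemma lderiv_conc: "lderiv [a] (conc A B) = conc (lderiv [a] A) B \<union> (if [] \<in> A then lderiv [a] B else {})"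
proof -
  have "a # w \<in> conc A B \<longleftrightarrow> (\<exists>u v. w = u @ v \<and> a # u \<in> A \<and> v \<in> B) \<or> [] \<in> A \<and> a # w \<in> B" for w
    unfolding conc_def by (auto simp: Cons_eq_append_conv)
  then show ?thesis by (auto simp: lderiv_def conc_def)
qed

lemma conc_empty [simp]: "conc {} L = {}"
  by (auto simp: conc_def)

lemma conc_Un: "conc (A \<union> B) L = conc A L \<union> conc B L"
  by (auto simp: conc_def)

lemma lderiv_Un: "lderiv u (A \<union> B) = lderiv u A \<union> lderiv u B"
  by (auto simp: lderiv_def)

lemma lderiv_Union: "lderiv u (\<Union>\<B>) = \<Union> (lderiv u ` \<B>)"
  by (auto simp: lderiv_def)

lemma lderiv_star: "lderiv [a] (star L) = conc (lderiv [a] L) (star L)"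
proof (intro set_eqI iffI)
  fix w assume "w \<in> lderiv [a] (star L)"
  then obtain us where us: "a # w = concat us" "set us \<subseteq> L"
    by (auto simp: lderiv_def star_def)
  then show "w \<in> conc (lderiv [a] L) (star L)"
  proof (induction us)
    case (Cons u us)
    show ?case
    proof (cases u)
      case Nil
      then show ?thesis using Cons by simp
    next
      case (Cons b u')
      with Cons.prems show ?thesis
        by (auto simp: conc_def lderiv_def star_def)
    qed
  qed simp
next
  fix w assume "w \<in> conc (lderiv [a] L) (star L)"
  then obtain u us where "w = u @ concat us" "a # u \<in> L" "set us \<subseteq> L"
    by (auto simp: conc_def lderiv_def star_def)
  then have "a # w = concat ((a # u) # us)" "set ((a # u) # us) \<subseteq> L" by auto
  then show "w \<in> lderiv [a] (star L)" unfolding lderiv_def star_def by (simp only: append.simps mem_Collect_eq) blast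
qed

lemma regularI: "lderiv_closed \<D> \<Longrightarrow> L \<in> \<D> \<Longrightarrow> regular L"
  by (auto simp: regular_def)

lemma regular_empty: "regular {}"
  by (rule regularI[of "{{}}"]) (auto simp: lderiv_closed_def lderiv_def)

lemma regular_Nil: "regular {[]}"
  by (rule regularI[of "{{}, {[]}}"]) (auto simp: lderiv_closed_def lderiv_def)

lemma regular_single: "regular {[a]}"
proof (rule regularI)
  have "lderiv [b] {[a]} = (if a = b then {[]} else {})" "lderiv [b] {[]} = {}" "lderiv [b] {} = {}" for b
    by (auto simp: lderiv_def)
  then show "lderiv_closed {{}, {[]}, {[a]}}" by (auto simp: lderiv_closed_def)
qed simp

lemma regular_Un:
  assumes "regular A" "regular B"
  shows "regular (A \<union> B)"
proof -
  from assms obtain \<A> \<B> where "lderiv_closed \<A>" "A \<in> \<A>" "lderiv_closed \<B>" "B \<in> \<B>"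
    by (auto simp: regular_def)
  then show ?thesis
    by (intro regularI[of "(\<lambda>(A, B). A \<union> B) ` (\<A> \<times> \<B>)"]) (auto simp: lderiv_closed_def lderiv_Un)
qed

lemma regular_conc:
  assumes "regular A" "regular B"
  shows "regular (conc A B)"
proof -
  from assms obtain \<A> \<B> where \<A>: "lderiv_closed \<A>" "A \<in> \<A>" and \<B>: "lderiv_closed \<B>" "B \<in> \<B>"
    by (auto simp: regular_def)
  \<comment> \<open>A quotient of \<open>conc A B\<close> consists of the words that continue the
    factor from \<open>A\<close>, described by a quotient \<open>C\<close> of \<open>A\<close>, and,
    for the factorizations in which that factor has already ended, a set of quotients of
    \<open>B\<close>. Subsets of a finite \<open>\<B>\<close> leave finitely many cases.\<close>
  define \<D> where "\<D> = (\<lambda>(C, \<C>). conc C B \<union> \<Union>\<C>) ` (\<A> \<times> Pow \<B>)"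
  have "finite \<D>" using \<A> \<B> by (simp add: \<D>_def lderiv_closed_def)
  moreover have "lderiv [a] D \<in> \<D>" if "D \<in> \<D>" for D a
  proof -
    from that obtain C \<C> where D: "D = conc C B \<union> \<Union>\<C>" "C \<in> \<A>" "\<C> \<subseteq> \<B>"
      by (auto simp: \<D>_def)
    define \<C>' where "\<C>' = lderiv [a] ` \<C> \<union> (if [] \<in> C then {lderiv [a] B} else {})"
    have "lderiv [a] D = conc (lderiv [a] C) B \<union> \<Union>\<C>'"
      by (auto simp: D lderiv_Un lderiv_conc lderiv_Union \<C>'_def)
    moreover have "lderiv [a] C \<in> \<A>" "\<C>' \<subseteq> \<B>"
      using D \<A> \<B> by (auto simp: \<C>'_def lderiv_closed_def)
    ultimately show ?thesis by (auto simp: \<D>_def)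
  qed
  moreover have "conc A B = conc A B \<union> \<Union>{}" by simp
  then have "conc A B \<in> \<D>" using \<A> unfolding \<D>_def by blast
  ultimately show ?thesis by (intro regularI[of \<D>]) (auto simp: lderiv_closed_def)
qed

lemma regular_star:
  assumes "regular L"
  shows "regular (star L)"
proof -
  from assms obtain \<L> where \<L>: "lderiv_closed \<L>" "L \<in> \<L>" by (auto simp: regular_def)
  \<comment> \<open>Once a letter has been read, a quotient of \<open>star L\<close> is a set of
    possible unfinished iterations, each a quotient of \<open>L\<close>, followed by
    \<open>star L\<close>. The language before the first letter is added separately.\<close>
  define \<D> where "\<D> = insert (star L) ((\<lambda>\<C>. conc (\<Union>\<C>) (star L)) ` Pow \<L>)"
  have "finite \<D>" using \<L> by (simp add: \<D>_def lderiv_closed_def)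
  moreover have "lderiv [a] D \<in> \<D>" if "D \<in> \<D>" for D a
  proof -
    from that consider "D = star L" | \<C> where "D = conc (\<Union>\<C>) (star L)" "\<C> \<subseteq> \<L>"
      by (auto simp: \<D>_def)
    then show ?thesis
    proof cases
      case 1
      have "lderiv [a] D = conc (\<Union>{lderiv [a] L}) (star L)" by (simp add: 1 lderiv_star)
      moreover have "{lderiv [a] L} \<subseteq> \<L>" using \<L> by (auto simp: lderiv_closed_def)
      ultimately show ?thesis unfolding \<D>_def by blast
    next
      case 2
      define \<C>' where "\<C>' = lderiv [a] ` \<C> \<union> (if [] \<in> \<Union>\<C> then {lderiv [a] L} else {})"
      have "lderiv [a] D = conc (\<Union>\<C>') (star L)"
        by (simp add: 2 lderiv_conc lderiv_Union lderiv_star \<C>'_def conc_Un)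
      moreover have "\<C>' \<subseteq> \<L>" using 2 \<L> by (auto simp: \<C>'_def lderiv_closed_def)
      ultimately show ?thesis unfolding \<D>_def by blast
    qed
  qed
  ultimately show ?thesis by (intro regularI[of \<D>]) (auto simp: lderiv_closed_def \<D>_def)
qed

lemma mdef_regular:
  fixes L :: "'a::finite list set"
  assumes "regular L"
  shows "mdef (\<lambda>W \<sigma>. \<sigma> u \<le> \<sigma> v \<and> seg W (\<sigma> u) (\<sigma> v) \<in> L)"
  using assms mdef_lderiv_closed unfolding regular_def by blast

section \<open>Regex formulas\<close>

text \<open>The count excludes \<open>x\<close> itself, so symbol-elements and \<open>$\<close>
  alike correspond to the span endpoint \<open>cnt W x + 1\<close>.\<close>

definition cnt :: "'a wstruct \<Rightarrow> nat \<Rightarrow> nat" where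
  "cnt W x = length (seg W 1 x)"

lemma seg_full: "seg W 1 (ws_dollar W) = ws_word W"
  by (simp add: seg_def ws_dollar_def)

lemma cnt_add: "1 \<le> x \<Longrightarrow> x \<le> y \<Longrightarrow> cnt W y = cnt W x + length (seg W x y)"
  using seg_append[of 1 x y W] by (simp add: cnt_def)

lemma cnt_1 [simp]: "cnt W (Suc 0) = 0"
  by (simp add: cnt_def)

lemma factor_cnt:
  assumes "x \<in> ws_dom W" "y \<in> ws_dom W"
  shows "factor (ws_word W) (cnt W x + 1, cnt W y + 1) = seg W x y"
proof (cases "x \<le> y")
  case True
  have "ws_word W = seg W 1 x @ seg W x y @ seg W y (ws_dollar W)"
    using assms True seg_append[of 1 x "ws_dollar W" W] seg_append[of x y "ws_dollar W" W] seg_full[of W]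
    by (auto simp: ws_dom_def ws_dollar_def)
  then show ?thesis
    using cnt_add[of x y W] True assms by (simp add: cnt_def ws_dom_def)
next
  case False
  then have "cnt W y \<le> cnt W x" using cnt_add[of y x W] assms by (simp add: ws_dom_def)
  then show ?thesis using False by (simp add: seg_def)
qed

text \<open>Provides positions for spans that are given only as numbers, namely those that a
  projection discards.\<close>

lemma ex_cnt:
  assumes "k \<le> length (ws_word W)"
  shows "\<exists>x\<in>ws_dom W. cnt W x = k"
proof -
  have "seg W 1 (Suc (length W)) = take k (ws_word W) @ drop k (ws_word W)"
    using seg_full[of W] by (simp add: ws_dollar_def)
  from seg_eq_append[OF _ _ _ this] obtain z where "1 \<le> z" "z \<le> Suc (length W)" "seg W 1 z = take k (ws_word W)"
    by auto
  then show ?thesis using assms by (intro bexI[of _ z]) (auto simp: cnt_def ws_dom_def)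
qed

text \<open>Counts agree when no symbol lies between the two positions, that is, when the interval
  between them has the same word as an empty interval.\<close>

lemma mdef_cnt_eq: "mdef (\<lambda>(W :: 'a::finite wstruct) \<sigma>. cnt W (\<sigma> u) = cnt W (\<sigma> v))"
proof (rule mdef_cong)
  show "mdef (\<lambda>(W :: 'a wstruct) \<sigma>. segeq W (\<sigma> u) (\<sigma> v) (\<sigma> u) (\<sigma> u) \<or> segeq W (\<sigma> v) (\<sigma> u) (\<sigma> u) (\<sigma> u))"
    by (intro mdef_or mdef_segeq)
  fix W :: "'a wstruct" and \<sigma> :: "nat \<Rightarrow> nat" assume "in_dom W \<sigma>"
  then have "1 \<le> \<sigma> u" "1 \<le> \<sigma> v" using in_dom_bounds by blast+
  then show "cnt W (\<sigma> u) = cnt W (\<sigma> v) \<longleftrightarrow>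
      segeq W (\<sigma> u) (\<sigma> v) (\<sigma> u) (\<sigma> u) \<or> segeq W (\<sigma> v) (\<sigma> u) (\<sigma> u) (\<sigma> u)"
    using cnt_add[of "\<sigma> u" "\<sigma> v" W] cnt_add[of "\<sigma> v" "\<sigma> u" W]
    by (cases "\<sigma> u \<le> \<sigma> v") (auto simp: segeq_def)
qed

text \<open>\<open>segeq\<close> insists on ordered ends, but the two positions that represent an
  empty span may come in reverse order. A reversed interval has the empty word, and the last three
  disjuncts treat it as an empty interval.\<close>

lemma mdef_seg_eq:
  "mdef (\<lambda>(W :: 'a::finite wstruct) \<sigma>. seg W (\<sigma> a) (\<sigma> b) = seg W (\<sigma> c) (\<sigma> d))"
proof (rule mdef_cong)
  show "mdef (\<lambda>(W :: 'a wstruct) \<sigma>. segeq W (\<sigma> a) (\<sigma> b) (\<sigma> c) (\<sigma> d) \<or>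
      \<sigma> b \<le> \<sigma> a \<and> segeq W (\<sigma> a) (\<sigma> a) (\<sigma> c) (\<sigma> d) \<or>
      \<sigma> d \<le> \<sigma> c \<and> segeq W (\<sigma> a) (\<sigma> b) (\<sigma> c) (\<sigma> c) \<or>
      \<sigma> b \<le> \<sigma> a \<and> \<sigma> d \<le> \<sigma> c)"
    by (intro mdef_or mdef_and mdef_segeq mdef_le)
  fix W :: "'a wstruct" and \<sigma> :: "nat \<Rightarrow> nat"
  have "seg W x y = []" if "y \<le> x" for x y using that by (simp add: seg_def)
  then show "seg W (\<sigma> a) (\<sigma> b) = seg W (\<sigma> c) (\<sigma> d) \<longleftrightarrow>
      segeq W (\<sigma> a) (\<sigma> b) (\<sigma> c) (\<sigma> d) \<or>
      \<sigma> b \<le> \<sigma> a \<and> segeq W (\<sigma> a) (\<sigma> a) (\<sigma> c) (\<sigma> d) \<or>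
      \<sigma> d \<le> \<sigma> c \<and> segeq W (\<sigma> a) (\<sigma> b) (\<sigma> c) (\<sigma> c) \<or>
      \<sigma> b \<le> \<sigma> a \<and> \<sigma> d \<le> \<sigma> c"
    by (cases "\<sigma> a \<le> \<sigma> b"; cases "\<sigma> c \<le> \<sigma> d") (auto simp: segeq_def)
qed

lemma clr_append [simp]: "clr (r @ s) = clr r @ clr s"
  by (induction r rule: clr.induct) auto

lemma clr_concat: "clr (concat rs) = concat (map clr rs)"
  by (induction rs) auto

lemma regular_clr_ref_words: "regular (clr ` ref_words \<alpha>)"
proof (induction \<alpha>)
  case (RConc \<alpha> \<beta>)
  have "clr ` ref_words (RConc \<alpha> \<beta>) = conc (clr ` ref_words \<alpha>) (clr ` ref_words \<beta>)"
  proof (intro set_eqI iffI)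
    fix w assume "w \<in> clr ` ref_words (RConc \<alpha> \<beta>)"
    then show "w \<in> conc (clr ` ref_words \<alpha>) (clr ` ref_words \<beta>)" unfolding conc_def by auto blast
  next
    fix w assume "w \<in> conc (clr ` ref_words \<alpha>) (clr ` ref_words \<beta>)"
    then obtain r s where "w = clr (r @ s)" "r \<in> ref_words \<alpha>" "s \<in> ref_words \<beta>"
      by (auto simp: conc_def)
    then show "w \<in> clr ` ref_words (RConc \<alpha> \<beta>)" by (intro image_eqI[of _ _ "r @ s"]) auto
  qed
  then show ?case using RConc by (simp only: regular_conc)
next
  case (RStar \<alpha>)
  have "clr ` ref_words (RStar \<alpha>) = star (clr ` ref_words \<alpha>)"
  proof (intro set_eqI iffI)
    fix w assume "w \<in> clr ` ref_words (RStar \<alpha>)"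
    then obtain rs where "w = concat (map clr rs)" "set rs \<subseteq> ref_words \<alpha>"
      by (auto simp: clr_concat)
    then show "w \<in> star (clr ` ref_words \<alpha>)"
      unfolding star_def by (intro CollectI exI[of _ "map clr rs"]) auto
  next
    fix w assume "w \<in> star (clr ` ref_words \<alpha>)"
    then obtain us where us: "w = concat us" "set us \<subseteq> clr ` ref_words \<alpha>"
      by (auto simp: star_def)
    from us(2) have "us \<in> map clr ` lists (ref_words \<alpha>)"
      by (simp add: lists_image[symmetric] in_lists_conv_set subset_iff)
    then obtain rs where "us = map clr rs" "set rs \<subseteq> ref_words \<alpha>" by auto
    then show "w \<in> clr ` ref_words (RStar \<alpha>)"
      using us(1) by (auto simp: clr_concat intro!: image_eqI[of _ _ "concat rs"])
  qed
  then show ?case using RStar by (simp only: regular_star)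
next
  case (RBind x \<alpha>)
  have "ref_words (RBind x \<alpha>) = (\<lambda>r. Open x # r @ [Close x]) ` ref_words \<alpha>" by auto
  then have "clr ` ref_words (RBind x \<alpha>) = clr ` ref_words \<alpha>" by (simp only: image_image) simp
  then show ?case using RBind by simp
qed (simp_all add: regular_empty regular_Nil regular_single regular_Un image_Un)

section \<open>Positions of the markers in ref-words\<close>

definition opos :: "('a, 'v) ref_symbol list \<Rightarrow> 'v \<Rightarrow> nat" where
  "opos r v = length (clr (takeWhile (\<lambda>s. s \<noteq> Open v) r))"

definition cpos :: "('a, 'v) ref_symbol list \<Rightarrow> 'v \<Rightarrow> nat" where
  "cpos r v = length (clr (takeWhile (\<lambda>s. s \<noteq> Close v) r))"

lemma takeWhile_neq_append:
  "x \<notin> set r \<Longrightarrow> takeWhile (\<lambda>s. s \<noteq> x) (r @ t) = r @ takeWhile (\<lambda>s. s \<noteq> x) t"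
  by (rule takeWhile_append2) auto

lemma opos_append1: "Open v \<in> set r \<Longrightarrow> opos (r @ s) v = opos r v"
  by (simp add: opos_def)

lemma opos_append2: "Open v \<notin> set r \<Longrightarrow> opos (r @ s) v = length (clr r) + opos s v"
  by (simp add: opos_def takeWhile_neq_append)

lemma cpos_append1: "Close v \<in> set r \<Longrightarrow> cpos (r @ s) v = cpos r v"
  by (simp add: cpos_def)

lemma cpos_append2: "Close v \<notin> set r \<Longrightarrow> cpos (r @ s) v = length (clr r) + cpos s v"
  by (simp add: cpos_def takeWhile_neq_append)

lemma count_list_Open_Close:
  "r \<in> ref_words \<alpha> \<Longrightarrow> count_list r (Open x) = count_list r (Close x)"
proof (induction \<alpha> arbitrary: r)
  case (RStar \<alpha>)
  then obtain rs where "r = concat rs" "set rs \<subseteq> ref_words \<alpha>" by auto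
  moreover from this(2) have "count_list (concat rs) (Open x) = count_list (concat rs) (Close x)"
    by (induction rs) (auto simp: RStar.IH)
  ultimately show ?case by simp
qed auto

text \<open>Only \<open>RBind\<close> produces markers, and it produces them as a pair around its
  body; all other constructs merely add context to that pair.\<close>

lemma Open_in_ref_words:
  "r \<in> ref_words \<alpha> \<Longrightarrow> Open v \<in> set r \<Longrightarrow> \<exists>r1 r2 r3. r = r1 @ [Open v] @ r2 @ [Close v] @ r3"
proof (induction \<alpha> arbitrary: r)
  case (RConc \<alpha> \<beta>)
  then obtain s t where st: "r = s @ t" "s \<in> ref_words \<alpha>" "t \<in> ref_words \<beta>" by auto
  show ?case
  proof (cases "Open v \<in> set s")
    case True
    from RConc.IH(1)[OF st(2) this] obtain r1 r2 r3 where "s = r1 @ [Open v] @ r2 @ [Close v] @ r3" by blast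
    then show ?thesis using st(1) by (intro exI[of _ r1] exI[of _ r2] exI[of _ "r3 @ t"]) simp
  next
    case False
    then have "Open v \<in> set t" using RConc.prems(2) st(1) by simp
    from RConc.IH(2)[OF st(3) this] obtain r1 r2 r3 where "t = r1 @ [Open v] @ r2 @ [Close v] @ r3" by blast
    then show ?thesis using st(1) by (intro exI[of _ "s @ r1"] exI[of _ r2] exI[of _ r3]) simp
  qed
next
  case (RStar \<alpha>)
  then obtain rs where rs: "r = concat rs" "set rs \<subseteq> ref_words \<alpha>" by auto
  with RStar.prems(2) obtain s where s: "s \<in> set rs" "Open v \<in> set s" by auto
  then obtain as bs where "rs = as @ s # bs" by (meson split_list)
  moreover from s rs RStar.IH obtain r1 r2 r3 where "s = r1 @ [Open v] @ r2 @ [Close v] @ r3" by blast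
  ultimately show ?case using rs(1)
    by (intro exI[of _ "concat as @ r1"] exI[of _ r2] exI[of _ "r3 @ concat bs"]) simp
next
  case (RBind x \<alpha>)
  then obtain s where s: "r = Open x # s @ [Close x]" "s \<in> ref_words \<alpha>" by auto
  show ?case
  proof (cases "v = x")
    case True
    then show ?thesis using s by (intro exI[of _ "[]"] exI[of _ s]) simp
  next
    case False
    then have "Open v \<in> set s" using RBind.prems(2) s by simp
    from RBind.IH[OF s(2) this] obtain r1 r2 r3 where "s = r1 @ [Open v] @ r2 @ [Close v] @ r3" by blast
    then show ?thesis using s
      by (intro exI[of _ "Open x # r1"] exI[of _ r2] exI[of _ "r3 @ [Close x]"]) simp
  qed
qed auto

lemma opos_cpos_decomp:
  assumes r: "r = r1 @ [Open v] @ r2 @ [Close v] @ r3"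
    and "count_list r (Open v) = 1" "count_list r (Close v) = 1"
  shows "opos r v = length (clr r1)" "cpos r v = length (clr (r1 @ r2))"
proof -
  have "Open v \<notin> set r1" "Close v \<notin> set r1" "Close v \<notin> set r2"
    using assms(2,3) by (auto simp: r count_list_0_iff[symmetric])
  then have "opos (r1 @ [Open v] @ r2 @ [Close v] @ r3) v = length (clr r1)"
    "cpos ((r1 @ [Open v] @ r2) @ [Close v] @ r3) v = length (clr (r1 @ [Open v] @ r2))"
    by (subst opos_append2 cpos_append2; simp add: opos_def cpos_def)+
  then show "opos r v = length (clr r1)" "cpos r v = length (clr (r1 @ r2))"
    by (simp_all add: r)
qed

text \<open>Markers that occur once admit a single decomposition, so the quantifier over
  decompositions gives way to the functions \<open>opos\<close> and \<open>cpos\<close>.\<close>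

lemma is_ref_tuple_iff:
  assumes r: "r \<in> ref_words \<alpha>" and cnt: "\<And>v. v \<in> V \<Longrightarrow> count_list r (Open v) = 1"
  shows "is_ref_tuple V r \<mu> \<longleftrightarrow> dom \<mu> = V \<and> (\<forall>v\<in>V. \<mu> v = Some (opos r v + 1, cpos r v + 1))"
proof -
  have "(\<exists>r1 r2 r3. r = r1 @ [Open v] @ r2 @ [Close v] @ r3 \<and>
        \<mu> v = Some (length (clr r1) + 1, length (clr (r1 @ r2)) + 1)) \<longleftrightarrow>
      \<mu> v = Some (opos r v + 1, cpos r v + 1)" if "v \<in> V" for v
  proof -
    have c: "count_list r (Open v) = 1" "count_list r (Close v) = 1"
      using cnt[OF that] count_list_Open_Close[OF r, of v] by auto
    then have "Open v \<in> set r" by (metis count_list_0_iff zero_neq_one)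
    from Open_in_ref_words[OF r this] obtain r1 r2 r3 where "r = r1 @ [Open v] @ r2 @ [Close v] @ r3" by blast
    with opos_cpos_decomp[OF _ c] show ?thesis by metis
  qed
  then show ?thesis unfolding is_ref_tuple_def by blast
qed

text \<open>A local semantics for the recursion on the syntax: \<open>r\<close> covers only the
  interval, while \<open>S\<close> and \<open>C\<close> count from the beginning of the whole word,
  so the offset \<open>cnt W x\<close> is added. \<open>Y\<close> contains the variables that this
  subformula has to bind.\<close>

definition ref_match :: "('a, 'v) regex_formula \<Rightarrow> 'v set \<Rightarrow> ('v \<Rightarrow> nat) \<Rightarrow> ('v \<Rightarrow> nat) \<Rightarrow>
    'a wstruct \<Rightarrow> nat \<Rightarrow> nat \<Rightarrow> bool" where
  "ref_match \<alpha> Y S C W x y \<longleftrightarrow> x \<le> y \<and> (\<exists>r\<in>ref_words \<alpha>. clr r = seg W x y \<and>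
     (\<forall>v\<in>Y. S v = cnt W x + opos r v \<and> C v = cnt W x + cpos r v))"

lemma ref_match_cong:
  "(\<And>v. v \<in> Y \<Longrightarrow> S v = S' v \<and> C v = C' v) \<Longrightarrow> ref_match \<alpha> Y S C W x y = ref_match \<alpha> Y S' C' W x y"
  unfolding ref_match_def by simp

text \<open>Markers of \<open>Y1\<close> lie in the left factor and keep their offset. Those of
  \<open>Y2\<close> are shifted by the length of the left factor, which is the difference between
  the counts at \<open>z\<close> and at \<open>x\<close>.\<close>

lemma ref_match_RConc:
  assumes x: "1 \<le> x" "x \<le> Suc (length W)" and y: "1 \<le> y" "y \<le> Suc (length W)"
    and Y: "Y = Y1 \<union> Y2"
    and Y1: "\<And>v r. v \<in> Y1 \<Longrightarrow> r \<in> ref_words \<alpha> \<Longrightarrow> count_list r (Open v) = 1"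
    and Y2: "\<And>v r. v \<in> Y2 \<Longrightarrow> r \<in> ref_words \<alpha> \<Longrightarrow> count_list r (Open v) = 0"
  shows "ref_match (RConc \<alpha> \<beta>) Y S C W x y \<longleftrightarrow>
    (\<exists>z\<in>ws_dom W. ref_match \<alpha> Y1 S C W x z \<and> ref_match \<beta> Y2 S C W z y)"
proof -
  have p1: "opos (r @ s) v = opos r v" "cpos (r @ s) v = cpos r v"
    if "v \<in> Y1" "r \<in> ref_words \<alpha>" for r s v
  proof -
    have "count_list r (Open v) \<noteq> 0" "count_list r (Close v) \<noteq> 0"
      using Y1[OF that] count_list_Open_Close[OF that(2), of v] by auto
    then show "opos (r @ s) v = opos r v" "cpos (r @ s) v = cpos r v"
      by (simp_all add: count_list_0_iff opos_append1 cpos_append1)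
  qed
  have p2: "opos (r @ s) v = length (clr r) + opos s v" "cpos (r @ s) v = length (clr r) + cpos s v"
    if "v \<in> Y2" "r \<in> ref_words \<alpha>" for r s v
  proof -
    have "count_list r (Open v) = 0" "count_list r (Close v) = 0"
      using Y2[OF that] count_list_Open_Close[OF that(2), of v] by auto
    then show "opos (r @ s) v = length (clr r) + opos s v" "cpos (r @ s) v = length (clr r) + cpos s v"
      by (simp_all add: count_list_0_iff opos_append2 cpos_append2)
  qed
  show ?thesis
  proof
    assume "ref_match (RConc \<alpha> \<beta>) Y S C W x y"
    then obtain r s where xy: "x \<le> y" and rs: "r \<in> ref_words \<alpha>" "s \<in> ref_words \<beta>" "clr r @ clr s = seg W x y"
      and v: "\<And>v. v \<in> Y \<Longrightarrow> S v = cnt W x + opos (r @ s) v \<and> C v = cnt W x + cpos (r @ s) v"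
      unfolding ref_match_def by auto
    from seg_eq_append[OF x(1) xy y(2) rs(3)[symmetric]] obtain z
      where z: "x \<le> z" "z \<le> y" "seg W x z = clr r" "seg W z y = clr s" by blast
    have cz: "cnt W z = cnt W x + length (clr r)" using cnt_add[OF x(1) z(1), of W] z(3) by simp
    have "\<forall>v\<in>Y1. S v = cnt W x + opos r v \<and> C v = cnt W x + cpos r v"
      using v p1[OF _ rs(1)] Y by simp
    then have "ref_match \<alpha> Y1 S C W x z"
      unfolding ref_match_def using z rs by (intro conjI bexI[of _ r]) simp_all
    moreover have "\<forall>v\<in>Y2. S v = cnt W z + opos s v \<and> C v = cnt W z + cpos s v"
      using v p2[OF _ rs(1)] Y cz by simp
    then have "ref_match \<beta> Y2 S C W z y"
      unfolding ref_match_def using z rs by (intro conjI bexI[of _ s]) simp_all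
    moreover have "z \<in> ws_dom W" using z x y by (simp add: ws_dom_def)
    ultimately show "\<exists>z\<in>ws_dom W. ref_match \<alpha> Y1 S C W x z \<and> ref_match \<beta> Y2 S C W z y" by blast
  next
    assume "\<exists>z\<in>ws_dom W. ref_match \<alpha> Y1 S C W x z \<and> ref_match \<beta> Y2 S C W z y"
    then obtain z r s where z: "x \<le> z" "z \<le> y" "seg W x z = clr r" "seg W z y = clr s"
      and rs: "r \<in> ref_words \<alpha>" "s \<in> ref_words \<beta>"
      and v: "\<forall>v\<in>Y1. S v = cnt W x + opos r v \<and> C v = cnt W x + cpos r v"
        "\<forall>v\<in>Y2. S v = cnt W z + opos s v \<and> C v = cnt W z + cpos s v"
      unfolding ref_match_def by metis
    have "cnt W z = cnt W x + length (clr r)" using cnt_add[OF x(1) z(1), of W] z(3) by simp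
    then have "\<forall>v\<in>Y. S v = cnt W x + opos (r @ s) v \<and> C v = cnt W x + cpos (r @ s) v"
      using v p1[OF _ rs(1)] p2[OF _ rs(1)] Y by auto
    moreover have "clr (r @ s) = seg W x y" using seg_append[OF x(1) z(1,2), of W] z by simp
    moreover have "r @ s \<in> ref_words (RConc \<alpha> \<beta>)" using rs by auto
    ultimately show "ref_match (RConc \<alpha> \<beta>) Y S C W x y"
      unfolding ref_match_def using z by (meson le_trans)
  qed
qed

lemma ref_match_RBind:
  fixes \<alpha> :: "('a, 'b) regex_formula"
  assumes x: "1 \<le> x"
    and Y: "\<And>v r. v \<in> Y \<Longrightarrow> r \<in> ref_words (RBind u \<alpha>) \<Longrightarrow> count_list r (Open v) = 1"
  shows "ref_match (RBind u \<alpha>) Y S C W x y \<longleftrightarrow>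
    ref_match \<alpha> (Y - {u}) S C W x y \<and> (u \<in> Y \<longrightarrow> S u = cnt W x \<and> C u = cnt W y)"
proof -
  have p: "opos (Open u # r @ [Close u]) v = opos r v" "cpos (Open u # r @ [Close u]) v = cpos r v"
    if "v \<in> Y - {u}" "r \<in> ref_words \<alpha>" for r v
  proof -
    have "Open u # r @ [Close u] \<in> ref_words (RBind u \<alpha>)" using that by simp
    from Y[OF _ this, of v] have "count_list (Open u # r @ [Close u]) (Open v) = 1" using that by simp
    then have "count_list r (Open v) = 1" using that by (auto split: if_splits)
    moreover from this have "count_list r (Close v) = 1"
      using count_list_Open_Close[OF that(2), of v] by simp
    ultimately have "Open v \<in> set r" "Close v \<in> set r"
      by (metis count_list_0_iff zero_neq_one)+
    then show "opos (Open u # r @ [Close u]) v = opos r v" "cpos (Open u # r @ [Close u]) v = cpos r v"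
      using that by (auto simp: opos_def cpos_def)
  qed
  have q: "opos (Open u # r @ [Close u]) u = 0" "cpos (Open u # r @ [Close u]) u = length (clr r)"
    if "u \<in> Y" "r \<in> ref_words \<alpha>" for r
  proof -
    have "Open u # r @ [Close u] \<in> ref_words (RBind u \<alpha>)" using that by simp
    from Y[OF that(1) this] have "count_list (Open u # r @ [Close u]) (Open u) = 1" .
    then have "count_list r (Close u) = 0"
      using count_list_Open_Close[OF that(2), of u] by simp
    then have "Close u \<notin> set r" by (simp add: count_list_0_iff)
    then show "opos (Open u # r @ [Close u]) u = 0" "cpos (Open u # r @ [Close u]) u = length (clr r)"
      by (simp_all add: opos_def cpos_def takeWhile_neq_append)
  qed
  define R where "R r \<longleftrightarrow> (\<forall>v\<in>Y. S v = cnt W x + opos (Open u # r @ [Close u]) v \<and>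
    C v = cnt W x + cpos (Open u # r @ [Close u]) v)" for r :: "('a, 'b) ref_symbol list"
  define R' where "R' r \<longleftrightarrow> (\<forall>v\<in>Y - {u}. S v = cnt W x + opos r v \<and> C v = cnt W x + cpos r v)"
    for r :: "('a, 'b) ref_symbol list"
  have R: "R r \<longleftrightarrow> R' r \<and> (u \<in> Y \<longrightarrow> S u = cnt W x \<and> C u = cnt W y)"
    if "r \<in> ref_words \<alpha>" "x \<le> y" "clr r = seg W x y" for r
  proof -
    have "cnt W y = cnt W x + length (clr r)"
      using cnt_add[OF x that(2), of W] that(3) by simp
    then show ?thesis
      unfolding R_def R'_def using p[OF _ that(1)] q[OF _ that(1)]
      by (metis Diff_iff add.right_neutral singletonD insertCI)
  qed
  have "ref_words (RBind u \<alpha>) = (\<lambda>r. Open u # r @ [Close u]) ` ref_words \<alpha>" by auto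
  then have "ref_match (RBind u \<alpha>) Y S C W x y \<longleftrightarrow> x \<le> y \<and> (\<exists>r\<in>ref_words \<alpha>. clr r = seg W x y \<and> R r)"
    unfolding ref_match_def R_def by (simp only: bex_simps) simp
  moreover have "ref_match \<alpha> (Y - {u}) S C W x y \<longleftrightarrow> x \<le> y \<and> (\<exists>r\<in>ref_words \<alpha>. clr r = seg W x y \<and> R' r)"
    unfolding ref_match_def R'_def ..
  ultimately show ?thesis using R by blast
qed

lemma mdef_ref_match:
  fixes \<alpha> :: "('a::finite, 'v) regex_formula"
  assumes "finite Y" "\<And>v r. v \<in> Y \<Longrightarrow> r \<in> ref_words \<alpha> \<Longrightarrow> count_list r (Open v) = 1"
  shows "mdef (\<lambda>W \<sigma>. ref_match \<alpha> Y (\<lambda>v. cnt W (\<sigma> (p v))) (\<lambda>v. cnt W (\<sigma> (q v))) W (\<sigma> a) (\<sigma> b))"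
proof -
  \<comment> \<open>Without variables only the word matters, and the words generated by a regex
    formula form a regular language.\<close>
  have empty: "mdef (\<lambda>W \<sigma>. ref_match \<beta> {} (\<lambda>v. cnt W (\<sigma> (p v))) (\<lambda>v. cnt W (\<sigma> (q v))) W (\<sigma> a) (\<sigma> b))"
    for \<beta> :: "('a, 'v) regex_formula" and a b
    by (rule mdef_cong[OF mdef_regular[OF regular_clr_ref_words[of \<beta>], of a b]])
      (force simp: ref_match_def)
  show ?thesis
    using assms
  proof (induction \<alpha> arbitrary: Y a b)
    case RNone
    show ?case by (simp add: ref_match_def mdef_const)
  next
    case REps
    from REps.prems(2)[of _ "[]"] have "Y = {}" by auto
    then show ?case using empty by simp
  next
    case (RSym s)
    from RSym.prems(2)[of _ "[Letter s]"] have "Y = {}" by auto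
    then show ?case using empty by simp
  next
    case (RStar \<alpha>)
    \<comment> \<open>The empty iteration has no markers, so no variable can occur exactly once in
      every ref-word.\<close>
    have "[] \<in> ref_words (RStar \<alpha>)" by (auto intro!: exI[of _ "[]"])
    from RStar.prems(2)[OF _ this] have "Y = {}" by auto
    then show ?case using empty by simp
  next
    case (RAlt \<alpha> \<beta>)
    have "mdef (\<lambda>W \<sigma>.
        ref_match \<alpha> Y (\<lambda>v. cnt W (\<sigma> (p v))) (\<lambda>v. cnt W (\<sigma> (q v))) W (\<sigma> a) (\<sigma> b) \<or>
        ref_match \<beta> Y (\<lambda>v. cnt W (\<sigma> (p v))) (\<lambda>v. cnt W (\<sigma> (q v))) W (\<sigma> a) (\<sigma> b))"
      using RAlt.prems by (intro mdef_or RAlt.IH) auto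
    then show ?case by (rule mdef_cong) (auto simp: ref_match_def)
  next
    case (RConc \<alpha> \<beta>)
    show ?case
    proof (cases "ref_words \<alpha> = {} \<or> ref_words \<beta> = {}")
      case True
      then show ?thesis by (intro mdef_cong[OF mdef_const[of False]]) (auto simp: ref_match_def)
    next
      case False
      \<comment> \<open>The counts in a word of \<open>\<alpha>\<close> and in a word of
        \<open>\<beta>\<close> always add up to 1. Varying one word while the other is fixed shows
        that each count is constant, so \<open>r0\<close> alone decides which factor binds a
        variable.\<close>
      then obtain r0 s0 where r0: "r0 \<in> ref_words \<alpha>" and s0: "s0 \<in> ref_words \<beta>" by blast
      define Y1 where "Y1 = {v \<in> Y. count_list r0 (Open v) = 1}"
      define Y2 where "Y2 = {v \<in> Y. count_list r0 (Open v) = 0}"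
      have sum: "count_list r (Open v) + count_list s (Open v) = 1"
        if "v \<in> Y" "r \<in> ref_words \<alpha>" "s \<in> ref_words \<beta>" for v r s
      proof -
        have "r @ s \<in> ref_words (RConc \<alpha> \<beta>)" using that by auto
        from RConc.prems(2)[OF that(1) this] show ?thesis by simp
      qed
      have Y: "Y = Y1 \<union> Y2"
        using sum[OF _ r0 s0] unfolding Y1_def Y2_def by (fastforce simp: add_is_1)
      have c1: "count_list r (Open v) = 1" if "v \<in> Y1" "r \<in> ref_words \<alpha>" for v r
        using sum[OF _ that(2) s0, of v] sum[OF _ r0 s0, of v] that(1) by (auto simp: Y1_def)
      have c2: "count_list r (Open v) = 0" if "v \<in> Y2" "r \<in> ref_words \<alpha>" for v r
        using sum[OF _ that(2) s0, of v] sum[OF _ r0 s0, of v] that(1) by (auto simp: Y2_def)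
      have c3: "count_list s (Open v) = 1" if "v \<in> Y2" "s \<in> ref_words \<beta>" for v s
        using sum[OF _ r0 that(2), of v] that(1) by (auto simp: Y2_def)
      have fin: "finite Y1" "finite Y2" using RConc.prems(1) by (auto simp: Y1_def Y2_def)
      have "finite ({a, b} \<union> p ` Y \<union> q ` Y)" using RConc.prems(1) by simp
      from ex_new_if_finite[OF infinite_UNIV_nat this] obtain z where z: "z \<notin> {a, b} \<union> p ` Y \<union> q ` Y"
        by (elim exE)
      have "mdef (\<lambda>W \<sigma>.
          ref_match \<alpha> Y1 (\<lambda>v. cnt W (\<sigma> (p v))) (\<lambda>v. cnt W (\<sigma> (q v))) W (\<sigma> a) (\<sigma> z) \<and>
          ref_match \<beta> Y2 (\<lambda>v. cnt W (\<sigma> (p v))) (\<lambda>v. cnt W (\<sigma> (q v))) W (\<sigma> z) (\<sigma> b))"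
        using RConc.IH(1)[OF fin(1) c1] RConc.IH(2)[OF fin(2) c3] by (intro mdef_and)
      from mdef_ex[OF this, of z] show ?thesis
      proof (rule mdef_cong)
        fix W :: "'a wstruct" and \<sigma> :: "nat \<Rightarrow> nat" assume \<sigma>: "in_dom W \<sigma>"
        let ?S = "\<lambda>v. cnt W (\<sigma> (p v))" and ?C = "\<lambda>v. cnt W (\<sigma> (q v))"
        have "ref_match (RConc \<alpha> \<beta>) Y ?S ?C W (\<sigma> a) (\<sigma> b) \<longleftrightarrow>
            (\<exists>d\<in>ws_dom W. ref_match \<alpha> Y1 ?S ?C W (\<sigma> a) d \<and> ref_match \<beta> Y2 ?S ?C W d (\<sigma> b))"
          using in_dom_bounds[OF \<sigma>] by (intro ref_match_RConc Y c1 c2) auto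
        also have "\<dots> \<longleftrightarrow> (\<exists>d\<in>ws_dom W.
            ref_match \<alpha> Y1 (\<lambda>v. cnt W ((\<sigma>(z := d)) (p v))) (\<lambda>v. cnt W ((\<sigma>(z := d)) (q v))) W
              ((\<sigma>(z := d)) a) ((\<sigma>(z := d)) z) \<and>
            ref_match \<beta> Y2 (\<lambda>v. cnt W ((\<sigma>(z := d)) (p v))) (\<lambda>v. cnt W ((\<sigma>(z := d)) (q v))) W
              ((\<sigma>(z := d)) z) ((\<sigma>(z := d)) b))"
        proof -
          have 1: "ref_match \<alpha> Y1 (\<lambda>v. cnt W ((\<sigma>(z := d)) (p v))) (\<lambda>v. cnt W ((\<sigma>(z := d)) (q v))) W x y =
              ref_match \<alpha> Y1 ?S ?C W x y" for d x y
            using z by (intro ref_match_cong) (auto simp: Y1_def)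
          have 2: "ref_match \<beta> Y2 (\<lambda>v. cnt W ((\<sigma>(z := d)) (p v))) (\<lambda>v. cnt W ((\<sigma>(z := d)) (q v))) W x y =
              ref_match \<beta> Y2 ?S ?C W x y" for d x y
            using z by (intro ref_match_cong) (auto simp: Y2_def)
          have "(\<sigma>(z := d)) a = \<sigma> a" "(\<sigma>(z := d)) b = \<sigma> b" for d using z by auto
          then show ?thesis by (simp only: 1 2 fun_upd_same)
        qed
        finally show "ref_match (RConc \<alpha> \<beta>) Y ?S ?C W (\<sigma> a) (\<sigma> b) \<longleftrightarrow> \<dots>" .
      qed
    qed
  next
    case (RBind u \<alpha>)
    have "count_list r (Open v) = 1" if "v \<in> Y - {u}" "r \<in> ref_words \<alpha>" for v r
      using RBind.prems(2)[of v "Open u # r @ [Close u]"] that by (auto split: if_splits)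
    then have "mdef (\<lambda>W \<sigma>.
        ref_match \<alpha> (Y - {u}) (\<lambda>v. cnt W (\<sigma> (p v))) (\<lambda>v. cnt W (\<sigma> (q v))) W (\<sigma> a) (\<sigma> b))"
      using RBind.prems(1) by (intro RBind.IH) auto
    moreover have "mdef (\<lambda>(W :: 'a wstruct) \<sigma>. u \<notin> Y \<or> cnt W (\<sigma> (p u)) = cnt W (\<sigma> a) \<and> cnt W (\<sigma> (q u)) = cnt W (\<sigma> b))"
      by (intro mdef_or mdef_and mdef_const mdef_cnt_eq)
    ultimately have "mdef (\<lambda>W \<sigma>.
        ref_match \<alpha> (Y - {u}) (\<lambda>v. cnt W (\<sigma> (p v))) (\<lambda>v. cnt W (\<sigma> (q v))) W (\<sigma> a) (\<sigma> b) \<and>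
        (u \<notin> Y \<or> cnt W (\<sigma> (p u)) = cnt W (\<sigma> a) \<and> cnt W (\<sigma> (q u)) = cnt W (\<sigma> b)))"
      by (rule mdef_and)
    then show ?case
    proof (rule mdef_cong)
      fix W :: "'a wstruct" and \<sigma> :: "nat \<Rightarrow> nat" assume \<sigma>: "in_dom W \<sigma>"
      show "ref_match (RBind u \<alpha>) Y (\<lambda>v. cnt W (\<sigma> (p v))) (\<lambda>v. cnt W (\<sigma> (q v))) W (\<sigma> a) (\<sigma> b) \<longleftrightarrow>
        ref_match \<alpha> (Y - {u}) (\<lambda>v. cnt W (\<sigma> (p v))) (\<lambda>v. cnt W (\<sigma> (q v))) W (\<sigma> a) (\<sigma> b) \<and>
        (u \<notin> Y \<or> cnt W (\<sigma> (p u)) = cnt W (\<sigma> a) \<and> cnt W (\<sigma> (q u)) = cnt W (\<sigma> b))"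
        using ref_match_RBind[OF _ RBind.prems(2), of "\<sigma> a"] in_dom_bounds[OF \<sigma>] by auto
    qed
  qed
qed

section \<open>Core spanners\<close>

text \<open>Spans are described by arbitrary positions, not only by endpoint elements: position \<open>x\<close> stands for
  the span endpoint \<open>cnt W x + 1\<close>. The variables \<open>p v\<close> and \<open>q v\<close> hold the opening and the closing
  endpoint of the spanner variable \<open>v\<close>.\<close>

definition tup :: "'v set \<Rightarrow> ('v \<Rightarrow> nat) \<Rightarrow> ('v \<Rightarrow> nat) \<Rightarrow> 'a wstruct \<Rightarrow> (nat \<Rightarrow> nat) \<Rightarrow> ('v \<rightharpoonup> span)" where
  "tup V p q W \<sigma> = (\<lambda>v. if v \<in> V then Some (cnt W (\<sigma> (p v)) + 1, cnt W (\<sigma> (q v)) + 1) else None)"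

lemma dom_tup [simp]: "dom (tup V p q W \<sigma>) = V"
  by (auto simp: tup_def split: if_splits)

lemma tup_restrict: "Y \<subseteq> V \<Longrightarrow> tup V p q W \<sigma> |` Y = tup Y p q W \<sigma>"
  by (auto simp: tup_def restrict_map_def fun_eq_iff)

lemma finite_regex_vars: "finite (regex_vars \<alpha>)"
  by (induction \<alpha>) auto

text \<open>When a projection discards variables, nothing but \<open>P\<close> itself guarantees
  that their spans lie within the word and hence have positions.\<close>

lemma core_spanner_valid:
  assumes "core_spanner V P"
  shows "finite V \<and> (\<forall>w. \<forall>\<mu>\<in>P w. dom \<mu> = V \<and>
    (\<forall>v i j. \<mu> v = Some (i, j) \<longrightarrow> i \<in> {1..length w + 1} \<and> j \<in> {1..length w + 1}))"
  using assms
proof (induction rule: core_spanner.induct)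
  case (regex \<alpha>)
  have "dom \<mu> = regex_vars \<alpha> \<and>
      (\<forall>v i j. \<mu> v = Some (i, j) \<longrightarrow> i \<in> {1..length w + 1} \<and> j \<in> {1..length w + 1})"
    if \<mu>: "\<mu> \<in> regex_spanner \<alpha> w" for w \<mu>
  proof -
    from \<mu> obtain r where r: "clr r = w" "is_ref_tuple (regex_vars \<alpha>) r \<mu>"
      unfolding regex_spanner_def by blast
    have d: "dom \<mu> = regex_vars \<alpha>" using r(2) by (simp add: is_ref_tuple_def)
    have "i \<in> {1..length w + 1} \<and> j \<in> {1..length w + 1}" if "\<mu> v = Some (i, j)" for v i j
    proof -
      have "v \<in> regex_vars \<alpha>" using d that by blast
      with r(2) obtain r1 r2 r3 where "r = r1 @ [Open v] @ r2 @ [Close v] @ r3"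
        "\<mu> v = Some (length (clr r1) + 1, length (clr (r1 @ r2)) + 1)"
        unfolding is_ref_tuple_def by blast
      then show ?thesis using that r(1) by auto
    qed
    with d show ?thesis by blast
  qed
  then show ?case using finite_regex_vars by blast
next
  case (projection V P Y)
  show ?case
  proof (intro conjI allI ballI impI)
    show "finite Y" using projection.IH projection.hyps(2) finite_subset by blast
    fix w \<mu> assume "\<mu> \<in> (\<lambda>\<mu>. \<mu> |` Y) ` P w"
    then obtain \<nu> where \<nu>: "\<mu> = \<nu> |` Y" "\<nu> \<in> P w" by blast
    then show "dom \<mu> = Y" using projection.IH projection.hyps(2) by auto
    fix v i j assume "\<mu> v = Some (i, j)"
    then have "\<nu> v = Some (i, j)" using \<nu>(1) by (simp add: restrict_map_def split: if_splits)
    then show "i \<in> {1..length w + 1}" "j \<in> {1..length w + 1}"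
      using \<nu>(2) projection.IH by blast+
  qed
next
  case (join V1 P1 V2 P2)
  show ?case
  proof (intro conjI allI ballI impI)
    show "finite (V1 \<union> V2)" using join.IH by blast
    fix w \<mu> assume \<mu>: "\<mu> \<in> {\<mu>. dom \<mu> = V1 \<union> V2 \<and> \<mu> |` V1 \<in> P1 w \<and> \<mu> |` V2 \<in> P2 w}"
    then show "dom \<mu> = V1 \<union> V2" by blast
    fix v i j assume v: "\<mu> v = Some (i, j)"
    then have "v \<in> V1 \<or> v \<in> V2" using \<mu> by blast
    then have "(\<mu> |` V1) v = Some (i, j) \<or> (\<mu> |` V2) v = Some (i, j)"
      using v by (auto simp: restrict_map_def)
    then show "i \<in> {1..length w + 1}" "j \<in> {1..length w + 1}"
      using \<mu> join.IH by blast+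
  qed
next
  case (union V P1 P2)
  then show ?case by (metis UnE)
next
  case (selection V P x y)
  then show ?case by (metis (no_types, lifting) mem_Collect_eq)
qed

lemma core_spanner_finite: "core_spanner V P \<Longrightarrow> finite V"
  using core_spanner_valid by blast

lemma core_spanner_dom: "core_spanner V P \<Longrightarrow> \<mu> \<in> P w \<Longrightarrow> dom \<mu> = V"
  using core_spanner_valid by metis

lemma core_spanner_bounds:
  assumes "core_spanner V P" "\<mu> \<in> P w" "\<mu> v = Some (i, j)"
  shows "1 \<le> i" "i \<le> length w + 1" "1 \<le> j" "j \<le> length w + 1"
  using core_spanner_valid[OF assms(1)] assms(2,3) by auto

lemma mdef_regex_spanner:
  fixes \<alpha> :: "('a::finite, 'v) regex_formula"
  assumes "functional \<alpha>"
  shows "mdef (\<lambda>W \<sigma>. tup (regex_vars \<alpha>) p q W \<sigma> \<in> regex_spanner \<alpha> (ws_word W))"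
proof -
  let ?V = "regex_vars \<alpha>"
  let ?M = "\<lambda>(W :: 'a wstruct) \<sigma>. ref_match \<alpha> ?V (\<lambda>v. cnt W (\<sigma> (p v))) (\<lambda>v. cnt W (\<sigma> (q v))) W"
  have one: "count_list r (Open v) = 1" if "v \<in> ?V" "r \<in> ref_words \<alpha>" for v r
    using assms that by (simp add: functional_def)
  have "finite (p ` ?V \<union> q ` ?V)" using finite_regex_vars by blast
  \<comment> \<open>\<open>N\<close> and \<open>Suc N\<close> are fresh; they will denote the first
    position and \<open>$\<close>, the ends of the interval of the whole word.\<close>
  then obtain N where N: "\<forall>u\<in>p ` ?V \<union> q ` ?V. u < N"
    using finite_nat_set_iff_bounded by blast
  then have "p v < N \<and> q v < N" if "v \<in> ?V" for v
    using that by blast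
  then have ne: "p v \<noteq> N" "p v \<noteq> Suc N" "q v \<noteq> N" "q v \<noteq> Suc N" if "v \<in> ?V" for v
    using that by fastforce+
  have "mdef (\<lambda>W \<sigma>. \<sigma> N = 1 \<and> \<sigma> (Suc N) = ws_dollar W \<and> ?M W \<sigma> (\<sigma> N) (\<sigma> (Suc N)))"
    by (intro mdef_and mdef_first mdef_dollar mdef_ref_match finite_regex_vars one)
  from mdef_ex[OF mdef_ex[OF this, of "Suc N"], of N] show ?thesis
  proof (rule mdef_cong)
    fix W :: "'a wstruct" and \<sigma> :: "nat \<Rightarrow> nat"
    let ?\<tau> = "\<lambda>d d'. \<sigma>(N := d, Suc N := d')"
    have M: "?M W (?\<tau> d d') x y \<longleftrightarrow> ?M W \<sigma> x y" for d d' x y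
      using ne by (intro ref_match_cong) simp
    have d: "1 \<in> ws_dom W" "ws_dollar W \<in> ws_dom W" by (simp_all add: ws_dom_def ws_dollar_def)
    have "tup ?V p q W \<sigma> \<in> regex_spanner \<alpha> (ws_word W) \<longleftrightarrow> ?M W \<sigma> 1 (ws_dollar W)"
    proof -
      have "is_ref_tuple ?V r (tup ?V p q W \<sigma>) \<longleftrightarrow>
          (\<forall>v\<in>?V. cnt W (\<sigma> (p v)) = cnt W 1 + opos r v \<and> cnt W (\<sigma> (q v)) = cnt W 1 + cpos r v)"
        if "r \<in> ref_words \<alpha>" for r
        using is_ref_tuple_iff[OF that one, of ?V "tup ?V p q W \<sigma>"] that
        by (simp only: dom_tup) (simp add: tup_def)
      then show ?thesis
        unfolding regex_spanner_def ref_match_def seg_full by (auto simp: ws_dollar_def)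
    qed
    also have "\<dots> \<longleftrightarrow> (\<exists>d\<in>ws_dom W. \<exists>d'\<in>ws_dom W. d = 1 \<and> d' = ws_dollar W \<and> ?M W \<sigma> d d')"
      using d by blast
    also have "\<dots> \<longleftrightarrow> (\<exists>d\<in>ws_dom W. \<exists>d'\<in>ws_dom W. ?\<tau> d d' N = 1 \<and> ?\<tau> d d' (Suc N) = ws_dollar W \<and>
        ?M W (?\<tau> d d') (?\<tau> d d' N) (?\<tau> d d' (Suc N)))"
      unfolding M by simp
    finally show "tup ?V p q W \<sigma> \<in> regex_spanner \<alpha> (ws_word W) \<longleftrightarrow> \<dots>" .
  qed
qed

text \<open>A discarded spanner variable needs two formula variables of its own. Even and odd
  offsets above \<open>N\<close>, spread by the injective \<open>g\<close>, keep them apart from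
  each other and from those in use; their values come from \<open>ex_cnt\<close>.\<close>

lemma ex_projection_valuation:
  assumes P: "core_spanner V P" and Y: "Y \<subseteq> V" and \<sigma>: "in_dom W \<sigma>" and \<mu>: "\<mu> \<in> P (ws_word W)"
    and eq: "\<mu> |` Y = tup Y p q W \<sigma>"
    and g: "inj_on g (V - Y)" and N: "\<And>v. v \<in> Y \<Longrightarrow> p v < N \<and> q v < (N :: nat)"
  defines "p' \<equiv> \<lambda>v. if v \<in> Y then p v else N + 2 * g v"
    and "q' \<equiv> \<lambda>v. if v \<in> Y then q v else Suc (N + 2 * g v)"
  shows "\<exists>\<tau>. in_dom W \<tau> \<and> (\<forall>u. u \<notin> p' ` (V - Y) \<union> q' ` (V - Y) \<longrightarrow> \<tau> u = \<sigma> u) \<and> tup V p' q' W \<tau> = \<mu>"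
proof -
  let ?w = "ws_word W"
  have dom: "dom \<mu> = V" by (rule core_spanner_dom[OF P \<mu>])
  have "\<exists>a b. a \<in> ws_dom W \<and> b \<in> ws_dom W \<and> \<mu> v = Some (cnt W a + 1, cnt W b + 1)" if "v \<in> V" for v
  proof -
    from that dom obtain i j where ij: "\<mu> v = Some (i, j)" by (metis domD surj_pair)
    note bd = core_spanner_bounds[OF P \<mu> ij]
    have "i - 1 \<le> length ?w" "j - 1 \<le> length ?w" using bd by simp_all
    then obtain a b where "a \<in> ws_dom W" "cnt W a = i - 1" "b \<in> ws_dom W" "cnt W b = j - 1"
      using ex_cnt by metis
    then show ?thesis using ij bd by (intro exI[of _ a] exI[of _ b]) simp
  qed
  then obtain A B where AB: "\<And>v. v \<in> V \<Longrightarrow>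
      A v \<in> ws_dom W \<and> B v \<in> ws_dom W \<and> \<mu> v = Some (cnt W (A v) + 1, cnt W (B v) + 1)"
    by metis
  \<comment> \<open>\<open>k\<close> recovers the spanner variable from either of its formula
    variables, since integer division erases the parity.\<close>
  define k where "k u = inv_into (V - Y) g ((u - N) div 2)" for u
  define \<tau> where "\<tau> u = (if u \<in> p' ` (V - Y) then A (k u) else if u \<in> q' ` (V - Y) then B (k u) else \<sigma> u)" for u
  have k: "k (p' v) = v" "k (q' v) = v" if "v \<in> V - Y" for v
    using that g by (simp_all add: k_def p'_def q'_def)
  have \<tau>1: "\<tau> (p' v) = A v" if "v \<in> V - Y" for v
    using that k by (simp add: \<tau>_def)
  have \<tau>2: "\<tau> (q' v) = B v" if "v \<in> V - Y" for v
  proof -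
    have "q' v \<noteq> p' v'" if "v' \<in> V - Y" for v'
      using that \<open>v \<in> V - Y\<close> by (simp add: p'_def q'_def) presburger
    then have "q' v \<notin> p' ` (V - Y)" by blast
    then show ?thesis using that k by (simp add: \<tau>_def)
  qed
  have \<tau>3: "\<tau> (p v) = \<sigma> (p v)" "\<tau> (q v) = \<sigma> (q v)" if "v \<in> Y" for v
    using N[OF that] by (auto simp: \<tau>_def p'_def q'_def)
  have "in_dom W \<tau>"
    unfolding in_dom_def \<tau>_def using AB k \<sigma> by (auto simp: in_dom_def)
  moreover have "\<forall>u. u \<notin> p' ` (V - Y) \<union> q' ` (V - Y) \<longrightarrow> \<tau> u = \<sigma> u" by (simp add: \<tau>_def)
  moreover have "tup V p' q' W \<tau> v = \<mu> v" for v
  proof -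
    consider "v \<in> Y" | "v \<in> V - Y" | "v \<notin> V" by blast
    then show ?thesis
    proof cases
      case 1
      have "\<mu> v = tup Y p q W \<sigma> v" using fun_cong[OF eq, of v] 1 by simp
      then show ?thesis using 1 Y \<tau>3 by (auto simp: tup_def p'_def q'_def)
    next
      case 2
      then show ?thesis using AB[of v] \<tau>1 \<tau>2 by (simp add: tup_def)
    next
      case 3
      then have "\<mu> v = None" using dom by blast
      with 3 show ?thesis by (simp add: tup_def)
    qed
  qed
  ultimately show ?thesis by blast
qed

lemma mdef_core_spanner:
  fixes P :: "('a::finite, 'v) spanner_fun"
  assumes "core_spanner V P"
  shows "mdef (\<lambda>W \<sigma>. tup V p q W \<sigma> \<in> P (ws_word W))"
  using assms
proof (induction arbitrary: p q rule: core_spanner.induct)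
  case (regex \<alpha>)
  then show ?case by (rule mdef_regex_spanner)
next
  case (union V P1 P2)
  show ?case using mdef_or[OF union.IH] by (rule mdef_cong) simp
next
  case (projection V P Y)
  have fin: "finite V" by (rule core_spanner_finite[OF projection.hyps(1)])
  then have "finite (p ` Y \<union> q ` Y)" using projection.hyps(2) finite_subset by blast
  then obtain N where "\<forall>u\<in>p ` Y \<union> q ` Y. u < N"
    using finite_nat_set_iff_bounded by blast
  then have N: "p v < N \<and> q v < N" if "v \<in> Y" for v using that by blast
  have "finite (V - Y)" using fin by simp
  then obtain g :: "'v \<Rightarrow> nat" where g: "inj_on g (V - Y)"
    using finite_imp_inj_to_nat_seg by blast
  define p' where "p' = (\<lambda>v. if v \<in> Y then p v else N + 2 * g v)"
  define q' where "q' = (\<lambda>v. if v \<in> Y then q v else Suc (N + 2 * g v))"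
  let ?Z = "p' ` (V - Y) \<union> q' ` (V - Y)"
  have "finite ?Z" using fin by simp
  from mdef_exs[OF this projection.IH[of p' q']] show ?case
  proof (rule mdef_cong)
    fix W :: "'a wstruct" and \<sigma> :: "nat \<Rightarrow> nat" assume \<sigma>: "in_dom W \<sigma>"
    show "tup Y p q W \<sigma> \<in> (\<lambda>\<mu>. \<mu> |` Y) ` P (ws_word W) \<longleftrightarrow>
      (\<exists>\<tau>. in_dom W \<tau> \<and> (\<forall>u. u \<notin> ?Z \<longrightarrow> \<tau> u = \<sigma> u) \<and> tup V p' q' W \<tau> \<in> P (ws_word W))" (is "?L \<longleftrightarrow> ?R")
    proof
      assume ?L
      then obtain \<mu> where \<mu>: "\<mu> \<in> P (ws_word W)" "\<mu> |` Y = tup Y p q W \<sigma>" by force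
      from ex_projection_valuation[OF projection.hyps \<sigma> \<mu> g N, folded p'_def q'_def] \<mu>(1)
      show ?R by metis
    next
      assume ?R
      then obtain \<tau> where \<tau>: "\<forall>u. u \<notin> ?Z \<longrightarrow> \<tau> u = \<sigma> u" "tup V p' q' W \<tau> \<in> P (ws_word W)" by blast
      have "u \<notin> ?Z" if "u < N" for u
        using that by (auto simp: p'_def q'_def)
      then have "\<tau> (p v) = \<sigma> (p v) \<and> \<tau> (q v) = \<sigma> (q v)" if "v \<in> Y" for v
        using \<tau>(1) N[OF that] by blast
      then have "tup V p' q' W \<tau> |` Y = tup Y p q W \<sigma>"
        unfolding tup_restrict[OF projection.hyps(2)] by (auto simp: tup_def p'_def q'_def)
      with \<tau>(2) show ?L by (metis image_eqI)
    qed
  qed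
next
  case (join V1 P1 V2 P2)
  \<comment> \<open>Restricting \<open>tup\<close> yields the \<open>tup\<close> of the smaller
    variable set over the same formula variables, so the operands share variables exactly as the
    join demands.\<close>
  show ?case using mdef_and[OF join.IH] by (rule mdef_cong) (simp add: tup_restrict)
next
  case (selection V P x y)
  have "mdef (\<lambda>W \<sigma>. tup V p q W \<sigma> \<in> P (ws_word W) \<and>
      seg W (\<sigma> (p x)) (\<sigma> (q x)) = seg W (\<sigma> (p y)) (\<sigma> (q y)))"
    by (intro mdef_and selection.IH mdef_seg_eq)
  then show ?case
  proof (rule mdef_cong)
    fix W :: "'a wstruct" and \<sigma> :: "nat \<Rightarrow> nat" assume "in_dom W \<sigma>"
    then have "factor (ws_word W) (the (tup V p q W \<sigma> v)) = seg W (\<sigma> (p v)) (\<sigma> (q v))" if "v \<in> V" for v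
      using that factor_cnt[of "\<sigma> (p v)" W "\<sigma> (q v)"] by (simp add: tup_def in_dom_def)
    with selection.hyps show "tup V p q W \<sigma> \<in> {\<mu> \<in> P (ws_word W).
        factor (ws_word W) (the (\<mu> x)) = factor (ws_word W) (the (\<mu> y))} \<longleftrightarrow>
      tup V p q W \<sigma> \<in> P (ws_word W) \<and> seg W (\<sigma> (p x)) (\<sigma> (q x)) = seg W (\<sigma> (p y)) (\<sigma> (q y))"
      by simp
  qed
qed

lemma card_symbol_elements:
  "x \<le> length W \<Longrightarrow> card {i \<in> symbol_elements W. i \<le> x} = length (ws_word (take x W))"
proof (induction x)
  case 0
  have "{i \<in> symbol_elements W. i \<le> 0} = {}" by (auto simp: symbol_elements_alt)
  then show ?case by (simp only: card.empty) simp
next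
  case (Suc x)
  have t: "take (Suc x) W = take x W @ [W ! x]" using Suc.prems by (simp add: take_Suc_conv_app_nth)
  have fin: "finite {i \<in> symbol_elements W. i \<le> x}" by simp
  have "{i \<in> symbol_elements W. i \<le> Suc x} =
      (if W ! x = None then {i \<in> symbol_elements W. i \<le> x} else insert (Suc x) {i \<in> symbol_elements W. i \<le> x})"
    using Suc.prems by (auto simp: symbol_elements_alt le_Suc_eq)
  then show ?case using Suc fin by (auto simp: t ws_word_Cons)
qed

text \<open>For a symbol-element the 1 arises because \<open>pos\<close> counts it and
  \<open>cnt\<close> does not; for \<open>$\<close> it is the step beyond the last symbol.\<close>

lemma endpoint_pos_cnt:
  assumes "x \<in> endpoint_elements W"
  shows "endpoint_pos W x = cnt W x + 1"
proof (cases "x = ws_dollar W")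
  case True
  then show ?thesis using seg_full[of W] by (simp add: endpoint_pos_def cnt_def)
next
  case False
  then have x: "x \<in> symbol_elements W" using assms by (simp add: endpoint_elements_def)
  then have b: "1 \<le> x" "x \<le> length W" "W ! (x - 1) \<noteq> None" by (auto simp: symbol_elements_alt)
  have "length (seg W x (Suc x)) = 1" using b by (auto simp: seg_Suc)
  then have "cnt W (Suc x) = cnt W x + 1" using cnt_add[of x "Suc x" W] b by simp
  moreover have "pos W x = cnt W (Suc x)"
    using card_symbol_elements[OF b(2)] by (simp add: pos_def cnt_def seg_def)
  ultimately show ?thesis using False by (simp add: endpoint_pos_def)
qed

lemma endpoint_elements_subset: "endpoint_elements W \<subseteq> ws_dom W"
  by (auto simp: endpoint_elements_def symbol_elements_alt ws_dom_def ws_dollar_def)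

theorem theorem3p13:
  fixes P :: "('a::finite, 'v) spanner_fun" and V :: "'v set" and xs :: "'v list"
  assumes "core_spanner V P"
    and "distinct xs" and "set xs = V"
  shows "spanner_rel xs P \<in> DynCQ (2 * length xs)"
proof -
  let ?n = "length xs"
  \<comment> \<open>\<open>ix v\<close> is the index of \<open>v\<close> in \<open>xs\<close>, so
    \<open>p v\<close> and \<open>q v\<close> are the places of its two endpoints in the tuple
    \<open>js\<close>.\<close>
  define ix where "ix v = inv_into {..<?n} ((!) xs) v" for v
  have ix: "ix (xs ! i) = i" if "i < ?n" for i
    using that inj_on_nth[OF assms(2), of "{..<?n}"] by (simp add: ix_def)
  define p where "p v = 2 * ix v" for v
  define q where "q v = 2 * ix v + 1" for v
  \<comment> \<open>Up to here any position could represent a span endpoint; the first conjunct now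
    selects the representatives allowed in the spanner relation.\<close>
  have "mdef (\<lambda>W \<sigma>. (\<forall>u\<in>{..<2 * ?n}. \<sigma> u \<in> endpoint_elements W) \<and> tup V p q W \<sigma> \<in> P (ws_word W))"
    by (intro mdef_and mdef_Ball mdef_end mdef_core_spanner assms(1)) simp
  then have "(\<lambda>W. {js. js \<in> spanner_rel xs P W}) \<in> DynCQ (2 * ?n)"
  proof (rule mdef_DynCQ)
    fix W :: "'a wstruct" and \<sigma> :: "nat \<Rightarrow> nat"
    let ?js = "map \<sigma> [0..<2 * ?n]"
    have "(\<exists>\<mu>\<in>P (ws_word W). \<forall>i<?n. \<mu> (xs ! i) =
          Some (endpoint_pos W (?js ! (2 * i)), endpoint_pos W (?js ! (2 * i + 1)))) \<longleftrightarrow>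
        tup V p q W \<sigma> \<in> P (ws_word W)"
      if e: "\<forall>u\<in>{..<2 * ?n}. \<sigma> u \<in> endpoint_elements W"
    proof -
      have val: "Some (endpoint_pos W (?js ! (2 * i)), endpoint_pos W (?js ! (2 * i + 1))) =
          tup V p q W \<sigma> (xs ! i)" if "i < ?n" for i
        using that e assms(3) by (auto simp: tup_def p_def q_def ix endpoint_pos_cnt)
      \<comment> \<open>The tuple of endpoints determines \<open>\<mu>\<close> on \<open>V\<close>,
        and outside \<open>V\<close> both maps are undefined.\<close>
      have "\<mu> = tup V p q W \<sigma>"
        if "\<mu> \<in> P (ws_word W)" "\<forall>i<?n. \<mu> (xs ! i) = tup V p q W \<sigma> (xs ! i)" for \<mu>
      proof
        fix v
        have "dom \<mu> = V" by (rule core_spanner_dom[OF assms(1) that(1)])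
        then have "v \<notin> V \<Longrightarrow> \<mu> v = None" "v \<notin> V \<Longrightarrow> tup V p q W \<sigma> v = None"
          by (auto simp: tup_def)
        moreover have "v \<in> V \<Longrightarrow> \<exists>i<?n. v = xs ! i"
          using assms(3) by (auto simp: in_set_conv_nth)
        ultimately show "\<mu> v = tup V p q W \<sigma> v"
          using that(2) by metis
      qed
      then show ?thesis using val by auto
    qed
    moreover have "set ?js \<subseteq> endpoint_elements W \<longleftrightarrow> (\<forall>u\<in>{..<2 * ?n}. \<sigma> u \<in> endpoint_elements W)"
      by auto
    ultimately show "?js \<in> spanner_rel xs P W \<longleftrightarrow>
        (\<forall>u\<in>{..<2 * ?n}. \<sigma> u \<in> endpoint_elements W) \<and> tup V p q W \<sigma> \<in> P (ws_word W)"
      unfolding spanner_rel_def by auto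
  next
    fix W :: "'a wstruct" and js assume "js \<in> spanner_rel xs P W"
    then show "js \<in> tuples (2 * ?n) W"
      using endpoint_elements_subset[of W] by (auto simp: spanner_rel_def tuples_def)
  qed
  then show ?thesis by simp
qed

end
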